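(* Let $\mathcal D=(V,E,F)$ be a simply connected quad-graph all of whose interior vertices have even degree, and let $f:V\to\mathbb{RP}^3$ be a generic discrete A-net. Then there exists a 1-parameter family of pre-hyperbolic nets with underlying A-net $f$, and each such net is determined by the choice of one initial hyperboloid. That is: for every face $Q\in F$ and every hyperboloid $\mathcal H$ containing the four discrete asymptotic lines associated with the edges of $Q$ (these hyperboloids form a 1-parameter family), there is exactly one pre-hyperbolic net with underlying A-net $f$ whose hyperboloid at $Q$ is $\mathcal H$.
   Context: A quad-graph $\mathcal D=(V,E,F)$ is a strongly regular polytopal cell decomposition of a surface (possibly with boundary) all of whose faces are quadrilaterals; $V,E,F$ are the sets of vertices, edges and faces. (Strongly regular: the closed cells are embedded and any two closed cells intersect in a single closed cell or not at all.) It is simply connected if the surface is. An interior vertex is a vertex not on the boundary of the surface. The vertex star of $v\in V$ consists of $v$ and all vertices adjacent to $v$. A discrete A-net is a map $f:V\to\mathbb{RP}^3$ such that for every $v\in V$ the image of the vertex star of $v$ is contained in a plane $P(v)$. For an edge $e=(v,w)$, the line $\ell_e$ through $f(v)$ and $f(w)$ is called the discrete asymptotic line of $e$. The A-net is generic if (a) the discrete asymptotic lines of two distinct edges with a common vertex are distinct, and (b) the discrete asymptotic lines of two edges without a common vertex are skew (disjoint). A hyperboloid is a (nondegenerate) doubly ruled quadric in $\mathbb{RP}^3$; the lines contained in it are its asymptotic lines. A pre-hyperbolic net with underlying generic A-net $f$ is an assignment of a hyperboloid $\mathcal H_Q$ to every face $Q\in F$ such that (i) for every $Q\in F$ the four discrete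 asymptotic lines of the edges of $Q$ are asymptotic lines of $\mathcal H_Q$; (ii) if $Q,Q'\in F$ share an edge $e$, then $\mathcal H_Q$ and $\mathcal H_{Q'}$ have the same tangent plane at every point of the line $\ell_e$. *)

theory Defs
  imports "HOL-Analysis.Analysis"
begin

section \<open>Surfaces\<close>

text \<open>
  A space is a subset \<open>S\<close> of a type of class \<open>t2_space\<close>, with the subspace topology. As every
  Hausdorff space is of this form (with \<open>S = UNIV\<close>), this is no restriction.
\<close>

definition closed_half_plane :: "complex set"
  where "closed_half_plane = {z. 0 \<le> Im z}"

text \<open>
  Two-dimensional topological manifolds, possibly with boundary. Charts around points off the
  boundary are covered, since a small open disc is also relatively open in the half-plane.
\<close>

definition surface :: "'a::t2_space set \<Rightarrow> bool"
  where "surface S \<longleftrightarrow>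
    (\<exists>B. countable B \<and> (\<forall>b\<in>B. openin (top_of_set S) b) \<and>
         (\<forall>U x. openin (top_of_set S) U \<and> x \<in> U \<longrightarrow> (\<exists>b\<in>B. x \<in> b \<and> b \<subseteq> U))) \<and>
    (\<forall>x\<in>S. \<exists>U W. openin (top_of_set S) U \<and> x \<in> U \<and>
         openin (top_of_set closed_half_plane) W \<and> U homeomorphic W)"

text \<open>The points of the surface that do not lie on its boundary.\<close>

definition surface_interior :: "'a::t2_space set \<Rightarrow> 'a set"
  where "surface_interior S =
    {x\<in>S. \<exists>U (W :: complex set). openin (top_of_set S) U \<and> x \<in> U \<and> open W \<and> U homeomorphic W}"


section \<open>Quad-graphs\<close>

text \<open>
  Vertices are points of the surface; edges and faces are closed cells, given as point sets.
  A vertex \<open>v\<close> is an endpoint of the edge \<open>e\<close> iff \<open>v \<in> e\<close>, and \<open>e\<close> is an edge of the face \<open>Q\<close> iff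
  \<open>e \<subseteq> Q\<close>.
\<close>

definition edge_cell :: "'a::t2_space set \<Rightarrow> 'a set \<Rightarrow> bool"
  where "edge_cell V e \<longleftrightarrow>
    (\<exists>g. arc g \<and> path_image g = e \<and> e \<inter> V = {pathstart g, pathfinish g})"

definition square_corners :: "complex set"
  where "square_corners = {0, 1, Complex 1 1, \<i>}"

definition square_sides :: "complex set set"
  where "square_sides =
    {closed_segment 0 1, closed_segment 1 (Complex 1 1),
     closed_segment (Complex 1 1) \<i>, closed_segment \<i> 0}"

text \<open>
  A quadrilateral is a closed unit square embedded in the surface in such a way that its corners are
  vertices, its sides are edges, and its interior meets no vertex and no edge.
\<close>

definition quad_cell :: "'a::t2_space set \<Rightarrow> 'a set set \<Rightarrow> 'a set \<Rightarrow> bool"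
  where "quad_cell V E Q \<longleftrightarrow>
    (\<exists>h k. homeomorphism (cbox 0 (Complex 1 1)) Q h k \<and>
       h ` square_corners \<subseteq> V \<and>
       (\<forall>s\<in>square_sides. h ` s \<in> E) \<and>
       h ` box 0 (Complex 1 1) \<inter> (V \<union> \<Union>E) = {})"

definition closed_cells :: "'a set \<Rightarrow> 'a set set \<Rightarrow> 'a set set \<Rightarrow> 'a set set"
  where "closed_cells V E F = (\<lambda>v. {v}) ` V \<union> E \<union> F"

text \<open>
  The assumptions \<open>edge_cells\<close>, \<open>quad_cells\<close>, \<open>edges_disjoint\<close> and \<open>faces_disjoint\<close> together say that
  the open cells are pairwise disjoint. Infinite decompositions are allowed, but, as for any cell
  decomposition of a manifold, they are locally finite.
\<close>

locale quad_graph =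
  fixes S :: "'a::t2_space set" and V :: "'a set" and E F :: "'a set set"
  assumes surface: "surface S"
    and cover: "\<Union>(closed_cells V E F) = S"
    and edge_cells: "\<And>e. e \<in> E \<Longrightarrow> edge_cell V e"
    and quad_cells: "\<And>Q. Q \<in> F \<Longrightarrow> quad_cell V E Q"
    and edges_disjoint: "\<And>e e'. e \<in> E \<Longrightarrow> e' \<in> E \<Longrightarrow> e \<noteq> e' \<Longrightarrow> e \<inter> e' \<subseteq> V"
    and faces_disjoint: "\<And>Q Q'. Q \<in> F \<Longrightarrow> Q' \<in> F \<Longrightarrow> Q \<noteq> Q' \<Longrightarrow> Q \<inter> Q' \<subseteq> \<Union>E"
    and locally_finite: "\<And>x. x \<in> S \<Longrightarrow>
      \<exists>U. openin (top_of_set S) U \<and> x \<in> U \<and> finite {c \<in> closed_cells V E F. c \<inter> U \<noteq> {}}"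
    and strongly_regular: "\<And>c d. c \<in> closed_cells V E F \<Longrightarrow> d \<in> closed_cells V E F \<Longrightarrow>
      c \<inter> d = {} \<or> c \<inter> d \<in> closed_cells V E F"

definition vertex_degree :: "'a set set \<Rightarrow> 'a \<Rightarrow> nat"
  where "vertex_degree E v = card {e\<in>E. v \<in> e}"

definition vertex_star :: "'a set \<Rightarrow> 'a set set \<Rightarrow> 'a \<Rightarrow> 'a set"
  where "vertex_star V E v = insert v {w. \<exists>e\<in>E. e \<inter> V = {v, w}}"


section \<open>Real projective 3-space\<close>

text \<open>
  Projective points, lines and planes are the linear subspaces of \<open>\<real>\<^sup>4\<close> of dimension 1, 2 and 3;
  incidence is inclusion. A point set in projective space is a set of one-dimensional subspaces.
\<close>

definition proj_points :: "(real^4) set set"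
  where "proj_points = {p. subspace p \<and> dim p = 1}"

definition proj_lines :: "(real^4) set set"
  where "proj_lines = {L. subspace L \<and> dim L = 2}"

definition proj_planes :: "(real^4) set set"
  where "proj_planes = {P. subspace P \<and> dim P = 3}"

definition points_on :: "(real^4) set \<Rightarrow> (real^4) set set"
  where "points_on X = {p\<in>proj_points. p \<subseteq> X}"


section \<open>Hyperboloids\<close>

definition quadric :: "real^4^4 \<Rightarrow> (real^4) set set"
  where "quadric A = {p\<in>proj_points. \<forall>x\<in>p. x \<bullet> (A *v x) = 0}"

definition doubly_ruled :: "(real^4) set set \<Rightarrow> bool"
  where "doubly_ruled H \<longleftrightarrow> H \<noteq> {} \<and>
    (\<forall>p\<in>H. \<exists>L\<in>proj_lines. \<exists>M\<in>proj_lines. L \<noteq> M \<and> p \<subseteq> L \<and> p \<subseteq> M \<and>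
       points_on L \<subseteq> H \<and> points_on M \<subseteq> H)"

definition hyperboloid :: "(real^4) set set \<Rightarrow> bool"
  where "hyperboloid H \<longleftrightarrow>
    (\<exists>A. transpose A = A \<and> invertible A \<and> H = quadric A) \<and> doubly_ruled H"

definition asymptotic_line :: "(real^4) set set \<Rightarrow> (real^4) set \<Rightarrow> bool"
  where "asymptotic_line H L \<longleftrightarrow> L \<in> proj_lines \<and> points_on L \<subseteq> H"

text \<open>
  The form \<open>x \<bullet> (A *v x)\<close> has gradient \<open>2 *\<^sub>R (A *v x)\<close>, so its tangent plane at the point spanned
  by \<open>x\<close> is \<open>{y. y \<bullet> (A *v x) = 0}\<close>. The matrix \<open>A\<close> of a hyperboloid is unique up to a nonzero
  factor, which does not affect that plane. Only used for hyperboloids \<open>H\<close> and points \<open>p \<in> H\<close>.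
\<close>

definition tangent_plane :: "(real^4) set set \<Rightarrow> (real^4) set \<Rightarrow> (real^4) set"
  where "tangent_plane H p =
    (THE T. \<exists>A. transpose A = A \<and> invertible A \<and> H = quadric A \<and>
                T = {y. \<forall>x\<in>p. y \<bullet> (A *v x) = 0})"

text \<open>
  A 1-parameter family of hyperboloids: injectively parametrised by the members \<open>A + t *\<^sub>R B\<close>,
  \<open>t \<noteq> 0\<close>, of a pencil of quadrics (the two members \<open>A\<close> and \<open>B\<close> of the pencil being left out).
\<close>

definition one_parameter_family :: "(real^4) set set set \<Rightarrow> bool"
  where "one_parameter_family \<H> \<longleftrightarrow>
    (\<exists>A B. transpose A = A \<and> transpose B = B \<and>
       bij_betw (\<lambda>t::real. quadric (A + t *\<^sub>R B)) (- {0}) \<H>)"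


section \<open>Discrete A-nets and pre-hyperbolic nets\<close>

definition discrete_A_net :: "'a set \<Rightarrow> 'a set set \<Rightarrow> ('a \<Rightarrow> (real^4) set) \<Rightarrow> bool"
  where "discrete_A_net V E f \<longleftrightarrow>
    (\<forall>v\<in>V. f v \<in> proj_points) \<and>
    (\<forall>v\<in>V. \<exists>P\<in>proj_planes. \<forall>w\<in>vertex_star V E v. f w \<subseteq> P)"

text \<open>For an edge \<open>e\<close> with endpoints \<open>v\<close> and \<open>w\<close> this is the join of \<open>f v\<close> and \<open>f w\<close>.\<close>

definition discrete_asymptotic_line ::
    "'a set \<Rightarrow> ('a \<Rightarrow> (real^4) set) \<Rightarrow> 'a set \<Rightarrow> (real^4) set"
  where "discrete_asymptotic_line V f e = span (\<Union>v \<in> e \<inter> V. f v)"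

text \<open>
  The first clause makes explicit that every edge does have a discrete asymptotic line, i.e. that
  \<open>f\<close> takes distinct values at the endpoints of an edge.
\<close>

definition generic_A_net :: "'a set \<Rightarrow> 'a set set \<Rightarrow> ('a \<Rightarrow> (real^4) set) \<Rightarrow> bool"
  where "generic_A_net V E f \<longleftrightarrow>
    discrete_A_net V E f \<and>
    (\<forall>e\<in>E. discrete_asymptotic_line V f e \<in> proj_lines) \<and>
    (\<forall>e\<in>E. \<forall>e'\<in>E. e \<noteq> e' \<and> e \<inter> e' \<inter> V \<noteq> {} \<longrightarrow>
       discrete_asymptotic_line V f e \<noteq> discrete_asymptotic_line V f e') \<and>
    (\<forall>e\<in>E. \<forall>e'\<in>E. e \<inter> e' \<inter> V = {} \<longrightarrow>
       points_on (discrete_asymptotic_line V f e) \<inter>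
       points_on (discrete_asymptotic_line V f e') = {})"

definition face_hyperboloids ::
    "'a set \<Rightarrow> 'a set set \<Rightarrow> ('a \<Rightarrow> (real^4) set) \<Rightarrow> 'a set \<Rightarrow> (real^4) set set set"
  where "face_hyperboloids V E f Q =
    {H. hyperboloid H \<and>
        (\<forall>e\<in>E. e \<subseteq> Q \<longrightarrow> asymptotic_line H (discrete_asymptotic_line V f e))}"

text \<open>
  A net assigns hyperboloids to the faces only; being \<open>extensional\<close> makes it a function on \<open>F\<close>, so
  that equality of nets means equality on all faces.
\<close>

definition pre_hyperbolic_net ::
    "'a set \<Rightarrow> 'a set set \<Rightarrow> 'a set set \<Rightarrow> ('a \<Rightarrow> (real^4) set) \<Rightarrow>
     ('a set \<Rightarrow> (real^4) set set) \<Rightarrow> bool"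
  where "pre_hyperbolic_net V E F f \<N> \<longleftrightarrow>
    \<N> \<in> extensional F \<and>
    (\<forall>Q\<in>F. \<N> Q \<in> face_hyperboloids V E f Q) \<and>
    (\<forall>Q\<in>F. \<forall>Q'\<in>F. \<forall>e\<in>E. e \<subseteq> Q \<and> e \<subseteq> Q' \<longrightarrow>
       (\<forall>p \<in> points_on (discrete_asymptotic_line V f e).
          tangent_plane (\<N> Q) p = tangent_plane (\<N> Q') p))"

end

theory Submission
  imports Defs
begin

text \<open>
  Idea. Let the quadric of \<open>A\<close> contain the four lines of a face with corners \<open>a, b, c, d\<close>. Then \<open>A a\<close> is a
  multiple \<open>\<alpha>\<close> of a fixed normal vector of the vertex plane at \<open>a\<close>, and likewise \<open>A b\<close> with a factor \<open>\<beta>\<close>. The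
  tangent planes along the edge \<open>a b\<close> are determined by the ratio \<open>\<beta> / \<alpha>\<close>, which takes every nonzero value
  exactly once in the family of hyperboloids of the face. Measured with an area form on the vertex plane
  modulo \<open>a\<close>, this ratio merely changes its sign from one edge of a face at \<open>a\<close> to the other, because
  \<open>b \<bullet> A d = d \<bullet> A b\<close>. So the tangency conditions around a vertex are consistent iff the edges there have a
  two-colouring in which the two edges of every face differ. The edges at a vertex form a path or a cycle;
  invariance of domain excludes a cycle at a boundary vertex, and at an interior vertex the cycle has even
  length. Hence the hyperboloids form a local system, which has no monodromy on a simply connected surface.
\<close>

section \<open>Local systems on simply connected spaces\<close>

text \<open>Simple connectivity is given through homotopies of loops in \<open>S\<close>, whereas
  hyperboloids propagate from face to face. To avoid approximating homotopies by sequences of faces,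
  the data are attached to points: a germ at \<open>x\<close> is a compatible choice of hyperboloids
  on the faces containing \<open>x\<close> only. By local finiteness, points near \<open>x\<close>
  lie on no further faces, so germs restrict to nearby points. This restriction is bijective,
  because a germ is determined by its value on one face and any such value extends. Hence there is
  unique lifting along paths and homotopies, as for a covering space.

  The cost lies at the vertices, the only points where the existence of a germ is a genuine
  condition. That the faces there form a single path or cycle is not part of the definition of a
  cell decomposition: connectedness comes from the punctured half-disc in a chart, and the bound of
  two faces per edge from the fact that collars of two faces already fill a neighbourhood.\<close>

locale local_system =
  fixes S :: "'a::topological_space set"
    and C :: "'a \<Rightarrow> 'i set"
    and G :: "'a \<Rightarrow> ('i \<Rightarrow> 'h) set"
  assumes index_nbhd: "x \<in> S \<Longrightarrow> \<exists>U. openin (top_of_set S) U \<and> x \<in> U \<and> (\<forall>y\<in>U. C y \<subseteq> C x)"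
    and index_nonempty: "x \<in> S \<Longrightarrow> C x \<noteq> {}"
    and germ_extensional: "x \<in> S \<Longrightarrow> g \<in> G x \<Longrightarrow> g \<in> extensional (C x)"
    and germ_restrict: "x \<in> S \<Longrightarrow> y \<in> S \<Longrightarrow> C y \<subseteq> C x \<Longrightarrow> g \<in> G x \<Longrightarrow> restrict g (C y) \<in> G y"
    and germ_extend: "x \<in> S \<Longrightarrow> y \<in> S \<Longrightarrow> C y \<subseteq> C x \<Longrightarrow> g \<in> G y \<Longrightarrow> \<exists>g'\<in>G x. restrict g' (C y) = g"
    and germ_eqI: "x \<in> S \<Longrightarrow> i \<in> C x \<Longrightarrow> g \<in> G x \<Longrightarrow> g' \<in> G x \<Longrightarrow> g i = g' i \<Longrightarrow> g = g'"
begin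

text \<open>A lift of \<open>\<phi>\<close> to the space of germs, with continuity spelled out so
  that this space needs no topology of its own: near \<open>k\<close> the germ must be the
  restriction of the one at \<open>k\<close>. The domain is an arbitrary space, so that the notion
  covers paths as well as homotopies.\<close>

definition section_along :: "'b::topological_space set \<Rightarrow> ('b \<Rightarrow> 'a) \<Rightarrow> ('b \<Rightarrow> 'i \<Rightarrow> 'h) \<Rightarrow> bool"
  where "section_along K \<phi> \<sigma> \<longleftrightarrow>
    (\<forall>k\<in>K. \<sigma> k \<in> G (\<phi> k) \<and>
      (\<exists>T. open T \<and> k \<in> T \<and>
        (\<forall>l\<in>K \<inter> T. C (\<phi> l) \<subseteq> C (\<phi> k) \<and> \<sigma> l = restrict (\<sigma> k) (C (\<phi> l)))))"

lemma section_along_subset: "section_along K \<phi> \<sigma> \<Longrightarrow> L \<subseteq> K \<Longrightarrow> section_along L \<phi> \<sigma>"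
  unfolding section_along_def
proof (intro ballI)
  fix k assume H: "\<forall>k\<in>K. \<sigma> k \<in> G (\<phi> k) \<and> (\<exists>T. open T \<and> k \<in> T \<and>
      (\<forall>l\<in>K \<inter> T. C (\<phi> l) \<subseteq> C (\<phi> k) \<and> \<sigma> l = restrict (\<sigma> k) (C (\<phi> l))))"
    and "L \<subseteq> K" "k \<in> L"
  then obtain T where "\<sigma> k \<in> G (\<phi> k)" "open T" "k \<in> T"
    "\<forall>l\<in>K \<inter> T. C (\<phi> l) \<subseteq> C (\<phi> k) \<and> \<sigma> l = restrict (\<sigma> k) (C (\<phi> l))" by blast
  moreover have "L \<inter> T \<subseteq> K \<inter> T" using \<open>L \<subseteq> K\<close> by blast
  ultimately show "\<sigma> k \<in> G (\<phi> k) \<and> (\<exists>T. open T \<and> k \<in> T \<and>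
      (\<forall>l\<in>L \<inter> T. C (\<phi> l) \<subseteq> C (\<phi> k) \<and> \<sigma> l = restrict (\<sigma> k) (C (\<phi> l))))"
    by (meson subsetD)
qed

lemma section_along_cong:
  "section_along K \<phi> \<sigma> \<Longrightarrow> (\<And>k. k \<in> K \<Longrightarrow> \<phi> k = \<psi> k) \<Longrightarrow> (\<And>k. k \<in> K \<Longrightarrow> \<sigma> k = \<tau> k) \<Longrightarrow>
   section_along K \<psi> \<tau>"
  unfolding section_along_def by simp

lemma section_along_compose:
  assumes "section_along K \<phi> \<sigma>" "continuous_on L h" "h ` L \<subseteq> K"
  shows "section_along L (\<lambda>l. \<phi> (h l)) (\<lambda>l. \<sigma> (h l))"
  unfolding section_along_def
proof (intro ballI conjI)
  fix l assume l: "l \<in> L"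
  then have hl: "h l \<in> K" using assms(3) by auto
  then show "\<sigma> (h l) \<in> G (\<phi> (h l))" using assms(1) unfolding section_along_def by blast
  obtain T where T: "open T" "h l \<in> T"
    "\<forall>k\<in>K \<inter> T. C (\<phi> k) \<subseteq> C (\<phi> (h l)) \<and> \<sigma> k = restrict (\<sigma> (h l)) (C (\<phi> k))"
    using assms(1) hl unfolding section_along_def by blast
  obtain W where W: "open W" "W \<inter> L = h -` T \<inter> L"
    using assms(2) T(1) unfolding continuous_on_open_invariant by blast
  show "\<exists>T. open T \<and> l \<in> T \<and> (\<forall>k\<in>L \<inter> T. C (\<phi> (h k)) \<subseteq> C (\<phi> (h l)) \<and>
      \<sigma> (h k) = restrict (\<sigma> (h l)) (C (\<phi> (h k))))"
  proof (intro exI[of _ W] conjI ballI)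
    show "l \<in> W" using W l T(2) by blast
    fix k assume "k \<in> L \<inter> W"
    then have "h k \<in> K \<inter> T" using W assms(3) by blast
    then show "C (\<phi> (h k)) \<subseteq> C (\<phi> (h l))" "\<sigma> (h k) = restrict (\<sigma> (h l)) (C (\<phi> (h k)))"
      using T(3) by auto
  qed (use W in auto)
qed

lemma section_along_local:
  assumes "\<And>k. k \<in> K \<Longrightarrow> \<exists>W. open W \<and> k \<in> W \<and> section_along (K \<inter> W) \<phi> \<sigma>"
  shows "section_along K \<phi> \<sigma>"
  unfolding section_along_def
proof (intro ballI conjI)
  fix k assume k: "k \<in> K"
  then obtain W where W: "open W" "k \<in> W" "section_along (K \<inter> W) \<phi> \<sigma>" using assms by blast
  then show "\<sigma> k \<in> G (\<phi> k)" using k unfolding section_along_def by blast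
  obtain T where "open T" "k \<in> T"
    "\<forall>l\<in>K \<inter> W \<inter> T. C (\<phi> l) \<subseteq> C (\<phi> k) \<and> \<sigma> l = restrict (\<sigma> k) (C (\<phi> l))"
    using W k unfolding section_along_def by blast
  then show "\<exists>T. open T \<and> k \<in> T \<and>
      (\<forall>l\<in>K \<inter> T. C (\<phi> l) \<subseteq> C (\<phi> k) \<and> \<sigma> l = restrict (\<sigma> k) (C (\<phi> l)))"
    using W by (intro exI[of _ "W \<inter> T"]) auto
qed

text \<open>The source of explicit sections: one function on indices, cut down to the indices over
  each point. Continuity of \<open>\<phi>\<close> keeps nearby points inside the neighbourhood where
  \<open>C\<close> does not grow.\<close>

lemma section_along_restrict:
  assumes "continuous_on K \<phi>" "\<phi> ` K \<subseteq> S" "\<And>k. k \<in> K \<Longrightarrow> restrict N (C (\<phi> k)) \<in> G (\<phi> k)"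
  shows "section_along K \<phi> (\<lambda>k. restrict N (C (\<phi> k)))"
  unfolding section_along_def
proof (intro ballI conjI)
  fix k assume k: "k \<in> K"
  obtain U where U: "openin (top_of_set S) U" "\<phi> k \<in> U" "\<forall>y\<in>U. C y \<subseteq> C (\<phi> k)"
    using index_nbhd k assms(2) by (meson imageI subsetD)
  have "openin (top_of_set K) (K \<inter> \<phi> -` U)"
    using assms(1,2) U(1) continuous_openin_preimage by (metis image_subset_iff_funcset)
  then obtain T where T: "open T" "K \<inter> \<phi> -` U = K \<inter> T" by (auto simp: openin_open)
  show "\<exists>T. open T \<and> k \<in> T \<and> (\<forall>l\<in>K \<inter> T. C (\<phi> l) \<subseteq> C (\<phi> k) \<and>
      restrict N (C (\<phi> l)) = restrict (restrict N (C (\<phi> k))) (C (\<phi> l)))"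
  proof (intro exI[of _ T] conjI ballI)
    show "k \<in> T" using T k U(2) by blast
    fix l assume "l \<in> K \<inter> T"
    then have "\<phi> l \<in> U" using T by blast
    then show sub: "C (\<phi> l) \<subseteq> C (\<phi> k)" using U(3) by blast
    show "restrict N (C (\<phi> l)) = restrict (restrict N (C (\<phi> k))) (C (\<phi> l))"
      using sub by (auto simp: restrict_def fun_eq_iff)
  qed (use T in auto)
qed (use assms(3) in auto)

lemma section_along_germ:
  assumes "continuous_on K \<phi>" "\<phi> ` K \<subseteq> S" "x \<in> S" "g \<in> G x" "\<And>k. k \<in> K \<Longrightarrow> C (\<phi> k) \<subseteq> C x"
  shows "section_along K \<phi> (\<lambda>k. restrict g (C (\<phi> k)))"
  using assms germ_restrict by (intro section_along_restrict) auto

text \<open>The identity principle: near every point of the connected domain, agreement at one point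
  gives agreement at all others. The upward direction uses \<open>germ_eqI\<close>: an index over
  \<open>\<phi> l\<close> is also one over \<open>\<phi> k\<close>, and agreement at this single
  index forces equality of the germs at \<open>k\<close>.\<close>

lemma section_along_unique:
  assumes "connected K" "\<phi> ` K \<subseteq> S" "section_along K \<phi> \<sigma>" "section_along K \<phi> \<tau>"
    and "a \<in> K" "\<sigma> a = \<tau> a" "b \<in> K"
  shows "\<sigma> b = \<tau> b"
proof (rule connected_induction_simple[OF assms(1) assms(5) assms(7), where P = "\<lambda>k. \<sigma> k = \<tau> k"])
  fix k assume k: "k \<in> K"
  obtain T where T: "open T" "k \<in> T"
      "\<forall>l\<in>K \<inter> T. C (\<phi> l) \<subseteq> C (\<phi> k) \<and> \<sigma> l = restrict (\<sigma> k) (C (\<phi> l))"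
    using assms(3) k unfolding section_along_def by blast
  obtain T' where T': "open T'" "k \<in> T'"
      "\<forall>l\<in>K \<inter> T'. C (\<phi> l) \<subseteq> C (\<phi> k) \<and> \<tau> l = restrict (\<tau> k) (C (\<phi> l))"
    using assms(4) k unfolding section_along_def by blast
  have in_G: "\<sigma> k \<in> G (\<phi> k)" "\<tau> k \<in> G (\<phi> k)"
    using assms(3,4) k unfolding section_along_def by blast+
  have "\<sigma> k = \<tau> k" if l: "l \<in> K \<inter> (T \<inter> T')" and eq: "\<sigma> l = \<tau> l" for l
  proof -
    have "\<phi> l \<in> S" "\<phi> k \<in> S" using l k assms(2) by auto
    then obtain i where i: "i \<in> C (\<phi> l)" using index_nonempty by fast
    have "restrict (\<sigma> k) (C (\<phi> l)) i = restrict (\<tau> k) (C (\<phi> l)) i" using l eq T(3) T'(3) by auto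
    then have "\<sigma> k i = \<tau> k i" using i by simp
    then show ?thesis
      using germ_eqI[OF \<open>\<phi> k \<in> S\<close> _ in_G] i l T(3) by blast
  qed
  then have "\<forall>x\<in>K \<inter> (T \<inter> T'). \<forall>y\<in>K \<inter> (T \<inter> T'). \<sigma> x = \<tau> x \<longrightarrow> \<sigma> y = \<tau> y"
    using T(3) T'(3) by (metis IntD1 IntD2 IntI)
  moreover have "openin (top_of_set K) (K \<inter> (T \<inter> T'))" using T T' by (simp add: openin_open_Int open_Int)
  ultimately show "\<exists>T. openin (top_of_set K) T \<and> k \<in> T \<and> (\<forall>x\<in>T. \<forall>y\<in>T. \<sigma> x = \<tau> x \<longrightarrow> \<sigma> y = \<tau> y)"
    using T T' k by blast
qed (rule assms(6))

lemma section_along_const: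
  assumes "\<And>k. k \<in> K \<Longrightarrow> \<phi> k = x" "x \<in> S" "g \<in> G x"
  shows "section_along K \<phi> (\<lambda>k. g)"
proof -
  have eq: "restrict g (C x) = g" using germ_extensional assms by (simp add: extensional_restrict)
  show ?thesis
    by (rule section_along_cong[OF section_along_germ[where K = K and \<phi> = "\<lambda>k. x" and x = x and g = g]])
      (use assms eq in \<open>auto\<close>)
qed

section \<open>Gluing of sections and lifting of homotopies\<close>

lemma section_along_glue:
  assumes "closed A" "closed B"
    and \<sigma>: "section_along (K \<inter> A) \<phi> \<sigma>" and \<tau>: "section_along (K \<inter> B) \<phi> \<tau>"
    and "K \<subseteq> A \<union> B" and eq: "\<And>k. k \<in> K \<inter> A \<inter> B \<Longrightarrow> \<sigma> k = \<tau> k"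
  shows "section_along K \<phi> (\<lambda>k. if k \<in> A then \<sigma> k else \<tau> k)" (is "section_along K \<phi> ?\<rho>")
  unfolding section_along_def
proof (intro ballI conjI)
  fix k assume k: "k \<in> K"
  show "?\<rho> k \<in> G (\<phi> k)" using k assms(3-5) unfolding section_along_def by auto
  have "\<exists>T. open T \<and> k \<in> T \<and> (\<forall>l\<in>K \<inter> A \<inter> T. C (\<phi> l) \<subseteq> C (\<phi> k) \<and> \<sigma> l = restrict (?\<rho> k) (C (\<phi> l)))"
  proof (cases "k \<in> A")
    case True
    then show ?thesis using \<sigma> k unfolding section_along_def by auto
  qed (use assms(1) in \<open>auto intro!: exI[of _ "-A"]\<close>)
  then obtain T where T: "open T" "k \<in> T"
    "\<forall>l\<in>K \<inter> A \<inter> T. C (\<phi> l) \<subseteq> C (\<phi> k) \<and> \<sigma> l = restrict (?\<rho> k) (C (\<phi> l))" by blast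
  have "\<exists>T. open T \<and> k \<in> T \<and> (\<forall>l\<in>K \<inter> B \<inter> T. C (\<phi> l) \<subseteq> C (\<phi> k) \<and> \<tau> l = restrict (?\<rho> k) (C (\<phi> l)))"
  proof (cases "k \<in> B")
    case True
    then have "?\<rho> k = \<tau> k" using eq k by auto
    then show ?thesis using \<tau> k True unfolding section_along_def by auto
  qed (use assms(2) in \<open>auto intro!: exI[of _ "-B"]\<close>)
  then obtain T' where T': "open T'" "k \<in> T'"
    "\<forall>l\<in>K \<inter> B \<inter> T'. C (\<phi> l) \<subseteq> C (\<phi> k) \<and> \<tau> l = restrict (?\<rho> k) (C (\<phi> l))" by blast
  show "\<exists>T. open T \<and> k \<in> T \<and> (\<forall>l\<in>K \<inter> T. C (\<phi> l) \<subseteq> C (\<phi> k) \<and> ?\<rho> l = restrict (?\<rho> k) (C (\<phi> l)))"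
  proof (intro exI[of _ "T \<inter> T'"] conjI ballI)
    fix l assume l: "l \<in> K \<inter> (T \<inter> T')"
    then have "l \<in> A \<or> (l \<notin> A \<and> l \<in> B)" using assms(5) by auto
    then show "C (\<phi> l) \<subseteq> C (\<phi> k)" "?\<rho> l = restrict (?\<rho> k) (C (\<phi> l))"
      using T(3) T'(3) l by auto
  qed (use T T' in auto)
qed

text \<open>Homotopy lifting near \<open>s0\<close>. The property \<open>P t\<close>, that a lift up
  to time \<open>t\<close> exists on some tube around \<open>s0\<close>, is locally constant in
  \<open>t\<close>; connectedness of the unit interval replaces a subdivision argument. The width of
  the tube may shrink at each step.\<close>

lemma section_along_tube:
  fixes K :: "real set" and \<phi> :: "real \<times> real \<Rightarrow> 'a"
  assumes "convex K" "s0 \<in> K" and cont: "continuous_on (K \<times> {0..1}) \<phi>"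
    and img: "\<phi> ` (K \<times> {0..1}) \<subseteq> S" and \<sigma>0: "section_along K (\<lambda>s. \<phi> (s, 0)) \<sigma>0"
  shows "\<exists>\<delta>>0. \<exists>\<sigma>. section_along ((K \<inter> ball s0 \<delta>) \<times> {0..1}) \<phi> \<sigma> \<and>
    (\<forall>s\<in>K \<inter> ball s0 \<delta>. \<sigma> (s, 0) = \<sigma>0 s)"
proof -
  define P where "P t \<longleftrightarrow> (\<exists>\<delta>>0. \<exists>\<sigma>. section_along ((K \<inter> ball s0 \<delta>) \<times> {0..t}) \<phi> \<sigma> \<and>
    (\<forall>s\<in>K \<inter> ball s0 \<delta>. \<sigma> (s, 0) = \<sigma>0 s))" for t :: real
  have "P 1"
  proof (rule connected_induction_simple[where S = "{0..1::real}" and a = 0 and P = P])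
    have "section_along ((K \<inter> ball s0 1) \<times> {0..0}) (\<lambda>x. \<phi> (fst x, 0)) (\<lambda>x. \<sigma>0 (fst x))"
      by (rule section_along_compose[OF \<sigma>0]) (auto intro!: continuous_intros)
    then have "section_along ((K \<inter> ball s0 1) \<times> {0..0}) \<phi> (\<lambda>x. \<sigma>0 (fst x))"
      by (rule section_along_cong) auto
    then show "P 0" unfolding P_def by (intro exI[of _ 1] conjI exI[of _ "\<lambda>x. \<sigma>0 (fst x)"]) auto
  next
    fix a :: real assume a: "a \<in> {0..1}"
    define x where "x = \<phi> (s0, a)"
    have x: "x \<in> S" using img a assms(2) unfolding x_def by auto
    obtain U where U: "openin (top_of_set S) U" "x \<in> U" "\<forall>y\<in>U. C y \<subseteq> C x"
      using index_nbhd[OF x] by auto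
    have "openin (top_of_set (K \<times> {0..1})) ((K \<times> {0..1}) \<inter> \<phi> -` U)"
      using cont img U(1) continuous_openin_preimage by (metis image_subset_iff_funcset)
    then obtain W where W: "open W" "(K \<times> {0..1}) \<inter> \<phi> -` U = (K \<times> {0..1}) \<inter> W"
      by (auto simp: openin_open)
    have "(s0, a) \<in> W" using W(2) U(2) a assms(2) unfolding x_def by blast
    then obtain A B where AB: "open A" "open B" "(s0, a) \<in> A \<times> B" "A \<times> B \<subseteq> W"
      using W(1) open_prod_elim by metis
    obtain e1 where e1: "e1 > 0" "ball s0 e1 \<subseteq> A" using AB open_contains_ball by blast
    obtain e2 where e2: "e2 > 0" "ball a e2 \<subseteq> B" using AB open_contains_ball by blast
    have inU: "\<phi> (s, t) \<in> U" if "s \<in> K \<inter> ball s0 e1" "t \<in> {0..1} \<inter> ball a e2" for s t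
      using that e1 e2 AB W by blast
    have step: "P t'" if t: "t \<in> {0..1} \<inter> ball a e2" "t' \<in> {0..1} \<inter> ball a e2" and Pt: "P t" for t t'
    proof -
      obtain \<delta> \<sigma> where \<delta>: "\<delta> > 0" and \<sigma>: "section_along ((K \<inter> ball s0 \<delta>) \<times> {0..t}) \<phi> \<sigma>"
        and start: "\<forall>s\<in>K \<inter> ball s0 \<delta>. \<sigma> (s, 0) = \<sigma>0 s" using Pt unfolding P_def by auto
      show ?thesis
      proof (cases "t' \<le> t")
        case True
        then have "section_along ((K \<inter> ball s0 \<delta>) \<times> {0..t'}) \<phi> \<sigma>"
          by (intro section_along_subset[OF \<sigma>]) auto
        then show ?thesis unfolding P_def using \<delta> start by auto
      next
        case False
        define d where "d = min \<delta> e1"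
        define J where "J = K \<inter> ball s0 d"
        have d: "d > 0" using \<delta> e1 unfolding d_def by auto
        have Jsub: "J \<subseteq> K \<inter> ball s0 \<delta>" "J \<subseteq> K \<inter> ball s0 e1" "s0 \<in> J"
          using assms(2) d unfolding J_def d_def by auto
        have "convex J" unfolding J_def using assms(1) by (intro convex_Int convex_ball)
        have seg: "{t..t'} \<subseteq> {0..1} \<inter> ball a e2"
          using t by (auto simp: dist_real_def abs_if split: if_splits)
        have "\<phi> (s0, t) \<in> U" by (rule inU) (use Jsub t in auto)
        have "(s0, t) \<in> (K \<inter> ball s0 \<delta>) \<times> {0..t}" using Jsub t by auto
        then have "\<sigma> (s0, t) \<in> G (\<phi> (s0, t))" using \<sigma> unfolding section_along_def by blast
        moreover have "C (\<phi> (s0, t)) \<subseteq> C x" using U(3) \<open>\<phi> (s0, t) \<in> U\<close> by blast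
        moreover have "\<phi> (s0, t) \<in> S" using img assms(2) t by auto
        \<comment> \<open>The germ reached at time \<open>t\<close> is extended to the centre
          \<open>x\<close> of the neighbourhood; its restrictions then serve all points of the box
          at once.\<close>
        ultimately obtain g where g: "g \<in> G x" "restrict g (C (\<phi> (s0, t))) = \<sigma> (s0, t)"
          using germ_extend[OF x] by blast
        define \<tau> where "\<tau> k = restrict g (C (\<phi> k))" for k
        have sub: "J \<times> {t..t'} \<subseteq> K \<times> {0..1}" using Jsub t by auto
        have \<tau>: "section_along (J \<times> {t..t'}) \<phi> \<tau>"
          unfolding \<tau>_def
        proof (rule section_along_germ[OF _ _ x g(1)])
          show "continuous_on (J \<times> {t..t'}) \<phi>" using cont sub continuous_on_subset by blast
          show "\<phi> ` (J \<times> {t..t'}) \<subseteq> S" using sub img by blast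
          show "C (\<phi> k) \<subseteq> C x" if k: "k \<in> J \<times> {t..t'}" for k
          proof -
            obtain s u where "k = (s, u)" "s \<in> J" "u \<in> {t..t'}" using k by blast
            then have "\<phi> k \<in> U" using inU[of s u] seg Jsub by blast
            then show ?thesis using U(3) by blast
          qed
        qed
        \<comment> \<open>Equality is known by construction at \<open>(s0, t)\<close> only; it
          spreads over the slice because \<open>J\<close> is convex, hence connected.\<close>
        have eq: "\<sigma> k = \<tau> k" if "k \<in> J \<times> {t}" for k
        proof (rule section_along_unique[where K = "J \<times> {t}" and a = "(s0, t)"])
          show "connected (J \<times> {t})"
            using \<open>convex J\<close> by (intro convex_connected convex_Times) auto
          show "\<phi> ` (J \<times> {t}) \<subseteq> S" using img Jsub t by (auto simp: image_subset_iff subset_eq)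
          show "section_along (J \<times> {t}) \<phi> \<sigma>" by (rule section_along_subset[OF \<sigma>]) (use Jsub t in auto)
          show "section_along (J \<times> {t}) \<phi> \<tau>" by (rule section_along_subset[OF \<tau>]) (use False in auto)
        qed (use that g Jsub in \<open>auto simp: \<tau>_def\<close>)
        have "section_along (J \<times> {0..t'}) \<phi> (\<lambda>k. if k \<in> UNIV \<times> {..t} then \<sigma> k else \<tau> k)"
        proof (rule section_along_glue[where B = "UNIV \<times> {t..}"])
          have "J \<times> {0..t'} \<inter> UNIV \<times> {..t} = J \<times> {0..t}" "J \<times> {0..t'} \<inter> UNIV \<times> {t..} = J \<times> {t..t'}"
            using False t by auto
          then show "section_along (J \<times> {0..t'} \<inter> UNIV \<times> {..t}) \<phi> \<sigma>"
            "section_along (J \<times> {0..t'} \<inter> UNIV \<times> {t..}) \<phi> \<tau>"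
            using \<tau> section_along_subset[OF \<sigma>, of "J \<times> {0..t}"] Jsub(1) by (simp_all add: Sigma_mono)
          show "\<sigma> k = \<tau> k" if "k \<in> J \<times> {0..t'} \<inter> UNIV \<times> {..t} \<inter> UNIV \<times> {t..}" for k
            using that by (intro eq) auto
        qed (auto intro!: closed_Times)
        then show ?thesis unfolding P_def J_def using d t start Jsub
          by (intro exI[of _ d] conjI exI[of _ "\<lambda>k. if k \<in> UNIV \<times> {..t} then \<sigma> k else \<tau> k"])
            (auto simp: J_def)
      qed
    qed
    have "openin (top_of_set {0..1}) ({0..1} \<inter> ball a e2)" by (simp add: openin_open_Int)
    then show "\<exists>T. openin (top_of_set {0..1}) T \<and> a \<in> T \<and> (\<forall>x\<in>T. \<forall>y\<in>T. P x \<longrightarrow> P y)"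
      using step a e2(1) by (intro exI[of _ "{0..1} \<inter> ball a e2"] conjI ballI impI) (blast, simp, blast)
  qed auto
  then show ?thesis unfolding P_def .
qed

text \<open>A path is a homotopy over a one-point parameter set, so the tube lemma for the set
  \<open>{0}\<close> already gives its lift.\<close>

lemma section_along_path_exists:
  assumes "path \<gamma>" "path_image \<gamma> \<subseteq> S" "g \<in> G (\<gamma> 0)"
  shows "\<exists>\<sigma>. section_along {0..1} \<gamma> \<sigma> \<and> \<sigma> 0 = g"
proof -
  have \<gamma>: "continuous_on {0..1} \<gamma>" "\<gamma> ` {0..1} \<subseteq> S"
    using assms unfolding path_def path_image_def by auto
  have "\<exists>\<delta>>0. \<exists>\<sigma>. section_along (({0::real} \<inter> ball 0 \<delta>) \<times> {0..1}) (\<lambda>x. \<gamma> (snd x)) \<sigma> \<and>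
    (\<forall>s\<in>{0} \<inter> ball 0 \<delta>. \<sigma> (s, 0) = g)"
  proof (rule section_along_tube)
    show "continuous_on ({0::real} \<times> {0..1}) (\<lambda>x. \<gamma> (snd x))"
      by (rule continuous_on_compose2[OF \<gamma>(1)]) (auto intro!: continuous_intros)
    show "section_along {0::real} (\<lambda>s. \<gamma> (snd (s, 0))) (\<lambda>s. g)"
      by (rule section_along_const[of _ _ "\<gamma> 0"]) (use \<gamma>(2) assms(3) in auto)
  qed (use \<gamma>(2) in auto)
  then obtain \<delta> \<sigma> where "\<delta> > 0" "section_along (({0::real} \<inter> ball 0 \<delta>) \<times> {0..1}) (\<lambda>x. \<gamma> (snd x)) \<sigma>"
    "\<forall>s\<in>{0} \<inter> ball 0 \<delta>. \<sigma> (s, 0) = g" by blast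
  then have "section_along {0..1} (\<lambda>t. \<gamma> (snd (0::real, t))) (\<lambda>t. \<sigma> (0, t))"
    by (intro section_along_compose[where h = "\<lambda>t. (0, t)" and \<phi> = "\<lambda>x. \<gamma> (snd x)" and \<sigma> = \<sigma>])
      (auto intro!: continuous_intros)
  moreover have "\<sigma> (0, 0) = g"
    using \<open>\<delta> > 0\<close> \<open>\<forall>s\<in>{0} \<inter> ball 0 \<delta>. \<sigma> (s, 0) = g\<close> by auto
  ultimately  show ?thesis by (intro exI[of _ "\<lambda>t. \<sigma> (0, t)"]) auto
qed

text \<open>The homotopy is free, so the base point moves and its track \<open>h (s, 0)\<close> has
  to be lifted first. When every loop is lifted from there, the end germs form a second lift of the
  same track, since \<open>h (s, 1) = h (s, 0)\<close>. At \<open>s = 1\<close> the loop is constant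
  and the two lifts agree; hence they agree at \<open>s = 0\<close>.\<close>

lemma section_along_null_loop:
  assumes hom: "homotopic_loops S p (\<lambda>_. c)" and \<sigma>: "section_along {0..1} p \<sigma>"
  shows "\<sigma> 1 = \<sigma> 0"
proof -
  obtain h where h: "continuous_on ({0..1::real} \<times> {0..1}) h" "h ` ({0..1} \<times> {0..1}) \<subseteq> S"
    "\<And>t. t \<in> {0..1} \<Longrightarrow> h (0, t) = p t" "\<And>t. t \<in> {0..1} \<Longrightarrow> h (1, t) = c"
    "\<And>s. s \<in> {0..1} \<Longrightarrow> h (s, 1) = h (s, 0)"
  proof -
    obtain h where h: "continuous_on ({0..1::real} \<times> {0..1}) h" "h \<in> ({0..1} \<times> {0..1}) \<rightarrow> S"
      "\<forall>x\<in>{0..1}. h (0, x) = p x" "\<forall>x\<in>{0..1}. h (1, x) = c"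
      "\<forall>t\<in>{0..1}. pathfinish (h \<circ> Pair t) = pathstart (h \<circ> Pair t)"
      using hom unfolding homotopic_loops by blast
    show thesis by (rule that[of h]) (use h in \<open>auto simp: pathfinish_def pathstart_def\<close>)
  qed
  have c: "c \<in> S" using h(2) h(4)[of 0] by force
  have p0: "\<sigma> 0 \<in> G (h (0, 0))" using \<sigma> h(3)[of 0] unfolding section_along_def by auto
  have "path (\<lambda>s. h (s, 0))" unfolding path_def
    by (intro continuous_on_compose2[OF h(1)]) (auto intro!: continuous_intros)
  then obtain \<sigma>0 where \<sigma>0: "section_along {0..1} (\<lambda>s. h (s, 0)) \<sigma>0" "\<sigma>0 0 = \<sigma> 0"
    using section_along_path_exists[of "\<lambda>s. h (s, 0)" "\<sigma> 0"] p0 h(2) unfolding path_image_def by force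
  have "\<exists>\<tau>. section_along {0..1} (\<lambda>t. h (s, t)) \<tau> \<and> \<tau> 0 = \<sigma>0 s" if s: "s \<in> {0..1}" for s
  proof (rule section_along_path_exists)
    show "path (\<lambda>t. h (s, t))" unfolding path_def
      using s by (intro continuous_on_compose2[OF h(1)]) (auto intro!: continuous_intros)
    show "path_image (\<lambda>t. h (s, t)) \<subseteq> S" using s h(2) unfolding path_image_def by auto
    show "\<sigma>0 s \<in> G (h (s, 0))" using \<sigma>0(1) s unfolding section_along_def by blast
  qed
  then obtain \<tau> where \<tau>: "\<And>s. s \<in> {0..1} \<Longrightarrow> section_along {0..1} (\<lambda>t. h (s, t)) (\<tau> s)"
    "\<And>s. s \<in> {0..1} \<Longrightarrow> \<tau> s 0 = \<sigma>0 s" by metis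
  \<comment> \<open>The lifts \<open>\<tau> s\<close> are chosen separately for each
    \<open>s\<close>. Uniqueness identifies them locally with one lift on a tube, and this makes
    their end germs continuous in \<open>s\<close>.\<close>
  have ends: "section_along {0..1} (\<lambda>s. h (s, 0)) (\<lambda>s. \<tau> s 1)"
  proof (rule section_along_local)
    fix s0 :: real assume s0: "s0 \<in> {0..1}"
    obtain \<delta> \<rho> where \<delta>: "\<delta> > 0" and \<rho>: "section_along (({0..1} \<inter> ball s0 \<delta>) \<times> {0..1}) h \<rho>"
      "\<forall>s\<in>{0..1} \<inter> ball s0 \<delta>. \<rho> (s, 0) = \<sigma>0 s"
      using section_along_tube[OF _ s0 h(1,2) \<sigma>0(1)] by auto
    have eq: "\<rho> (s, 1) = \<tau> s 1" if s: "s \<in> {0..1} \<inter> ball s0 \<delta>" for s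
    proof (rule section_along_unique[where K = "{0..1}" and \<phi> = "\<lambda>t. h (s, t)" and a = 0 and \<sigma> = "\<lambda>t. \<rho> (s, t)"])
      show "section_along {0..1} (\<lambda>t. h (s, t)) (\<lambda>t. \<rho> (s, t))"
        by (rule section_along_compose[OF \<rho>(1)]) (use s in \<open>auto intro!: continuous_intros\<close>)
    qed (use s \<rho>(2) \<tau> h(2) in auto)
    have "section_along ({0..1} \<inter> ball s0 \<delta>) (\<lambda>s. h (s, 1)) (\<lambda>s. \<rho> (s, 1))"
      by (rule section_along_compose[OF \<rho>(1)]) (auto intro!: continuous_intros)
    then have "section_along ({0..1} \<inter> ball s0 \<delta>) (\<lambda>s. h (s, 0)) (\<lambda>s. \<tau> s 1)"
      by (rule section_along_cong) (use h(5) eq in auto)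
    then show "\<exists>W. open W \<and> s0 \<in> W \<and> section_along ({0..1} \<inter> W) (\<lambda>s. h (s, 0)) (\<lambda>s. \<tau> s 1)"
      using \<delta> by (intro exI[of _ "ball s0 \<delta>"]) auto
  qed
  have "\<tau> 1 1 = \<sigma>0 1"
  proof (rule section_along_unique[where K = "{0..1::real}" and \<phi> = "\<lambda>t. h (1, t)" and a = 0 and \<sigma> = "\<tau> 1" and \<tau> = "\<lambda>_. \<sigma>0 1"])
    have "\<sigma>0 1 \<in> G (h (1, 0))" using \<sigma>0(1) unfolding section_along_def by auto
    then show "section_along {0..1} (\<lambda>t. h (1, t)) (\<lambda>_. \<sigma>0 1)"
      using h(4) c by (intro section_along_const[of _ _ c]) auto
  qed (use \<tau> h(2) in auto)
  have "\<tau> 0 1 = \<sigma>0 0"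
    by (rule section_along_unique[OF _ _ ends \<sigma>0(1), of 1]) (use h(2) \<open>\<tau> 1 1 = \<sigma>0 1\<close> in auto)
  moreover have "\<tau> 0 1 = \<sigma> 1"
  proof (rule section_along_unique[where K = "{0..1::real}" and \<phi> = p and a = 0 and \<sigma> = "\<tau> 0" and \<tau> = \<sigma>])
    show "section_along {0..1} p (\<tau> 0)"
      by (rule section_along_cong[OF \<tau>(1)]) (use h(3) in auto)
    show "p ` {0..1} \<subseteq> S"
    proof
      fix x assume "x \<in> p ` {0..1}"
      then obtain t where "t \<in> {0..1}" "x = h (0, t)" using h(3) by auto
      then show "x \<in> S" using h(2) by auto
    qed
  qed (use \<tau> \<sigma> \<sigma>0(2) in auto)
  ultimately show ?thesis using \<sigma>0(2) by simp
qed

section \<open>Joined and reversed paths, independence of the path\<close>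

lemma section_along_first_half:
  assumes "section_along {0..1} (p +++ q) \<rho>"
  shows "section_along {0..1} p (\<lambda>t. \<rho> (t / 2))"
proof -
  have "section_along {0..1} (\<lambda>t. (p +++ q) (t / 2)) (\<lambda>t. \<rho> (t / 2))"
    by (rule section_along_compose[OF assms]) (auto intro!: continuous_intros)
  then show ?thesis by (rule section_along_cong) (auto simp: joinpaths_def)
qed

lemma section_along_second_half:
  assumes "section_along {0..1} (p +++ q) \<rho>" "pathfinish p = pathstart q"
  shows "section_along {0..1} q (\<lambda>t. \<rho> ((t + 1) / 2))"
proof -
  have "section_along {0..1} (\<lambda>t. (p +++ q) ((t + 1) / 2)) (\<lambda>t. \<rho> ((t + 1) / 2))"
    by (rule section_along_compose[OF assms(1)]) (auto intro!: continuous_intros)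
  moreover have "(p +++ q) ((t + 1) / 2) = q t" if "t \<in> {0..1}" for t
  proof (cases "t = 0")
    case True
    then show ?thesis using assms(2) by (simp add: joinpaths_def pathfinish_def pathstart_def)
  next
    case False
    then have "\<not> (t + 1) / 2 \<le> 1 / 2" using that by auto
    moreover have "2 * ((t + 1) / 2) - 1 = t" by (simp add: field_simps)
    ultimately show ?thesis by (simp only: joinpaths_def if_False)
  qed
  ultimately show ?thesis by (rule section_along_cong) auto
qed

lemma section_along_reverse:
  assumes "section_along {0..1} (reversepath p) \<rho>"
  shows "section_along {0..1} p (\<lambda>t. \<rho> (1 - t))"
proof -
  have "section_along {0..1} (\<lambda>t. reversepath p (1 - t)) (\<lambda>t. \<rho> (1 - t))"
    by (rule section_along_compose[OF assms]) (auto intro!: continuous_intros)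
  then show ?thesis by (rule section_along_cong) (auto simp: reversepath_def)
qed

text \<open>A section is lifted along \<open>p\<close> followed by \<open>q\<close> backwards. It
  closes up by \<open>section_along_null_loop\<close>, so its halves are the given sections along
  \<open>p\<close> and \<open>q\<close>, and both end germs are read off at time 1/2.\<close>

lemma section_along_path_independent:
  assumes "simply_connected S"
    and p: "path p" "path_image p \<subseteq> S" "section_along {0..1} p \<sigma>"
    and q: "path q" "path_image q \<subseteq> S" "section_along {0..1} q \<tau>"
    and ends: "pathstart p = pathstart q" "pathfinish p = pathfinish q" and start: "\<sigma> 0 = \<tau> 0"
  shows "\<sigma> 1 = \<tau> 1"
proof -
  define l where "l = p +++ reversepath q"
  have l: "path l" "path_image l \<subseteq> S" "pathfinish l = pathstart l"
    using p q ends unfolding l_def by (auto simp: path_image_join)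
  have "p 0 \<in> S" using p(2) unfolding path_image_def by auto
  then have "homotopic_loops S l (\<lambda>_. p 0)"
    using assms(1) l unfolding simply_connected_def
    by (elim allE[of _ l] allE[of _ "\<lambda>_. p 0"]) (auto simp: path_def pathstart_def pathfinish_def path_image_def)
  moreover have "\<sigma> 0 \<in> G (l 0)"
    using p(3) unfolding section_along_def l_def joinpaths_def by auto
  then obtain \<rho> where \<rho>: "section_along {0..1} l \<rho>" "\<rho> 0 = \<sigma> 0"
    using section_along_path_exists l by blast
  ultimately have \<rho>1: "\<rho> 1 = \<sigma> 0" using section_along_null_loop by metis
  have 1: "section_along {0..1} p (\<lambda>t. \<rho> (t / 2))"
    using section_along_first_half \<rho>(1) unfolding l_def by blast
  have 2: "section_along {0..1} q (\<lambda>t. \<rho> ((1 - t + 1) / 2))"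
    using section_along_reverse[OF section_along_second_half] \<rho>(1) ends unfolding l_def by force
  have "\<sigma> 1 = \<rho> (1 / 2)"
    by (rule section_along_unique[OF _ _ p(3) 1, of 0]) (use p(2) \<rho>(2) in \<open>auto simp: path_image_def\<close>)
  moreover have "\<tau> 1 = \<rho> ((1 - 1 + 1) / 2)"
    by (rule section_along_unique[OF _ _ q(3) 2, of 0])
      (use q(2) \<rho>1 start in \<open>auto simp: path_image_def\<close>)
  ultimately show ?thesis by simp
qed

text \<open>Constant loops at \<open>x\<close> and \<open>y\<close> are freely homotopic, and the
  track of the base point joins the two points.\<close>

lemma simply_connected_ex_path:
  assumes "simply_connected S" "x \<in> S" "y \<in> S"
  shows "\<exists>p. path p \<and> path_image p \<subseteq> S \<and> pathstart p = x \<and> pathfinish p = y"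
proof -
  have "homotopic_loops S (\<lambda>_. x) (\<lambda>_. y)"
    using assms unfolding simply_connected_def
    by (elim allE[of _ "\<lambda>_. x"] allE[of _ "\<lambda>_. y"]) (auto simp: path_def pathstart_def pathfinish_def path_image_def)
  then have "path_component S x y"
    using homotopic_loops_imp_path_component_value[of S _ _ 0] by fastforce
  then show ?thesis unfolding path_component_def by auto
qed

text \<open>The germ at \<open>x\<close> is transported from \<open>x0\<close> along any path. To
  assemble a single function, the values at an index \<open>i\<close> of germs at different points
  must agree. This is where path connectedness of the set of points carrying \<open>i\<close>
  enters, since along a path inside that set the value at \<open>i\<close> never changes.\<close>

theorem global_section_exists:
  assumes sc: "simply_connected S"
    and cells: "\<And>i. path_connected {x \<in> S. i \<in> C x}"
    and x0: "x0 \<in> S" and g: "g \<in> G x0"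
  shows "\<exists>N. (\<forall>x\<in>S. restrict N (C x) \<in> G x) \<and> restrict N (C x0) = g"
proof -
  have "\<forall>x\<in>S. \<exists>z. path (fst z) \<and> path_image (fst z) \<subseteq> S \<and> pathstart (fst z) = x0 \<and>
      pathfinish (fst z) = x \<and> section_along {0..1} (fst z) (snd z) \<and> snd z 0 = g"
  proof
    fix x assume "x \<in> S"
    then obtain p where p: "path p" "path_image p \<subseteq> S" "pathstart p = x0" "pathfinish p = x"
      using simply_connected_ex_path[OF sc x0] by blast
    moreover obtain \<sigma> where "section_along {0..1} p \<sigma>" "\<sigma> 0 = g"
      using section_along_path_exists[OF p(1,2)] g p(3) unfolding pathstart_def by blast
    ultimately show "\<exists>z. path (fst z) \<and> path_image (fst z) \<subseteq> S \<and> pathstart (fst z) = x0 \<and>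
      pathfinish (fst z) = x \<and> section_along {0..1} (fst z) (snd z) \<and> snd z 0 = g"
      by (intro exI[of _ "(p, \<sigma>)"]) simp
  qed
  from bchoice[OF this] obtain F where F: "\<forall>x\<in>S. path (fst (F x)) \<and> path_image (fst (F x)) \<subseteq> S \<and>
      pathstart (fst (F x)) = x0 \<and> pathfinish (fst (F x)) = x \<and>
      section_along {0..1} (fst (F x)) (snd (F x)) \<and> snd (F x) 0 = g" ..
  define p where "p x = fst (F x)" for x
  define \<sigma> where "\<sigma> x = snd (F x)" for x
  have p: "path (p x)" "path_image (p x) \<subseteq> S" "pathstart (p x) = x0" "pathfinish (p x) = x"
    and \<sigma>: "section_along {0..1} (p x) (\<sigma> x)" "\<sigma> x 0 = g" if "x \<in> S" for x
    using F that unfolding p_def \<sigma>_def by auto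
  define s where "s x = \<sigma> x 1" for x
  have transport: "\<tau> 1 = s x"
    if "path q" "path_image q \<subseteq> S" "pathstart q = x0" "pathfinish q = x"
      "section_along {0..1} q \<tau>" "\<tau> 0 = g" for q \<tau> x
  proof -
    have x: "x \<in> S" using that by auto
    show ?thesis unfolding s_def
      by (rule section_along_path_independent[OF sc that(1,2,5) p(1)[OF x] p(2)[OF x] \<sigma>(1)[OF x]])
        (use that p[OF x] \<sigma>[OF x] in auto)
  qed
  have s_G: "s x \<in> G x" if "x \<in> S" for x
    using \<sigma>(1)[OF that] p(4)[OF that] unfolding section_along_def pathfinish_def s_def
    by (elim ballE[of _ _ 1]) auto
  have s_x0: "s x0 = g"
    by (rule sym, rule transport[of "\<lambda>_. x0" x0 "\<lambda>_. g"])
      (use x0 section_along_const[of "{0..1}" "\<lambda>_. x0" x0 g] g in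
        \<open>auto simp: path_def pathstart_def pathfinish_def path_image_def\<close>)
  have s_const: "s x i = s y i" if x: "x \<in> S" "i \<in> C x" and y: "y \<in> S" "i \<in> C y" for x y i
  proof -
    obtain r where r: "path r" "path_image r \<subseteq> {x \<in> S. i \<in> C x}" "pathstart r = x" "pathfinish r = y"
      using cells[of i] x y unfolding path_connected_def by blast
    define l where "l = p x +++ r"
    have l: "path l" "path_image l \<subseteq> S" "pathstart l = x0" "pathfinish l = y"
      using p[OF x(1)] r unfolding l_def by (auto simp: path_image_join)
    have "g \<in> G (l 0)" using l(3) g unfolding pathstart_def by simp
    then obtain \<rho> where \<rho>: "section_along {0..1} l \<rho>" "\<rho> 0 = g"
      using section_along_path_exists l by blast
    have 1: "section_along {0..1} (p x) (\<lambda>t. \<rho> (t / 2))"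
      using section_along_first_half \<rho>(1) unfolding l_def by blast
    have 2: "section_along {0..1} r (\<lambda>t. \<rho> ((t + 1) / 2))"
      using section_along_second_half \<rho>(1) p(4)[OF x(1)] r unfolding l_def by blast
    have "\<rho> (1 / 2) = s x"
      by (rule transport[of "p x" x "\<lambda>t. \<rho> (t / 2)"]) (use 1 p[OF x(1)] \<rho> in auto)
    moreover have "\<rho> 1 = s y" by (rule transport[of l y \<rho>]) (use l \<rho> in simp_all)
    \<comment> \<open>Restriction does not affect the value at \<open>i\<close>, because
      \<open>i\<close> stays in \<open>C (r t)\<close>; so this value is locally constant in
      \<open>t\<close>.\<close>
    moreover have "(\<lambda>t. \<rho> ((t + 1) / 2) i) constant_on {0..1}"
    proof (rule locally_constant_imp_constant)
      fix a :: real assume a: "a \<in> {0..1}"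
      obtain T where T: "open T" "a \<in> T"
        "\<forall>t\<in>{0..1} \<inter> T. \<rho> ((t + 1) / 2) = restrict (\<rho> ((a + 1) / 2)) (C (r t))"
        using 2[unfolded section_along_def, THEN bspec, OF a] by (elim conjE exE) simp
      have "i \<in> C (r t)" if "t \<in> {0..1}" for t using r(2) that unfolding path_image_def by blast
      then have "\<forall>t\<in>{0..1} \<inter> T. \<rho> ((t + 1) / 2) i = \<rho> ((a + 1) / 2) i"
        using T(3) by simp
      moreover have "openin (top_of_set {0..1}) ({0..1} \<inter> T)" using T(1) by (rule openin_open_Int)
      ultimately show "\<exists>T. openin (top_of_set {0..1}) T \<and> a \<in> T \<and>
          (\<forall>t\<in>T. \<rho> ((t + 1) / 2) i = \<rho> ((a + 1) / 2) i)"
        using T(2) a by blast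
    qed simp
    then obtain z where "\<forall>t\<in>{0..1}. \<rho> ((t + 1) / 2) i = z" unfolding constant_on_def by blast
    from bspec[OF this, of 1] bspec[OF this, of 0] have "\<rho> 1 i = z" "\<rho> (1 / 2) i = z" by simp_all
    ultimately show ?thesis by simp
  qed
  define N where "N i = s (SOME x. x \<in> S \<and> i \<in> C x) i" for i
  have N: "N i = s x i" if "x \<in> S" "i \<in> C x" for x i
  proof -
    have "(SOME x. x \<in> S \<and> i \<in> C x) \<in> S \<and> i \<in> C (SOME x. x \<in> S \<and> i \<in> C x)"
      by (rule someI[of "\<lambda>x. x \<in> S \<and> i \<in> C x"]) (use that in auto)
    then show ?thesis unfolding N_def using s_const that by blast
  qed
  have N_eq: "restrict N (C x) = s x" if "x \<in> S" for x
    using N that germ_extensional[OF that s_G[OF that]] by (auto simp: extensional_def fun_eq_iff)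
  show ?thesis using N_eq s_G s_x0 x0 by (intro exI[of _ N]) auto
qed

text \<open>Agreement at one index gives equal germs at \<open>x0\<close> by
  \<open>germ_eqI\<close>, and both functions define sections along a path from there to
  \<open>x\<close>.\<close>

theorem global_section_unique:
  assumes sc: "simply_connected S"
    and N: "\<And>x. x \<in> S \<Longrightarrow> restrict N (C x) \<in> G x" and M: "\<And>x. x \<in> S \<Longrightarrow> restrict M (C x) \<in> G x"
    and "x0 \<in> S" "i \<in> C x0" "N i = M i" "x \<in> S" "j \<in> C x"
  shows "N j = M j"
proof -
  obtain p where p: "path p" "path_image p \<subseteq> S" "pathstart p = x0" "pathfinish p = x"
    using simply_connected_ex_path[OF sc] assms by blast
  have img: "p ` {0..1} \<subseteq> S" "continuous_on {0..1} p" using p unfolding path_image_def path_def by auto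
  have sec: "section_along {0..1} p (\<lambda>t. restrict N (C (p t)))" "section_along {0..1} p (\<lambda>t. restrict M (C (p t)))"
    using img N M by (auto intro!: section_along_restrict)
  have "restrict N (C x0) = restrict M (C x0)"
    by (rule germ_eqI[of x0 i]) (use assms in auto)
  have "restrict N (C (p 1)) = restrict M (C (p 1))"
    by (rule section_along_unique[OF _ img(1) sec, of 0])
      (use p \<open>restrict N (C x0) = restrict M (C x0)\<close> in \<open>auto simp: pathstart_def\<close>)
  then show ?thesis using p(4) assms(8) by (metis pathfinish_def restrict_apply')
qed

end

section \<open>Two-colourings of paths and even cycles\<close>

text \<open>Applied to the link of a vertex: the nodes are the edges at the vertex, the arcs are the
  faces, and \<open>ends\<close> gives the two edges of a face there. A longest walk reaches every
  node, and its nodes are coloured alternately. Only an arc joining the first and last node can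
  spoil this; it closes the walk to a cycle, and then \<open>par\<close> forces even length.
  Connectedness is stated for sets of arcs, the form in which the surface provides it.\<close>

lemma two_colouring_of_path_or_cycle:
  fixes arcs :: "'q set" and ends :: "'q \<Rightarrow> 'e set"
  assumes fin: "finite arcs"
    and ends: "\<And>Q. Q \<in> arcs \<Longrightarrow> \<exists>x y. x \<noteq> y \<and> ends Q = {x, y}"
    and deg: "\<And>x. card {Q \<in> arcs. x \<in> ends Q} \<le> 2"
    and conn: "\<And>A. A \<subseteq> arcs \<Longrightarrow> A \<noteq> {} \<Longrightarrow> A \<noteq> arcs \<Longrightarrow>
      \<exists>Q\<in>A. \<exists>Q'\<in>arcs - A. ends Q \<inter> ends Q' \<noteq> {}"
    and par: "even (card (\<Union>(ends ` arcs))) \<or> (\<exists>x\<in>\<Union>(ends ` arcs). card {Q \<in> arcs. x \<in> ends Q} \<le> 1)"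
  shows "\<exists>c :: 'e \<Rightarrow> bool. \<forall>Q\<in>arcs. \<forall>x\<in>ends Q. \<forall>y\<in>ends Q. x \<noteq> y \<longrightarrow> c x \<noteq> c y"
proof (cases "arcs = {}")
  case False
  have three: False
    if "Q1 \<in> arcs" "Q2 \<in> arcs" "Q3 \<in> arcs" "x \<in> ends Q1" "x \<in> ends Q2" "x \<in> ends Q3"
      "Q1 \<noteq> Q2" "Q1 \<noteq> Q3" "Q2 \<noteq> Q3" for Q1 Q2 Q3 x
  proof -
    have "card {Q1, Q2, Q3} \<le> card {Q \<in> arcs. x \<in> ends Q}"
      by (rule card_mono) (use fin that in auto)
    then show False using deg[of x] that(7-9) by simp
  qed
  \<comment> \<open>The nodes of a walk are distinct, so lengths are bounded and a longest walk
    exists.\<close>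
  define walk where "walk xs \<longleftrightarrow> distinct xs \<and> set xs \<subseteq> \<Union>(ends ` arcs) \<and>
    (\<forall>i. Suc i < length xs \<longrightarrow> (\<exists>Q\<in>arcs. ends Q = {xs ! i, xs ! Suc i}))" for xs
  have fin_nodes: "finite (\<Union>(ends ` arcs))"
  proof (rule finite_UN_I[OF fin])
    fix Q assume "Q \<in> arcs"
    then obtain x y where "ends Q = {x, y}" using ends by blast
    then show "finite (ends Q)" by simp
  qed
  have bound: "length xs \<le> card (\<Union>(ends ` arcs))" if "walk xs" for xs
    using that card_mono[OF fin_nodes, of "set xs"] distinct_card[of xs] unfolding walk_def by simp
  obtain Q0 where Q0: "Q0 \<in> arcs" using False by blast
  then obtain x0 y0 where xy0: "x0 \<noteq> y0" "ends Q0 = {x0, y0}" using ends by blast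
  have walk0: "walk [x0, y0]"
    unfolding walk_def using xy0 Q0 by (auto intro!: bexI[of _ Q0])
  obtain xs where xs: "walk xs" and longest: "\<And>ys. walk ys \<Longrightarrow> length ys \<le> length xs"
  proof -
    have "\<exists>xs. walk xs \<and> (\<forall>ys. walk ys \<longrightarrow> length ys \<le> length xs)"
      by (rule ex_has_greatest_nat[of walk "[x0, y0]" length "Suc (card (\<Union>(ends ` arcs)))"])
        (use bound walk0 in \<open>auto simp: less_Suc_eq_le\<close>)
    then show thesis using that by blast
  qed
  define n where "n = length xs"
  have n2: "n \<ge> 2" using longest[OF walk0] unfolding n_def by simp
  have dist: "distinct xs" and sub: "set xs \<subseteq> \<Union>(ends ` arcs)" using xs unfolding walk_def by auto
  have arc_ex: "\<exists>Q\<in>arcs. ends Q = {xs ! i, xs ! Suc i}" if "Suc i < n" for i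
    using xs that unfolding walk_def n_def by blast
  have nth_eq: "xs ! i = xs ! j \<longleftrightarrow> i = j" if "i < n" "j < n" for i j
    using dist that unfolding n_def by (simp add: nth_eq_iff_index_eq)
  have mem: "xs ! i \<in> set xs" if "i < n" for i using that unfolding n_def by simp
  have notin: "xs ! i \<notin> {xs ! a, xs ! b}" if "i < n" "a < n" "b < n" "i \<noteq> a" "i \<noteq> b" for i a b
    using nth_eq that by simp
  \<comment> \<open>An inner node already lies on two arcs of the walk, so degree at most 2 leaves
    no third arc with other ends.\<close>
  have inner: "ends Q = {xs ! (i - 1), xs ! i} \<or> ends Q = {xs ! i, xs ! Suc i}"
    if i: "0 < i" "Suc i < n" and Q: "Q \<in> arcs" "xs ! i \<in> ends Q" for i Q
  proof (rule ccontr)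
    assume neg: "\<not> ?thesis"
    obtain Q1 where Q1: "Q1 \<in> arcs" "ends Q1 = {xs ! (i - 1), xs ! i}"
      using arc_ex[of "i - 1"] i by auto
    obtain Q2 where Q2: "Q2 \<in> arcs" "ends Q2 = {xs ! i, xs ! Suc i}"
      using arc_ex[of i] i by auto
    have "xs ! (i - 1) \<noteq> xs ! i" "xs ! (i - 1) \<noteq> xs ! Suc i"
      using i nth_eq[of "i - 1" i] nth_eq[of "i - 1" "Suc i"] by auto
    then have "Q1 \<noteq> Q2" using Q1 Q2 by auto
    then show False using three[OF Q(1) Q1(1) Q2(1) Q(2)] Q1 Q2 neg by auto
  qed
  \<comment> \<open>Otherwise some arc leaves the node set of the walk. At an end of the walk it
    would make the walk longer; at an inner node it is excluded by \<open>inner\<close>.\<close>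
  have all_sub: "ends Q \<subseteq> set xs" if Q: "Q \<in> arcs" for Q
  proof (rule ccontr)
    assume neg: "\<not> ends Q \<subseteq> set xs"
    define A where "A = {Q \<in> arcs. ends Q \<subseteq> set xs}"
    obtain P where "P \<in> arcs" "ends P = {xs ! 0, xs ! Suc 0}" using arc_ex[of 0] n2 by auto
    then have "P \<in> A" using n2 mem[of 0] mem[of "Suc 0"] unfolding A_def by auto
    moreover have "A \<subseteq> arcs" "Q \<notin> A" using neg unfolding A_def by auto
    ultimately obtain Q1 Q2 where Q12: "Q1 \<in> A" "Q2 \<in> arcs - A" "ends Q1 \<inter> ends Q2 \<noteq> {}"
      using conn[of A] Q by blast
    then obtain x where x: "x \<in> ends Q1" "x \<in> ends Q2" by blast
    then have "x \<in> set xs" using Q12 unfolding A_def by auto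
    then obtain i where i: "i < n" "x = xs ! i" unfolding n_def by (metis in_set_conv_nth)
    obtain a b where ab: "a \<noteq> b" "ends Q2 = {a, b}" using ends[of Q2] Q12(2) by blast
    obtain z where z: "ends Q2 = {x, z}" "x \<noteq> z" using ab x(2) by auto
    have znot: "z \<notin> set xs" using z Q12 \<open>x \<in> set xs\<close> unfolding A_def by auto
    have zin: "z \<in> \<Union>(ends ` arcs)" using z Q12 by auto
    consider "i = 0" | "Suc i = n" | "0 < i" "Suc i < n" using i by linarith
    then show False
    proof cases
      case 1
      have "walk (z # xs)" unfolding walk_def
      proof (intro conjI allI impI)
        fix j assume "Suc j < length (z # xs)"
        then show "\<exists>Q\<in>arcs. ends Q = {(z # xs) ! j, (z # xs) ! Suc j}"
          using arc_ex[of "j - 1"] z(1) Q12(2) 1 i(2) unfolding n_def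
          by (cases j) (auto simp: insert_commute intro!: bexI[of _ Q2])
      qed (use dist sub znot zin in auto)
      then show False using longest by fastforce
    next
      case 2
      have "walk (xs @ [z])" unfolding walk_def
      proof (intro conjI allI impI)
        fix j assume "Suc j < length (xs @ [z])"
        then consider "Suc j < n" | "Suc j = n" unfolding n_def by fastforce
        then show "\<exists>Q\<in>arcs. ends Q = {(xs @ [z]) ! j, (xs @ [z]) ! Suc j}"
        proof cases
          case 1
          then show ?thesis using arc_ex[of j] unfolding n_def by (simp add: nth_append)
        next
          case 2
          then have "j = i" using \<open>Suc i = n\<close> by simp
          then show ?thesis using z(1) Q12(2) i 2 unfolding n_def
            by (intro bexI[of _ Q2]) (auto simp: nth_append)
        qed
      qed (use dist sub znot zin in auto)
      then show False using longest by fastforce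
    next
      case 3
      then have "ends Q2 \<subseteq> {xs ! (i - 1), xs ! i, xs ! Suc i}"
        using inner[OF 3, of Q2] Q12 x i by auto
      moreover have "{xs ! (i - 1), xs ! i, xs ! Suc i} \<subseteq> set xs"
        using 3 mem[of "i - 1"] mem[of i] mem[of "Suc i"] by auto
      ultimately show False using Q12(2) unfolding A_def by auto
    qed
  qed
  have nodes: "\<Union>(ends ` arcs) = set xs" using all_sub sub by blast
  define c where "c x \<longleftrightarrow> (\<exists>i<n. xs ! i = x \<and> even i)" for x
  have c_nth: "c (xs ! i) \<longleftrightarrow> even i" if "i < n" for i unfolding c_def using that nth_eq by auto
  \<comment> \<open>An arc between non-consecutive positions can touch no inner node, so it joins
    positions \<open>0\<close> and \<open>n - 1\<close>. Then every node has two arcs, so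
    \<open>n\<close> is even and the two positions have different parity.\<close>
  have ordered: "c (xs ! i) \<noteq> c (xs ! j)" if Q: "Q \<in> arcs" "ends Q = {xs ! i, xs ! j}" and ij: "i < j" "j < n" for Q i j
  proof (cases "j = Suc i")
    case True
    then show ?thesis using c_nth ij by auto
  next
    case False
    have "i = 0"
    proof (rule ccontr)
      assume "i \<noteq> 0"
      then have "xs ! j \<in> {xs ! (i - 1), xs ! i, xs ! Suc i}" using inner[of i Q] Q ij by auto
      moreover have "i - 1 < n" "i < n" "Suc i < n" using ij by auto
      ultimately have "j = i - 1 \<or> j = i \<or> j = Suc i"
        using nth_eq[OF ij(2)] by blast
      then show False using ij False by linarith
    qed
    have "Suc j = n"
    proof (rule ccontr)
      assume "Suc j \<noteq> n"
      then have "xs ! i \<in> {xs ! (j - 1), xs ! j, xs ! Suc j}" using inner[of j Q] Q ij by auto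
      moreover have "j - 1 < n" "i < n" "Suc j < n" using ij \<open>Suc j \<noteq> n\<close> by auto
      ultimately have "i = j - 1 \<or> i = j \<or> i = Suc j"
        using nth_eq[of i] ij(2) by blast
      then show False using ij False by linarith
    qed
    have "\<not> card {Q \<in> arcs. x \<in> ends Q} \<le> 1" if "x \<in> set xs" for x
    proof -
      obtain m where m: "m < n" "x = xs ! m" using \<open>x \<in> set xs\<close> unfolding n_def by (metis in_set_conv_nth)
      have "\<exists>P\<in>arcs. \<exists>P'\<in>arcs. ends P \<noteq> ends P' \<and> x \<in> ends P \<and> x \<in> ends P'"
      proof (cases "0 < m \<and> Suc m < n")
        case True
        obtain P where P: "P \<in> arcs" "ends P = {xs ! (m - 1), xs ! m}"
          using arc_ex[of "m - 1"] True by auto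
        obtain P' where P': "P' \<in> arcs" "ends P' = {xs ! m, xs ! Suc m}"
          using arc_ex[of m] True by auto
        have "xs ! (m - 1) \<notin> ends P'" unfolding P'(2) by (rule notin) (use True in linarith)+
        then show ?thesis using P P' m by (intro bexI[of _ P] bexI[of _ P']) auto
      next
        case False
        then consider "m = 0" | "m = j" using m \<open>Suc j = n\<close> by linarith
        then show ?thesis
        proof cases
          case 1
          obtain P where P: "P \<in> arcs" "ends P = {xs ! 0, xs ! Suc 0}"
            using arc_ex[of 0] n2 by auto
          have "xs ! Suc 0 \<notin> ends Q"
            unfolding Q(2) by (rule notin) (use n2 ij \<open>j \<noteq> Suc i\<close> \<open>i = 0\<close> in linarith)+
          then show ?thesis using P Q m 1 \<open>i = 0\<close> by (intro bexI[of _ P] bexI[of _ Q]) auto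
        next
          case 2
          obtain P where P: "P \<in> arcs" "ends P = {xs ! (j - 1), xs ! j}"
            using arc_ex[of "j - 1"] ij by auto
          have "xs ! (j - 1) \<notin> ends Q"
            unfolding Q(2) by (rule notin) (use ij \<open>j \<noteq> Suc i\<close> in linarith)+
          then show ?thesis using P Q m 2 by (intro bexI[of _ P] bexI[of _ Q]) auto
        qed
      qed
      then obtain P P' where P: "P \<in> arcs" "P' \<in> arcs" "ends P \<noteq> ends P'" "x \<in> ends P" "x \<in> ends P'" by blast
      then have "card {P, P'} \<le> card {Q \<in> arcs. x \<in> ends Q}"
        by (intro card_mono) (use fin in auto)
      moreover have "P \<noteq> P'" using P by auto
      ultimately show ?thesis by simp
    qed
    then have "even n" using par nodes distinct_card[OF dist] unfolding n_def by auto
    then show ?thesis using c_nth ij \<open>i = 0\<close> \<open>Suc j = n\<close> by auto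
  qed
  have "c x \<noteq> c y" if Q: "Q \<in> arcs" "x \<in> ends Q" "y \<in> ends Q" "x \<noteq> y" for Q x y
  proof -
    obtain a b where "ends Q = {a, b}" using ends Q by blast
    then have exy: "ends Q = {x, y}" using Q by auto
    have "x \<in> set xs" "y \<in> set xs" using all_sub Q by auto
    then obtain i j where ij: "i < n" "j < n" "x = xs ! i" "y = xs ! j" unfolding n_def by (metis in_set_conv_nth)
    then have "i \<noteq> j" using Q(4) by auto
    then consider "i < j" | "j < i" by linarith
    then show ?thesis
    proof cases
      case 1
      then show ?thesis using ordered[of Q i j] Q(1) exy ij by auto
    next
      case 2
      then show ?thesis using ordered[of Q j i] Q(1) exy ij by auto
    qed
  qed
  then show ?thesis by blast
qed auto

section \<open>Hyperboloids through a skew quadrilateral\<close>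

lemma span_pair: "x \<in> span {u, v} \<longleftrightarrow> (\<exists>s t. x = s *\<^sub>R u + t *\<^sub>R v)"
  for u v :: "'a::real_vector"
proof -
  have "x - k *\<^sub>R u \<in> span {v} \<longleftrightarrow> (\<exists>t. x = k *\<^sub>R u + t *\<^sub>R v)" for k
    by (auto simp: span_singleton diff_eq_eq add.commute)
  then show ?thesis by (simp add: span_breakdown_eq)
qed

lemma proj_point_iff: "p \<in> proj_points \<longleftrightarrow> (\<exists>x. x \<noteq> 0 \<and> p = span {x})"
proof
  assume "p \<in> proj_points"
  then have p: "subspace p" "dim p = 1" unfolding proj_points_def by auto
  obtain B where B: "B \<subseteq> p" "independent B" "p \<subseteq> span B" "card B = dim p"
    using basis_exists[of p] by blast
  obtain x where "B = {x}" using B(4) p(2) by (auto simp: card_1_singleton_iff)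
  then show "\<exists>x. x \<noteq> 0 \<and> p = span {x}"
    using B p span_minimal[OF B(1) p(1)] by (intro exI[of _ x]) (auto simp: dependent_single)
next
  assume "\<exists>x. x \<noteq> 0 \<and> p = span {x}"
  then obtain x where "x \<noteq> 0" "p = span {x}" by blast
  then show "p \<in> proj_points" unfolding proj_points_def
    using dim_eq_card_independent[of "{x}"] by (auto simp: dim_span)
qed

lemma span_pair_proj_line:
  assumes "\<And>s t. s *\<^sub>R u + t *\<^sub>R v = 0 \<Longrightarrow> s = 0 \<and> t = 0"
  shows "span {u, v} \<in> proj_lines"
proof -
  have "u \<noteq> v" using assms[of 1 "-1"] by auto
  have "v \<noteq> 0" using assms[of 0 1] by auto
  have "u \<notin> span {v}"
  proof
    assume "u \<in> span {v}"
    then obtain k where "u = k *\<^sub>R v" by (auto simp: span_singleton)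
    then show False using assms[of 1 "-k"] by simp
  qed
  then have "independent {u, v}" using \<open>v \<noteq> 0\<close> by (simp add: independent_insert)
  then show ?thesis
    using dim_eq_card_independent[of "{u, v}"] \<open>u \<noteq> v\<close> unfolding proj_lines_def by (simp add: dim_span)
qed

lemma sym_matrix_dot: "transpose A = A \<Longrightarrow> x \<bullet> (A *v y) = y \<bullet> (A *v x)"
  for A :: "real^'n^'n"
  by (metis dot_lmul_matrix inner_commute transpose_matrix_vector)

text \<open>Polarisation: besides \<open>u\<close> and \<open>v\<close>, the point
  \<open>u + v\<close> of the line detects the mixed term, by symmetry of \<open>A\<close>.\<close>

lemma points_on_subset_quadric:
  assumes sym: "transpose A = A"
  shows "points_on (span {u, v}) \<subseteq> quadric A \<longleftrightarrow>
    u \<bullet> (A *v u) = 0 \<and> v \<bullet> (A *v v) = 0 \<and> u \<bullet> (A *v v) = 0"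
proof
  assume sub: "points_on (span {u, v}) \<subseteq> quadric A"
  have iso: "x \<bullet> (A *v x) = 0" if "x \<in> span {u, v}" for x
  proof (cases "x = 0")
    case False
    then have "span {x} \<in> points_on (span {u, v})"
      using that proj_point_iff unfolding points_on_def by (auto simp: span_minimal)
    then show ?thesis using sub span_base[of x "{x}"] unfolding quadric_def by auto
  qed auto
  have "u \<bullet> (A *v u) = 0" "v \<bullet> (A *v v) = 0" "(u + v) \<bullet> (A *v (u + v)) = 0"
    by (intro iso; auto simp: span_base span_add)+
  then show "u \<bullet> (A *v u) = 0 \<and> v \<bullet> (A *v v) = 0 \<and> u \<bullet> (A *v v) = 0"
    using sym_matrix_dot[OF sym, of u v] by (auto simp: matrix_vector_right_distrib inner_simps)
next
  assume uv: "u \<bullet> (A *v u) = 0 \<and> v \<bullet> (A *v v) = 0 \<and> u \<bullet> (A *v v) = 0"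
  then have vu: "v \<bullet> (A *v u) = 0" using sym_matrix_dot[OF sym] by metis
  have "x \<bullet> (A *v x) = 0" if "x \<in> span {u, v}" for x
    using that uv vu by (auto simp: span_pair matrix_vector_right_distrib matrix_vector_mult_scaleR inner_simps)
  then show "points_on (span {u, v}) \<subseteq> quadric A" unfolding points_on_def quadric_def by auto
qed

lemma span_in_quadric: "span {x} \<in> quadric A \<longleftrightarrow> x \<noteq> 0 \<and> x \<bullet> (A *v x) = 0"
proof -
  have "span {x} \<in> proj_points \<longleftrightarrow> x \<noteq> 0"
    unfolding proj_points_def using dim_eq_card_independent[of "{x}"] by (cases "x = 0") (auto simp: dim_span)
  moreover have "(\<forall>y\<in>span {x}. y \<bullet> (A *v y) = 0) \<longleftrightarrow> x \<bullet> (A *v x) = 0"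
  proof
    assume "x \<bullet> (A *v x) = 0"
    then show "\<forall>y\<in>span {x}. y \<bullet> (A *v y) = 0"
      by (auto simp: span_singleton matrix_vector_mult_scaleR)
  qed (simp add: span_base)
  ultimately show ?thesis unfolding quadric_def by simp
qed

text \<open>The Greek vectors are the coordinate functionals for the basis \<open>a\<close>,
  \<open>b\<close>, \<open>c\<close>, \<open>d\<close>, represented by the inner product. With x1,
  ..., x4 for these coordinates, the hyperboloids through the four sides will be x1 x3 + t x2 x4 = 0
  with nonzero t.\<close>

locale dual_frame =
  fixes a b c d \<alpha> \<beta> \<gamma> \<delta> :: "real^4"
  assumes dual: "\<alpha> \<bullet> a = 1" "\<alpha> \<bullet> b = 0" "\<alpha> \<bullet> c = 0" "\<alpha> \<bullet> d = 0"
    "\<beta> \<bullet> a = 0" "\<beta> \<bullet> b = 1" "\<beta> \<bullet> c = 0" "\<beta> \<bullet> d = 0"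
    "\<gamma> \<bullet> a = 0" "\<gamma> \<bullet> b = 0" "\<gamma> \<bullet> c = 1" "\<gamma> \<bullet> d = 0"
    "\<delta> \<bullet> a = 0" "\<delta> \<bullet> b = 0" "\<delta> \<bullet> c = 0" "\<delta> \<bullet> d = 1"
    and expand: "\<And>y. y = (\<alpha> \<bullet> y) *\<^sub>R a + (\<beta> \<bullet> y) *\<^sub>R b + (\<gamma> \<bullet> y) *\<^sub>R c + (\<delta> \<bullet> y) *\<^sub>R d"
lemma dual_basis:
  fixes a b c d :: "real^4"
  assumes indep: "\<And>x y z w. x *\<^sub>R a + y *\<^sub>R b + z *\<^sub>R c + w *\<^sub>R d = 0 \<Longrightarrow> x = 0 \<and> y = 0 \<and> z = 0 \<and> w = 0"
  shows "\<exists>\<alpha> \<beta> \<gamma> \<delta>. dual_frame a b c d \<alpha> \<beta> \<gamma> \<delta>"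
proof -
  \<comment> \<open>The columns of \<open>M\<close> are the basis vectors, so the rows of its
    inverse are the dual vectors.\<close>
  define M :: "real^4^4" where "M = (\<chi> i j. if j = 1 then a $ i else if j = 2 then b $ i else if j = 3 then c $ i else d $ i)"
  have M: "M *v x = x $ 1 *\<^sub>R a + x $ 2 *\<^sub>R b + x $ 3 *\<^sub>R c + x $ 4 *\<^sub>R d" for x
    unfolding M_def by (simp add: vec_eq_iff matrix_vector_mult_def sum_4)
  have "inj ((*v) M)" unfolding linear_injective_0[OF matrix_vector_mul_linear[of M]]
  proof (intro allI impI)
    fix x assume "M *v x = 0"
    then have "x $ 1 = 0 \<and> x $ 2 = 0 \<and> x $ 3 = 0 \<and> x $ 4 = 0" using indep[of "x $ 1" "x $ 2" "x $ 3" "x $ 4"] unfolding M by blast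
    then show "x = 0" by (simp add: vec_eq_iff forall_4)
  qed
  then obtain N where NM: "N ** M = mat 1" using matrix_left_invertible_injective[of M] by blast
  then have MN: "M ** N = mat 1" using matrix_left_right_inverse by blast
  have row: "N $ i \<bullet> y = (N *v y) $ i" for i y
    by (simp add: matrix_vector_mult_def inner_vec_def)
  have Nx: "N *v (M *v x) = x" for x by (simp add: matrix_vector_mul_assoc NM)
  have Na: "N *v a = axis 1 1" "N *v b = axis 2 1" "N *v c = axis 3 1" "N *v d = axis 4 1"
    using Nx[of "axis 1 1"] Nx[of "axis 2 1"] Nx[of "axis 3 1"] Nx[of "axis 4 1"]
    by (simp_all add: M axis_def)
  have "y = (N $ 1 \<bullet> y) *\<^sub>R a + (N $ 2 \<bullet> y) *\<^sub>R b + (N $ 3 \<bullet> y) *\<^sub>R c + (N $ 4 \<bullet> y) *\<^sub>R d" for y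
    unfolding row M[symmetric] by (simp add: matrix_vector_mul_assoc MN)
  then show ?thesis
    by (intro exI[of _ "N $ 1"] exI[of _ "N $ 2"] exI[of _ "N $ 3"] exI[of _ "N $ 4"] dual_frame.intro)
      (simp_all add: row Na axis_def)
qed

definition outer :: "real^4 \<Rightarrow> real^4 \<Rightarrow> real^4^4"
  where "outer x y = (\<chi> i j. x $ i * y $ j)"

lemma outer_mult: "outer x y *v z = (y \<bullet> z) *\<^sub>R x"
  by (simp add: outer_def vec_eq_iff matrix_vector_mult_def inner_vec_def sum_distrib_left mult_ac)

lemma transpose_outer: "transpose (outer x y) = outer y x"
  by (simp add: outer_def transpose_def vec_eq_iff mult_ac)

lemma transpose_add: "transpose (A + B) = transpose A + transpose B"
  for A B :: "'a::semiring_1^'n^'m"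
  by (simp add: transpose_def vec_eq_iff)

lemma scaleR_mat_mult: "(t *\<^sub>R A) *v x = t *\<^sub>R (A *v x)" for A :: "real^'n^'m"
  by (simp add: scaleR_matrix_vector_assoc)

context dual_frame
begin

text \<open>The symmetric matrix of twice x1 x3 + t x2 x4 in the dual coordinates: the only pairings
  of basis vectors that can be nonzero are those of opposite corners.\<close>

definition B :: "real \<Rightarrow> real^4^4"
  where "B t = (outer \<alpha> \<gamma> + outer \<gamma> \<alpha>) + t *\<^sub>R (outer \<beta> \<delta> + outer \<delta> \<beta>)"

lemma B_mult: "B t *v z = (\<gamma> \<bullet> z) *\<^sub>R \<alpha> + (\<alpha> \<bullet> z) *\<^sub>R \<gamma> + t *\<^sub>R ((\<delta> \<bullet> z) *\<^sub>R \<beta> + (\<beta> \<bullet> z) *\<^sub>R \<delta>)"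
  unfolding B_def by (simp add: matrix_vector_mult_add_rdistrib outer_mult scaleR_mat_mult)

lemma B_form: "x \<bullet> (B t *v z) = (\<gamma> \<bullet> z) * (\<alpha> \<bullet> x) + (\<alpha> \<bullet> z) * (\<gamma> \<bullet> x) +
    t * ((\<delta> \<bullet> z) * (\<beta> \<bullet> x) + (\<beta> \<bullet> z) * (\<delta> \<bullet> x))"
  unfolding B_mult by (simp add: inner_simps inner_commute)

lemma transpose_B: "transpose (B t) = B t"
proof -
  have "transpose (t *\<^sub>R M) = t *\<^sub>R transpose M" for M :: "real^4^4" by (simp add: transpose_def vec_eq_iff)
  then show ?thesis unfolding B_def by (simp add: transpose_add transpose_outer add.commute)
qed

lemma zeroI: "\<alpha> \<bullet> z = 0 \<Longrightarrow> \<beta> \<bullet> z = 0 \<Longrightarrow> \<gamma> \<bullet> z = 0 \<Longrightarrow> \<delta> \<bullet> z = 0 \<Longrightarrow> z = 0"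
  using expand[of z] by simp

lemma invertible_B: "t \<noteq> 0 \<Longrightarrow> invertible (B t)"
proof -
  assume t: "t \<noteq> 0"
  have "inj ((*v) (B t))" unfolding linear_injective_0[OF matrix_vector_mul_linear[of "B t"]]
  proof (intro allI impI)
    fix z assume "B t *v z = 0"
    then have "x \<bullet> (B t *v z) = 0" for x by simp
    from this[of a] this[of b] this[of c] this[of d] show "z = 0"
      unfolding B_form using t by (intro zeroI) (auto simp: dual)
  qed
  then show ?thesis
    using matrix_left_invertible_injective[of "B t"] matrix_left_right_inverse[of _ "B t"]
    unfolding invertible_def by blast
qed

lemma quadric_point: "span {x} \<in> quadric (B t) \<longleftrightarrow> x \<noteq> 0 \<and> (\<alpha> \<bullet> x) * (\<gamma> \<bullet> x) + t * ((\<beta> \<bullet> x) * (\<delta> \<bullet> x)) = 0"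
proof -
  have "x \<bullet> (B t *v x) = 2 * ((\<alpha> \<bullet> x) * (\<gamma> \<bullet> x) + t * ((\<beta> \<bullet> x) * (\<delta> \<bullet> x)))"
    unfolding B_form by (simp add: algebra_simps)
  then show ?thesis unfolding span_in_quadric by (simp del: distrib_left_numeral)
qed

lemma coexpand: "w = (a \<bullet> w) *\<^sub>R \<alpha> + (b \<bullet> w) *\<^sub>R \<beta> + (c \<bullet> w) *\<^sub>R \<gamma> + (d \<bullet> w) *\<^sub>R \<delta>"
proof -
  have "x \<bullet> w = x \<bullet> ((a \<bullet> w) *\<^sub>R \<alpha> + (b \<bullet> w) *\<^sub>R \<beta> + (c \<bullet> w) *\<^sub>R \<gamma> + (d \<bullet> w) *\<^sub>R \<delta>)" for x
  proof -
    have "x \<bullet> w = ((\<alpha> \<bullet> x) *\<^sub>R a + (\<beta> \<bullet> x) *\<^sub>R b + (\<gamma> \<bullet> x) *\<^sub>R c + (\<delta> \<bullet> x) *\<^sub>R d) \<bullet> w"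
      using expand[of x] by simp
    then show ?thesis by (simp add: inner_simps inner_commute mult.commute)
  qed
  then show ?thesis using vector_eq_ldot by blast
qed

text \<open>Of the ten entries of a symmetric form in the basis, the hypotheses annihilate eight:
  four for the corners and four for the sides. The diagonals leave \<open>p\<close> and
  \<open>q\<close>. Both are nonzero by invertibility, because \<open>A\<close> maps
  \<open>a\<close> to \<open>p\<close> times \<open>\<gamma>\<close> and \<open>b\<close> to
  \<open>q\<close> times \<open>\<delta>\<close>.\<close>

lemma matrix_eq_B:
  assumes sym: "transpose A = A" and inv: "invertible A"
    and iso: "a \<bullet> (A *v a) = 0" "b \<bullet> (A *v b) = 0" "c \<bullet> (A *v c) = 0" "d \<bullet> (A *v d) = 0"
      "a \<bullet> (A *v b) = 0" "b \<bullet> (A *v c) = 0" "c \<bullet> (A *v d) = 0" "d \<bullet> (A *v a) = 0"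
  shows "\<exists>p t. p \<noteq> 0 \<and> t \<noteq> 0 \<and> A = p *\<^sub>R B t"
proof -
  define p q where "p = a \<bullet> (A *v c)" and "q = b \<bullet> (A *v d)"
  have flip: "b \<bullet> (A *v a) = 0" "c \<bullet> (A *v b) = 0" "d \<bullet> (A *v c) = 0" "a \<bullet> (A *v d) = 0"
    "c \<bullet> (A *v a) = p" "d \<bullet> (A *v b) = q"
    using iso sym_matrix_dot[OF sym] unfolding p_def q_def by metis+
  have Aa: "A *v a = p *\<^sub>R \<gamma>" using coexpand[of "A *v a"] iso flip by simp
  have Ab: "A *v b = q *\<^sub>R \<delta>" using coexpand[of "A *v b"] iso flip by simp
  have Ac: "A *v c = p *\<^sub>R \<alpha>" using coexpand[of "A *v c"] iso flip p_def by simp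
  have Ad: "A *v d = q *\<^sub>R \<beta>" using coexpand[of "A *v d"] iso flip q_def by simp
  obtain A' where "A' ** A = mat 1" using inv unfolding invertible_def by blast
  then have ker: "z = 0" if "A *v z = 0" for z
    by (metis matrix_vector_mul_assoc matrix_vector_mul_lid matrix_vector_mult_0_right that)
  have "a \<noteq> 0" "b \<noteq> 0" using dual by auto
  then have pq: "p \<noteq> 0" "q \<noteq> 0" using ker[of a] ker[of b] Aa Ab by auto
  have "A *v z = (p *\<^sub>R B (q / p)) *v z" for z
  proof -
    have "A *v z = A *v ((\<alpha> \<bullet> z) *\<^sub>R a + (\<beta> \<bullet> z) *\<^sub>R b + (\<gamma> \<bullet> z) *\<^sub>R c + (\<delta> \<bullet> z) *\<^sub>R d)"
      using expand[of z] by simp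
    also have "\<dots> = (p *\<^sub>R B (q / p)) *v z"
      using pq by (simp add: matrix_vector_right_distrib matrix_vector_mult_scaleR Aa Ab Ac Ad
          scaleR_mat_mult B_mult scaleR_right_distrib mult.commute)
    finally show ?thesis .
  qed
  then have "A = p *\<^sub>R B (q / p)" by (simp add: matrix_eq)
  then show ?thesis using pq by (intro exI[of _ p] exI[of _ "q / p"]) simp
qed

lemma quadric_B_inject: "quadric (B t) = quadric (B s) \<Longrightarrow> t = s"
proof -
  assume eq: "quadric (B t) = quadric (B s)"
  \<comment> \<open>The point with coordinates (-t, 1, 1, 1) satisfies the equation with parameter
    \<open>s\<close> only if \<open>s = t\<close>.\<close>
  define x where "x = (- t) *\<^sub>R a + b + c + d"
  have x: "\<alpha> \<bullet> x = - t" "\<beta> \<bullet> x = 1" "\<gamma> \<bullet> x = 1" "\<delta> \<bullet> x = 1"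
    unfolding x_def by (simp_all add: inner_simps dual)
  then have "x \<noteq> 0" by auto
  then have "span {x} \<in> quadric (B t)" unfolding quadric_point x by simp
  then have "span {x} \<in> quadric (B s)" using eq by simp
  then show "t = s" unfolding quadric_point x by simp
qed

text \<open>The equation x1 x3 = - t x2 x4 is an equality of ratios in two ways: x1 : t x4 = x2 : -
  x3 and x1 : - x2 = t x4 : x3. Fixing the common value \<open>n : m\<close> of the first, or
  \<open>l : k\<close> of the second, cuts out a line of the respective ruling.\<close>

lemma ruling_lines:
  assumes x: "x \<noteq> 0" "(\<alpha> \<bullet> x) * (\<gamma> \<bullet> x) + t * ((\<beta> \<bullet> x) * (\<delta> \<bullet> x)) = 0" and t: "t \<noteq> 0"
  shows "\<exists>L\<in>proj_lines. \<exists>M\<in>proj_lines. L \<noteq> M \<and> span {x} \<subseteq> L \<and> span {x} \<subseteq> M \<and>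
       points_on L \<subseteq> quadric (B t) \<and> points_on M \<subseteq> quadric (B t)"
proof -
  define x1 x2 x3 x4 where xs: "x1 = \<alpha> \<bullet> x" "x2 = \<beta> \<bullet> x" "x3 = \<gamma> \<bullet> x" "x4 = \<delta> \<bullet> x"
  have xe: "x = x1 *\<^sub>R a + x2 *\<^sub>R b + x3 *\<^sub>R c + x4 *\<^sub>R d" unfolding xs by (rule expand)
  have q: "x1 * x3 + t * (x2 * x4) = 0" using x(2) unfolding xs .
  have nz: "x1 \<noteq> 0 \<or> x2 \<noteq> 0 \<or> x3 \<noteq> 0 \<or> x4 \<noteq> 0" using x(1) xe by auto
  \<comment> \<open>The ratio \<open>n : m\<close> is taken from whichever of the pairs (x1, t x4)
    and (x2, - x3) is not zero; the ratio \<open>l : k\<close> is found in the same way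
    below.\<close>
  have "\<exists>m n. (m \<noteq> 0 \<or> n \<noteq> 0) \<and> m * x1 = n * t * x4 \<and> m * x2 = - n * x3"
  proof (cases "x1 \<noteq> 0 \<or> x4 \<noteq> 0")
    case True
    then show ?thesis using q t by (intro exI[of _ "t * x4"] exI[of _ x1]) (auto simp: algebra_simps)
  next
    case False
    then show ?thesis using nz by (intro exI[of _ "- x3"] exI[of _ x2]) (auto simp: algebra_simps)
  qed
  then obtain m n where mn: "m \<noteq> 0 \<or> n \<noteq> 0" "m * x1 = n * t * x4" "m * x2 = - n * x3" by blast
  have "\<exists>k l. (k \<noteq> 0 \<or> l \<noteq> 0) \<and> k * x1 = - l * x2 \<and> k * t * x4 = l * x3"
  proof (cases "x1 \<noteq> 0 \<or> x2 \<noteq> 0")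
    case True
    then show ?thesis using q by (intro exI[of _ "- x2"] exI[of _ x1]) (auto simp: algebra_simps)
  next
    case False
    then show ?thesis using nz t by (intro exI[of _ x3] exI[of _ "t * x4"]) (auto simp: algebra_simps)
  qed
  then obtain k l where kl: "k \<noteq> 0 \<or> l \<noteq> 0" "k * x1 = - l * x2" "k * t * x4 = l * x3" by blast
  \<comment> \<open>Bases of the solution spaces of the two pairs of linear equations just
    obtained.\<close>
  define u1 u2 v1 v2 where uv: "u1 = (n * t) *\<^sub>R a + m *\<^sub>R d" "u2 = n *\<^sub>R b - m *\<^sub>R c"
    "v1 = l *\<^sub>R a - k *\<^sub>R b" "v2 = (k * t) *\<^sub>R c + l *\<^sub>R d"
  have co: "\<alpha> \<bullet> (y1 *\<^sub>R u1 + y2 *\<^sub>R u2) = y1 * n * t" "\<beta> \<bullet> (y1 *\<^sub>R u1 + y2 *\<^sub>R u2) = y2 * n"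
    "\<gamma> \<bullet> (y1 *\<^sub>R u1 + y2 *\<^sub>R u2) = - y2 * m" "\<delta> \<bullet> (y1 *\<^sub>R u1 + y2 *\<^sub>R u2) = y1 * m"
    "\<alpha> \<bullet> (y1 *\<^sub>R v1 + y2 *\<^sub>R v2) = y1 * l" "\<beta> \<bullet> (y1 *\<^sub>R v1 + y2 *\<^sub>R v2) = - y1 * k"
    "\<gamma> \<bullet> (y1 *\<^sub>R v1 + y2 *\<^sub>R v2) = y2 * k * t" "\<delta> \<bullet> (y1 *\<^sub>R v1 + y2 *\<^sub>R v2) = y2 * l" for y1 y2
    unfolding uv by (simp_all add: inner_simps dual)
  have eqI: "y = z" if "\<alpha> \<bullet> y = \<alpha> \<bullet> z" "\<beta> \<bullet> y = \<beta> \<bullet> z" "\<gamma> \<bullet> y = \<gamma> \<bullet> z" "\<delta> \<bullet> y = \<delta> \<bullet> z" for y z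
    using expand[of y] expand[of z] that by simp
  have L: "span {u1, u2} \<in> proj_lines"
  proof (rule span_pair_proj_line)
    fix r s assume "r *\<^sub>R u1 + s *\<^sub>R u2 = 0"
    then show "r = 0 \<and> s = 0" using co(1-4)[of r s] mn(1) t by auto
  qed
  have M: "span {v1, v2} \<in> proj_lines"
  proof (rule span_pair_proj_line)
    fix r s assume "r *\<^sub>R v1 + s *\<^sub>R v2 = 0"
    then show "r = 0 \<and> s = 0" using co(5-8)[of r s] kl(1) t by auto
  qed
  have xL: "x \<in> span {u1, u2}"
  proof (cases "n = 0")
    case True
    then have "x = (x4 / m) *\<^sub>R u1 + (- x3 / m) *\<^sub>R u2"
      using mn by (intro eqI) (simp_all only: co xs[symmetric], auto)
    then show ?thesis unfolding span_pair by blast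
  next
    case False
    then have "x = (x1 / (n * t)) *\<^sub>R u1 + (x2 / n) *\<^sub>R u2"
      using mn(2,3) t by (intro eqI) (simp_all only: co xs[symmetric], auto simp: field_simps)
    then show ?thesis unfolding span_pair by blast
  qed
  have xM: "x \<in> span {v1, v2}"
  proof (cases "l = 0")
    case True
    then have "x = (- x2 / k) *\<^sub>R v1 + (x3 / (k * t)) *\<^sub>R v2"
      using kl t by (intro eqI) (simp_all only: co xs[symmetric], auto)
    then show ?thesis unfolding span_pair by blast
  next
    case False
    then have "x = (x1 / l) *\<^sub>R v1 + (x4 / l) *\<^sub>R v2"
      using kl(2,3) t by (intro eqI) (simp_all only: co xs[symmetric], auto simp: field_simps)
    then show ?thesis unfolding span_pair by blast
  qed
  have ne: "span {u1, u2} \<noteq> span {v1, v2}"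
  proof
    assume eq: "span {u1, u2} = span {v1, v2}"
    have "u1 \<in> span {v1, v2}" "u2 \<in> span {v1, v2}" unfolding eq[symmetric] by (auto simp: span_base)
    then obtain r s r' s' where r: "u1 = r *\<^sub>R v1 + s *\<^sub>R v2" "u2 = r' *\<^sub>R v1 + s' *\<^sub>R v2"
      unfolding span_pair by blast
    have "k * (n * t) = 0" "k * m = 0" "l * n = 0" "l * m = 0"
      using co(1-4)[of 1 0] co(1-4)[of 0 1] co(5-8)[of r s] co(5-8)[of r' s'] r by (auto simp: algebra_simps)
    then show False using kl(1) mn(1) t by auto
  qed
  have LQ: "points_on (span {u1, u2}) \<subseteq> quadric (B t)"
    unfolding points_on_subset_quadric[OF transpose_B] B_form
    using co(1-4)[of 1 0] co(1-4)[of 0 1] by (simp add: algebra_simps)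
  have MQ: "points_on (span {v1, v2}) \<subseteq> quadric (B t)"
    unfolding points_on_subset_quadric[OF transpose_B] B_form
    using co(5-8)[of 1 0] co(5-8)[of 0 1] by (simp add: algebra_simps)
  show ?thesis using L M ne xL xM LQ MQ span_minimal[of "{x}"] by (meson empty_subsetI insert_subset subspace_span)
qed

lemma hyperboloid_B: "t \<noteq> 0 \<Longrightarrow> hyperboloid (quadric (B t))"
proof -
  assume t: "t \<noteq> 0"
  have "span {a} \<in> quadric (B t)" unfolding quadric_point using dual by auto
  then have ne: "quadric (B t) \<noteq> {}" by blast
  have "doubly_ruled (quadric (B t))" unfolding doubly_ruled_def
  proof (intro conjI ballI)
    fix p assume p: "p \<in> quadric (B t)"
    then have "p \<in> proj_points" unfolding quadric_def by blast
    then obtain x where x: "x \<noteq> 0" "p = span {x}" unfolding proj_point_iff by blast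
    then show "\<exists>L\<in>proj_lines. \<exists>M\<in>proj_lines. L \<noteq> M \<and> p \<subseteq> L \<and> p \<subseteq> M \<and>
       points_on L \<subseteq> quadric (B t) \<and> points_on M \<subseteq> quadric (B t)"
      using p ruling_lines[OF x(1) _ t] unfolding x(2) quadric_point by blast
  qed (rule ne)
  then show ?thesis using transpose_B invertible_B[OF t] unfolding hyperboloid_def by blast
qed

end

section \<open>The pencil through a skew quadrilateral and tangent planes along its sides\<close>

definition quad_hyperboloids :: "real^4 \<Rightarrow> real^4 \<Rightarrow> real^4 \<Rightarrow> real^4 \<Rightarrow> (real^4) set set set"
  where "quad_hyperboloids a b c d = {H. hyperboloid H \<and>
    asymptotic_line H (span {a, b}) \<and> asymptotic_line H (span {b, c}) \<and>
    asymptotic_line H (span {c, d}) \<and> asymptotic_line H (span {d, a})}"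

text \<open>The choice leaves a nonzero factor undetermined. It is common to all values of
  \<open>coef\<close> for the same hyperboloid, so ratios of these values, and homogeneous relations
  between them, are meaningful.\<close>

definition mat_of :: "(real^4) set set \<Rightarrow> real^4^4"
  where "mat_of H = (SOME A. transpose A = A \<and> invertible A \<and> H = quadric A)"

text \<open>The tangent plane of \<open>H\<close> at the point spanned by \<open>x\<close> has normal vector \<open>coef H x m *\<^sub>R m\<close> if \<open>m\<close> is
  one of its normal vectors.\<close>

definition coef :: "(real^4) set set \<Rightarrow> real^4 \<Rightarrow> real^4 \<Rightarrow> real"
  where "coef H x m = ((mat_of H *v x) \<bullet> m) / (m \<bullet> m)"

text \<open>Here \<open>na\<close> is normal to the vertex plane at \<open>a\<close>, which contains
  the neighbours \<open>b\<close> and \<open>d\<close> of \<open>a\<close>; likewise at the other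
  corners. Independence says that the four points are not coplanar. In a net the normals are
  attached to the vertices, so that adjacent faces share them.\<close>

locale skew_quad =
  fixes a b c d na nb nc nd :: "real^4"
  assumes indep: "\<And>x y z w. x *\<^sub>R a + y *\<^sub>R b + z *\<^sub>R c + w *\<^sub>R d = 0 \<Longrightarrow> x = 0 \<and> y = 0 \<and> z = 0 \<and> w = 0"
    and na: "na \<noteq> 0" "na \<bullet> a = 0" "na \<bullet> b = 0" "na \<bullet> d = 0"
    and nb: "nb \<noteq> 0" "nb \<bullet> b = 0" "nb \<bullet> c = 0" "nb \<bullet> a = 0"
    and nc: "nc \<noteq> 0" "nc \<bullet> c = 0" "nc \<bullet> d = 0" "nc \<bullet> b = 0"
    and nd: "nd \<noteq> 0" "nd \<bullet> d = 0" "nd \<bullet> a = 0" "nd \<bullet> c = 0"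
begin

text \<open>Statements at the corner \<open>a\<close> are carried to the other corners by this
  cyclic symmetry.\<close>

lemma rotate: "skew_quad b c d a nb nc nd na"
proof
  show "x = 0 \<and> y = 0 \<and> z = 0 \<and> w = 0" if "x *\<^sub>R b + y *\<^sub>R c + z *\<^sub>R d + w *\<^sub>R a = 0" for x y z w
    using indep[of w x y z] that by (simp add: algebra_simps)
qed (use na nb nc nd in auto)

lemma normal_form:
  obtains Bm :: "real \<Rightarrow> real^4^4" where
    "quad_hyperboloids a b c d = (\<lambda>t. quadric (Bm t)) ` (- {0})"
    "\<And>t s. quadric (Bm t) = quadric (Bm s) \<Longrightarrow> t = s"
    "\<exists>A0 B0. transpose A0 = A0 \<and> transpose B0 = B0 \<and> (\<forall>t. Bm t = A0 + t *\<^sub>R B0)"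
    "\<And>H. H \<in> quad_hyperboloids a b c d \<Longrightarrow> \<exists>t\<noteq>0. H = quadric (Bm t) \<and>
      (\<forall>A. transpose A = A \<and> invertible A \<and> H = quadric A \<longrightarrow> (\<exists>p\<noteq>0. A = p *\<^sub>R Bm t))"
    "\<And>t. Bm t *v a = (1 / (na \<bullet> c)) *\<^sub>R na \<and> Bm t *v b = (t / (nb \<bullet> d)) *\<^sub>R nb \<and> Bm t *v d = (t / (nd \<bullet> b)) *\<^sub>R nd"
    "na \<bullet> c \<noteq> 0" "nb \<bullet> d \<noteq> 0" "nd \<bullet> b \<noteq> 0"
proof -
  obtain \<alpha> \<beta> \<gamma> \<delta> where "dual_frame a b c d \<alpha> \<beta> \<gamma> \<delta>"
    using dual_basis[of a b c d] indep by blast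
  then interpret D: dual_frame a b c d \<alpha> \<beta> \<gamma> \<delta> .
  have lines: "span {a, b} \<in> proj_lines" "span {b, c} \<in> proj_lines" "span {c, d} \<in> proj_lines" "span {d, a} \<in> proj_lines"
  proof -
    show "span {a, b} \<in> proj_lines" by (rule span_pair_proj_line) (use indep[of _ _ 0 0] in auto)
    show "span {b, c} \<in> proj_lines" by (rule span_pair_proj_line) (use indep[of 0 _ _ 0] in auto)
    show "span {c, d} \<in> proj_lines" by (rule span_pair_proj_line) (use indep[of 0 0] in auto)
    have "s = 0 \<and> t = 0" if "s *\<^sub>R d + t *\<^sub>R a = 0" for s t
      using indep[of t 0 0 s] that by (simp add: add.commute)
    then show "span {d, a} \<in> proj_lines" by (rule span_pair_proj_line)
  qed
  have form: "\<exists>p t. p \<noteq> 0 \<and> t \<noteq> 0 \<and> A = p *\<^sub>R D.B t"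
    if A: "transpose A = A" "invertible A" and H: "quadric A \<in> quad_hyperboloids a b c d" for A
  proof -
    note iff = points_on_subset_quadric[OF A(1)]
    have sub: "points_on (span {a, b}) \<subseteq> quadric A" "points_on (span {b, c}) \<subseteq> quadric A"
      "points_on (span {c, d}) \<subseteq> quadric A" "points_on (span {d, a}) \<subseteq> quadric A"
      using H unfolding quad_hyperboloids_def asymptotic_line_def by auto
    show ?thesis
      using sub[unfolded iff] by (intro D.matrix_eq_B[OF A]) auto
  qed
  have quadric_scale: "quadric (p *\<^sub>R A) = quadric A" if "p \<noteq> 0" for p A
    using that unfolding quadric_def by (simp add: scaleR_mat_mult)
  have mem: "quadric (D.B t) \<in> quad_hyperboloids a b c d" if "t \<noteq> 0" for t
    using D.hyperboloid_B[OF that] lines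
    unfolding quad_hyperboloids_def asymptotic_line_def
    by (simp add: points_on_subset_quadric[OF D.transpose_B] D.B_form D.dual)
  have Bmul: "D.B t *v a = \<gamma>" "D.B t *v b = t *\<^sub>R \<delta>" "D.B t *v d = t *\<^sub>R \<beta>" for t
    by (simp_all add: D.B_mult D.dual)
  \<comment> \<open>A normal at a corner is orthogonal to three basis vectors, hence a multiple of
    one dual vector; the factor is its product with the opposite corner.\<close>
  have nas: "na = (na \<bullet> c) *\<^sub>R \<gamma>" "nb = (nb \<bullet> d) *\<^sub>R \<delta>" "nd = (nd \<bullet> b) *\<^sub>R \<beta>"
    using D.coexpand[of na] D.coexpand[of nb] D.coexpand[of nd] na nb nd by (simp_all add: inner_commute)
  have nz: "na \<bullet> c \<noteq> 0" "nb \<bullet> d \<noteq> 0" "nd \<bullet> b \<noteq> 0"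
    using nas na(1) nb(1) nd(1) by (metis scaleR_zero_left)+
  show thesis
  proof (rule that[of D.B])
    show "quad_hyperboloids a b c d = (\<lambda>t. quadric (D.B t)) ` (- {0})"
    proof
      show "quad_hyperboloids a b c d \<subseteq> (\<lambda>t. quadric (D.B t)) ` (- {0})"
      proof
        fix H assume H: "H \<in> quad_hyperboloids a b c d"
        then obtain A where A: "transpose A = A" "invertible A" "H = quadric A"
          unfolding quad_hyperboloids_def hyperboloid_def by auto
        then obtain p t where "p \<noteq> 0" "t \<noteq> 0" "A = p *\<^sub>R D.B t" using form H by blast
        then show "H \<in> (\<lambda>t. quadric (D.B t)) ` (- {0})" using A(3) quadric_scale by auto
      qed
    qed (use mem in auto)
    show "\<And>t s. quadric (D.B t) = quadric (D.B s) \<Longrightarrow> t = s" by (rule D.quadric_B_inject)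
    show "\<exists>A0 B0. transpose A0 = A0 \<and> transpose B0 = B0 \<and> (\<forall>t. D.B t = A0 + t *\<^sub>R B0)"
      unfolding D.B_def
      by (intro exI[of _ "outer \<alpha> \<gamma> + outer \<gamma> \<alpha>"] exI[of _ "outer \<beta> \<delta> + outer \<delta> \<beta>"])
        (simp add: transpose_add transpose_outer add.commute)
    show "D.B t *v a = (1 / (na \<bullet> c)) *\<^sub>R na \<and> D.B t *v b = (t / (nb \<bullet> d)) *\<^sub>R nb \<and> D.B t *v d = (t / (nd \<bullet> b)) *\<^sub>R nd" for t
    proof -
      have "(1 / (na \<bullet> c)) *\<^sub>R na = \<gamma>" "(t / (nb \<bullet> d)) *\<^sub>R nb = t *\<^sub>R \<delta>" "(t / (nd \<bullet> b)) *\<^sub>R nd = t *\<^sub>R \<beta>"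
        using arg_cong[OF nas(1), of "\<lambda>v. (1 / (na \<bullet> c)) *\<^sub>R v"]
          arg_cong[OF nas(2), of "\<lambda>v. (t / (nb \<bullet> d)) *\<^sub>R v"]
          arg_cong[OF nas(3), of "\<lambda>v. (t / (nd \<bullet> b)) *\<^sub>R v"] nz by simp_all
      then show ?thesis using Bmul by simp
    qed
    show "\<exists>t\<noteq>0. H = quadric (D.B t) \<and>
      (\<forall>A. transpose A = A \<and> invertible A \<and> H = quadric A \<longrightarrow> (\<exists>p\<noteq>0. A = p *\<^sub>R D.B t))"
      if H: "H \<in> quad_hyperboloids a b c d" for H
    proof -
      obtain A where A: "transpose A = A" "invertible A" "H = quadric A"
        using H unfolding quad_hyperboloids_def hyperboloid_def by auto
      obtain p t where pt: "p \<noteq> 0" "t \<noteq> 0" "A = p *\<^sub>R D.B t" using form A H by blast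
      have Ht: "H = quadric (D.B t)" using A(3) pt quadric_scale by simp
      have "\<exists>p\<noteq>0. A' = p *\<^sub>R D.B t" if A': "transpose A' = A'" "invertible A'" "H = quadric A'" for A'
      proof -
        obtain p' t' where pt': "p' \<noteq> 0" "t' \<noteq> 0" "A' = p' *\<^sub>R D.B t'" using form A' H by blast
        then have "quadric (D.B t) = quadric (D.B t')" using A'(3) quadric_scale Ht by simp
        then have "t = t'" by (rule D.quadric_B_inject)
        then show ?thesis using pt' by blast
      qed
      then show ?thesis using pt Ht by blast
    qed
  qed (rule nz)+
qed

lemma one_parameter: "one_parameter_family (quad_hyperboloids a b c d)"
proof -
  obtain Bm where Bm: "quad_hyperboloids a b c d = (\<lambda>t. quadric (Bm t)) ` (- {0})"
    "\<And>t s. quadric (Bm t) = quadric (Bm s) \<Longrightarrow> t = s"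
    "\<exists>A0 B0. transpose A0 = A0 \<and> transpose B0 = B0 \<and> (\<forall>t. Bm t = A0 + t *\<^sub>R B0)"
    by (rule normal_form) (rule that; assumption)
  then obtain A0 B0 where AB: "transpose A0 = A0" "transpose B0 = B0" "\<And>t. Bm t = A0 + t *\<^sub>R B0" by blast
  have "bij_betw (\<lambda>t. quadric (A0 + t *\<^sub>R B0)) (- {0}) (quad_hyperboloids a b c d)"
    unfolding bij_betw_def AB(3)[symmetric] using Bm(1,2) by (auto intro: inj_onI)
  then show ?thesis unfolding one_parameter_family_def using AB(1,2) by blast
qed

lemma mat_of:
  assumes "H \<in> quad_hyperboloids a b c d"
  shows "transpose (mat_of H) = mat_of H \<and> invertible (mat_of H) \<and> H = quadric (mat_of H)"
proof -
  have "\<exists>A. transpose A = A \<and> invertible A \<and> H = quadric A"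
    using assms unfolding quad_hyperboloids_def hyperboloid_def by auto
  then show ?thesis unfolding mat_of_def by (rule someI_ex)
qed

lemma normals_nonzero: "na \<bullet> c \<noteq> 0" "nb \<bullet> d \<noteq> 0" "nd \<bullet> b \<noteq> 0"
  by (rule normal_form; assumption)+

text \<open>\<open>T\<close> is the parameter of the pencil. The factor \<open>p\<close> relates the
  chosen matrix to the normal form. It cancels in the ratio
  \<open>coef H b nb / coef H a na\<close>, which is therefore proportional to
  \<open>T H\<close>.\<close>

lemma coordinate:
  obtains T :: "(real^4) set set \<Rightarrow> real" where "bij_betw T (quad_hyperboloids a b c d) (- {0})"
    "\<And>H. H \<in> quad_hyperboloids a b c d \<Longrightarrow> T H \<noteq> 0 \<and> (\<exists>p\<noteq>0. coef H a na = p / (na \<bullet> c) \<and>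
      coef H b nb = p * T H / (nb \<bullet> d) \<and> coef H d nd = p * T H / (nd \<bullet> b) \<and>
      mat_of H *v a = coef H a na *\<^sub>R na)"
proof (rule normal_form)
  fix Bm :: "real \<Rightarrow> real^4^4"
  assume im: "quad_hyperboloids a b c d = (\<lambda>t. quadric (Bm t)) ` (- {0})"
    and inj: "\<And>t s. quadric (Bm t) = quadric (Bm s) \<Longrightarrow> t = s"
    and form: "\<And>H. H \<in> quad_hyperboloids a b c d \<Longrightarrow> \<exists>t\<noteq>0. H = quadric (Bm t) \<and>
      (\<forall>A. transpose A = A \<and> invertible A \<and> H = quadric A \<longrightarrow> (\<exists>p\<noteq>0. A = p *\<^sub>R Bm t))"
    and mul: "\<And>t. Bm t *v a = (1 / (na \<bullet> c)) *\<^sub>R na \<and> Bm t *v b = (t / (nb \<bullet> d)) *\<^sub>R nb \<and> Bm t *v d = (t / (nd \<bullet> b)) *\<^sub>R nd"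
  have bij: "bij_betw (\<lambda>t. quadric (Bm t)) (- {0}) (quad_hyperboloids a b c d)"
    unfolding bij_betw_def im using inj by (auto intro: inj_onI)
  define T where "T = inv_into (- {0}) (\<lambda>t. quadric (Bm t))"
  show thesis
  proof (rule that)
    show T: "bij_betw T (quad_hyperboloids a b c d) (- {0})"
      unfolding T_def by (rule bij_betw_inv_into[OF bij])
    fix H assume H: "H \<in> quad_hyperboloids a b c d"
    have "T H \<noteq> 0" using bij_betwE[OF T] H by auto
    have HT: "quadric (Bm (T H)) = H" unfolding T_def by (rule bij_betw_inv_into_right[OF bij H])
    obtain t where t: "H = quadric (Bm t)"
      "\<forall>A. transpose A = A \<and> invertible A \<and> H = quadric A \<longrightarrow> (\<exists>p\<noteq>0. A = p *\<^sub>R Bm t)"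
      using form[OF H] by blast
    have "t = T H" by (rule inj) (use t(1) HT in simp)
    then obtain p where p: "p \<noteq> 0" "mat_of H = p *\<^sub>R Bm (T H)" using t(2) mat_of[OF H] by blast
    have "na \<bullet> na \<noteq> 0" "nb \<bullet> nb \<noteq> 0" "nd \<bullet> nd \<noteq> 0" using na nb nd by auto
    then have "coef H a na = p / (na \<bullet> c) \<and> coef H b nb = p * T H / (nb \<bullet> d) \<and>
      coef H d nd = p * T H / (nd \<bullet> b)"
      unfolding coef_def p(2) scaleR_mat_mult using mul[of "T H"] by (simp add: field_simps)
    moreover have "mat_of H *v a = (p / (na \<bullet> c)) *\<^sub>R na"
      unfolding p(2) scaleR_mat_mult using mul[of "T H"] by simp
    ultimately show "T H \<noteq> 0 \<and> (\<exists>p\<noteq>0. coef H a na = p / (na \<bullet> c) \<and>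
      coef H b nb = p * T H / (nb \<bullet> d) \<and> coef H d nd = p * T H / (nd \<bullet> b) \<and>
      mat_of H *v a = coef H a na *\<^sub>R na)"
      using p(1) \<open>T H \<noteq> 0\<close> by (intro conjI exI[of _ p]) simp_all
  qed
qed

lemma coef_a:
  assumes H: "H \<in> quad_hyperboloids a b c d"
  shows "mat_of H *v a = coef H a na *\<^sub>R na" "coef H a na \<noteq> 0"
  by (rule coordinate, use H normals_nonzero in fastforce)+

text \<open>This is the symmetry \<open>d \<bullet> (A *v b) = b \<bullet> (A *v d)\<close> of the
  matrix, rewritten through the normals at \<open>b\<close> and \<open>d\<close>.\<close>

lemma coef_opposite:
  assumes H: "H \<in> quad_hyperboloids a b c d"
  shows "coef H b nb * (nb \<bullet> d) = coef H d nd * (nd \<bullet> b)"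
  by (rule coordinate, use H normals_nonzero in fastforce)

lemma ratio_bij:
  assumes r: "r \<noteq> 0"
  shows "\<exists>!H. H \<in> quad_hyperboloids a b c d \<and> coef H b nb / coef H a na = r"
proof (rule coordinate)
  fix T :: "(real^4) set set \<Rightarrow> real"
  assume T: "bij_betw T (quad_hyperboloids a b c d) (- {0})"
    and coef: "\<And>H. H \<in> quad_hyperboloids a b c d \<Longrightarrow> T H \<noteq> 0 \<and> (\<exists>p\<noteq>0. coef H a na = p / (na \<bullet> c) \<and>
      coef H b nb = p * T H / (nb \<bullet> d) \<and> coef H d nd = p * T H / (nd \<bullet> b) \<and>
      mat_of H *v a = coef H a na *\<^sub>R na)"
  define t where "t = r * (nb \<bullet> d) / (na \<bullet> c)"
  have iff: "coef H b nb / coef H a na = r \<longleftrightarrow> T H = t" if "H \<in> quad_hyperboloids a b c d" for H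
  proof -
    have ratio: "coef H b nb / coef H a na = T H * (na \<bullet> c) / (nb \<bullet> d)" using coef[OF that] by auto
    show ?thesis unfolding ratio t_def using normals_nonzero by (auto simp: field_simps)
  qed
  have "t \<noteq> 0" unfolding t_def using r normals_nonzero by simp
  then have "t \<in> T ` quad_hyperboloids a b c d" using bij_betw_imp_surj_on[OF T] by simp
  then obtain H0 where H0: "H0 \<in> quad_hyperboloids a b c d" "T H0 = t" by blast
  show ?thesis
  proof (rule ex1I[of _ H0])
    show "H0 \<in> quad_hyperboloids a b c d \<and> coef H0 b nb / coef H0 a na = r"
      unfolding iff[OF H0(1)] using H0 by simp
    fix H assume H: "H \<in> quad_hyperboloids a b c d \<and> coef H b nb / coef H a na = r"
    then have "T H = T H0" using iff[of H] H0(2) by simp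
    then show "H = H0" using inj_onD[OF bij_betw_imp_inj_on[OF T]] H H0(1) by blast
  qed
qed

text \<open>All matrices of \<open>H\<close> are nonzero multiples of one, so the description in
  \<open>tangent_plane\<close> singles out one plane, and the chosen matrix computes it.\<close>

lemma tangent_plane_eq:
  assumes H: "H \<in> quad_hyperboloids a b c d"
  shows "tangent_plane H (span {x}) = {y. y \<bullet> (mat_of H *v x) = 0}"
proof -
  have "\<exists>M. \<forall>A. transpose A = A \<and> invertible A \<and> H = quadric A \<longrightarrow> (\<exists>p\<noteq>0. A = p *\<^sub>R M)"
  proof (rule normal_form)
    fix Bm :: "real \<Rightarrow> real^4^4"
    assume "\<And>H. H \<in> quad_hyperboloids a b c d \<Longrightarrow> \<exists>t\<noteq>0. H = quadric (Bm t) \<and>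
      (\<forall>A. transpose A = A \<and> invertible A \<and> H = quadric A \<longrightarrow> (\<exists>p\<noteq>0. A = p *\<^sub>R Bm t))"
    from this[OF H] show ?thesis by blast
  qed
  then obtain M where t: "\<And>A. transpose A = A \<Longrightarrow> invertible A \<Longrightarrow> H = quadric A \<Longrightarrow> \<exists>p\<noteq>0. A = p *\<^sub>R M"
    by blast
  have plane: "{y. \<forall>z\<in>span {x}. y \<bullet> (A *v z) = 0} = {y. y \<bullet> (M *v x) = 0}"
    if A: "transpose A = A" "invertible A" "H = quadric A" for A
  proof -
    obtain p where p: "p \<noteq> 0" "A = p *\<^sub>R M" using t[OF A] by blast
    have "(\<forall>z\<in>span {x}. y \<bullet> (A *v z) = 0) \<longleftrightarrow> y \<bullet> (M *v x) = 0" for y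
      using p by (auto simp: span_singleton scaleR_mat_mult matrix_vector_mult_scaleR dest: bspec[of _ _ x])
    then show ?thesis by blast
  qed
  note m = mat_of[OF H]
  obtain p where p: "p \<noteq> 0" "mat_of H = p *\<^sub>R M" using t m by blast
  have "tangent_plane H (span {x}) = {y. y \<bullet> (M *v x) = 0}"
    unfolding tangent_plane_def
  proof (rule the_equality)
    show "\<exists>A. transpose A = A \<and> invertible A \<and> H = quadric A \<and>
        {y. y \<bullet> (M *v x) = 0} = {y. \<forall>z\<in>span {x}. y \<bullet> (A *v z) = 0}"
      using m plane by blast
  qed (use plane in blast)
  also have "\<dots> = {y. y \<bullet> (mat_of H *v x) = 0}" unfolding p(2) scaleR_mat_mult using p(1) by simp
  finally show ?thesis .
qed

end

lemma quad_hyperboloids_rotate: "quad_hyperboloids b c d a = quad_hyperboloids a b c d"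
  unfolding quad_hyperboloids_def by auto

text \<open>With k and l the coefficients of \<open>H\<close> at \<open>a\<close> and
  \<open>b\<close>, the tangent plane at the point s a + t b has normal s k na + t l nb. Hence
  proportional pairs (k, l) give the same planes along the whole line, and conversely the single
  point \<open>a + b\<close> detects the ratio.\<close>

lemma tangent_planes_agree_iff:
  assumes Q: "skew_quad a b c d na nb nc nd" and Q': "skew_quad a b c' d' na nb nc' nd'"
    and H: "H \<in> quad_hyperboloids a b c d" and H': "H' \<in> quad_hyperboloids a b c' d'"
  shows "(\<forall>p\<in>points_on (span {a, b}). tangent_plane H p = tangent_plane H' p) \<longleftrightarrow>
    coef H b nb / coef H a na = coef H' b nb / coef H' a na"
proof -
  interpret Q: skew_quad a b c d na nb nc nd by (rule Q)
  interpret Q': skew_quad a b c' d' na nb nc' nd' by (rule Q')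
  define k l k' l' where kl: "k = coef H a na" "l = coef H b nb" "k' = coef H' a na" "l' = coef H' b nb"
  note rot = Q.rotate Q'.rotate
  have Hr: "H \<in> quad_hyperboloids b c d a" "H' \<in> quad_hyperboloids b c' d' a"
    using H H' by (simp_all add: quad_hyperboloids_rotate)
  have nz: "k \<noteq> 0" "l \<noteq> 0" "k' \<noteq> 0" "l' \<noteq> 0"
    unfolding kl using Q.coef_a(2)[OF H] Q'.coef_a(2)[OF H'] skew_quad.coef_a(2)[OF rot(1) Hr(1)]
      skew_quad.coef_a(2)[OF rot(2) Hr(2)] by auto
  have m: "mat_of H *v a = k *\<^sub>R na" "mat_of H *v b = l *\<^sub>R nb" "mat_of H' *v a = k' *\<^sub>R na" "mat_of H' *v b = l' *\<^sub>R nb"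
    unfolding kl using Q.coef_a(1)[OF H] Q'.coef_a(1)[OF H'] skew_quad.coef_a(1)[OF rot(1) Hr(1)]
      skew_quad.coef_a(1)[OF rot(2) Hr(2)] by auto
  have tp: "tangent_plane H (span {s *\<^sub>R a + t *\<^sub>R b}) = {y. s * k * (y \<bullet> na) + t * l * (y \<bullet> nb) = 0}"
    "tangent_plane H' (span {s *\<^sub>R a + t *\<^sub>R b}) = {y. s * k' * (y \<bullet> na) + t * l' * (y \<bullet> nb) = 0}" for s t
    unfolding Q.tangent_plane_eq[OF H] Q'.tangent_plane_eq[OF H']
    by (simp_all add: matrix_vector_right_distrib matrix_vector_mult_scaleR m inner_simps mult.assoc)
  have ac: "c \<bullet> na \<noteq> 0" "d \<bullet> nb \<noteq> 0"
    using Q.normals_nonzero by (simp_all add: inner_commute)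
  have perp: "c \<bullet> nb = 0" "d \<bullet> na = 0" using Q.na Q.nb by (simp_all add: inner_commute)
  show ?thesis
  proof
    assume agree: "\<forall>p\<in>points_on (span {a, b}). tangent_plane H p = tangent_plane H' p"
    have "a + b \<noteq> 0" using Q.indep[of 1 1 0 0] by auto
    moreover have "a + b \<in> span {a, b}" by (simp add: span_base span_add)
    then have "span {a + b} \<subseteq> span {a, b}" by (intro span_minimal) auto
    ultimately have "span {1 *\<^sub>R a + 1 *\<^sub>R b} \<in> points_on (span {a, b})"
      unfolding points_on_def using proj_point_iff by auto
    then have eq: "{y. k * (y \<bullet> na) + l * (y \<bullet> nb) = 0} = {y. k' * (y \<bullet> na) + l' * (y \<bullet> nb) = 0}"
      using bspec[OF agree] tp[of 1 1] by simp
    \<comment> \<open>A vector of the tangent plane of \<open>H\<close> at \<open>a + b\<close> in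
      the span of \<open>c\<close> and \<open>d\<close>. Since \<open>c\<close> is orthogonal to
      \<open>nb\<close> and \<open>d\<close> to \<open>na\<close>, its products with
      \<open>na\<close> and \<open>nb\<close> can be put in the ratio
      \<open>l : - k\<close>.\<close>
    define y where "y = (l * (d \<bullet> nb)) *\<^sub>R c - (k * (c \<bullet> na)) *\<^sub>R d"
    have y: "y \<bullet> na = l * (d \<bullet> nb) * (c \<bullet> na)" "y \<bullet> nb = - k * (c \<bullet> na) * (d \<bullet> nb)"
      unfolding y_def by (simp_all add: inner_simps perp)
    have "y \<in> {y. k * (y \<bullet> na) + l * (y \<bullet> nb) = 0}" by (simp add: y)
    then have "k' * (y \<bullet> na) + l' * (y \<bullet> nb) = 0" unfolding eq by simp
    then have "(k' * l - l' * k) * ((d \<bullet> nb) * (c \<bullet> na)) = 0" unfolding y by (simp add: algebra_simps)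
    then have "k' * l = l' * k" using ac by simp
    then show "coef H b nb / coef H a na = coef H' b nb / coef H' a na"
      using nz unfolding kl[symmetric] by (simp add: field_simps)
  next
    assume "coef H b nb / coef H a na = coef H' b nb / coef H' a na"
    then have eq: "l * k' = l' * k" using nz unfolding kl[symmetric] by (simp add: field_simps)
    have "s * k * u + t * l * v = 0 \<longleftrightarrow> s * k' * u + t * l' * v = 0" for s t u v :: real
    proof -
      have "k' * (s * k * u + t * l * v) = k * (s * k' * u + t * l' * v)"
        using eq by (simp add: algebra_simps)
      then show ?thesis using nz by (metis mult_eq_0_iff)
    qed
    then have tpe: "tangent_plane H (span {s *\<^sub>R a + t *\<^sub>R b}) = tangent_plane H' (span {s *\<^sub>R a + t *\<^sub>R b})" for s t
      unfolding tp by simp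
    show "\<forall>p\<in>points_on (span {a, b}). tangent_plane H p = tangent_plane H' p"
    proof
      fix p assume p: "p \<in> points_on (span {a, b})"
      then obtain x where x: "p = span {x}" unfolding points_on_def proj_point_iff by blast
      then have "x \<in> span {a, b}" using p unfolding points_on_def by (auto simp: span_base)
      then obtain s t where "x = s *\<^sub>R a + t *\<^sub>R b" unfolding span_pair by blast
      then show "tangent_plane H p = tangent_plane H' p" using tpe x by simp
    qed
  qed
qed

section \<open>Area forms on vertex planes\<close>

lemma proj_plane_normal:
  assumes "P \<in> proj_planes"
  shows "\<exists>m. m \<noteq> 0 \<and> (\<forall>x\<in>P. m \<bullet> x = 0)"
proof -
  have "dim P < DIM(real^4)" using assms unfolding proj_planes_def by simp
  then obtain m where m: "m \<noteq> 0" "span P \<subseteq> {x. m \<bullet> x = 0}" using lowdim_subset_hyperplane by blast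
  have "\<forall>x\<in>P. m \<bullet> x = 0" using m(2) span_superset[of P] by blast
  then show ?thesis using m(1) by blast
qed

text \<open>For \<open>g\<close>, \<open>h\<close> an orthonormal basis of the orthogonal complement
  of \<open>n\<close> and \<open>a\<close> is taken: on the plane with normal \<open>n\<close>, the
  products with \<open>g\<close> and \<open>h\<close> are coordinates modulo \<open>a\<close>, and
  their 2 by 2 determinant is an area form.\<close>

lemma plane_coordinates:
  fixes a n :: "real^4"
  assumes "a \<noteq> 0" "n \<noteq> 0" "n \<bullet> a = 0"
  shows "\<exists>g h. \<forall>y. n \<bullet> y = 0 \<longrightarrow> (\<exists>k. y = k *\<^sub>R a + (y \<bullet> g) *\<^sub>R g + (y \<bullet> h) *\<^sub>R h)"
proof -
  define T where "T = {y \<in> (UNIV :: (real^4) set). \<forall>x\<in>span {n, a}. orthogonal x y}"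
  have "independent {n, a}" "n \<noteq> a"
  proof -
    have "pairwise orthogonal {n, a}" using assms(3) by (simp add: pairwise_insert orthogonal_def inner_commute)
    then show "independent {n, a}" using assms by (intro pairwise_orthogonal_independent) auto
    show "n \<noteq> a" using assms by auto
  qed
  then have "dim (span {n, a}) = 2" using dim_eq_card_independent[of "{n, a}"] by (simp add: dim_span)
  then have "dim T = 2"
    using dim_subspace_orthogonal_to_vectors[of "span {n, a}" "UNIV :: (real^4) set"]
    unfolding T_def by (simp add: subspace_UNIV)
  have T_iff: "y \<in> T \<longleftrightarrow> n \<bullet> y = 0 \<and> a \<bullet> y = 0" for y
  proof
    assume y: "y \<in> T"
    have "n \<in> span {n, a}" "a \<in> span {n, a}" by (auto simp: span_base)
    then show "n \<bullet> y = 0 \<and> a \<bullet> y = 0" using y unfolding T_def orthogonal_def by blast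
  next
    assume "n \<bullet> y = 0 \<and> a \<bullet> y = 0"
    then show "y \<in> T" unfolding T_def by (auto simp: span_pair orthogonal_def inner_simps)
  qed
  have "subspace T" unfolding subspace_def by (auto simp: T_iff inner_simps)
  then obtain W where W: "W \<subseteq> T" "pairwise orthogonal W" "\<And>x. x \<in> W \<Longrightarrow> norm x = 1"
    "independent W" "card W = dim T" "span W = T" by (rule orthonormal_basis_subspace) blast
  then obtain g h where gh: "W = {g, h}" "g \<noteq> h" using \<open>dim T = 2\<close> card_2_iff[of W] by auto
  have on: "g \<bullet> g = 1" "h \<bullet> h = 1" "g \<bullet> h = 0" "h \<bullet> g = 0"
    using W(2,3) gh by (auto simp: pairwise_insert orthogonal_def inner_commute norm_eq_1[symmetric])
  have perp: "a \<bullet> g = 0" "a \<bullet> h = 0" using W(1) gh T_iff by auto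
  have "\<exists>k. y = k *\<^sub>R a + (y \<bullet> g) *\<^sub>R g + (y \<bullet> h) *\<^sub>R h" if y: "n \<bullet> y = 0" for y
  proof -
    define k where "k = (a \<bullet> y) / (a \<bullet> a)"
    have "y - k *\<^sub>R a \<in> T" unfolding T_iff k_def using y assms by (simp add: inner_simps)
    then obtain s t where st: "y - k *\<^sub>R a = s *\<^sub>R g + t *\<^sub>R h"
      using W(6) gh span_pair by blast
    then have ye: "y = k *\<^sub>R a + s *\<^sub>R g + t *\<^sub>R h" by (simp add: algebra_simps)
    have "y \<bullet> g = s" "y \<bullet> h = t" unfolding ye by (simp_all add: inner_simps on perp)
    then show ?thesis using ye by metis
  qed
  then show ?thesis by blast
qed

text \<open>Modulo \<open>a\<close>, the plane with normal vector \<open>n\<close> is two-dimensional, so that a functional on it which vanishes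
  at \<open>b\<close> is a multiple of the area form.\<close>

lemma area_form_multiple:
  fixes a b n m :: "real^4"
  assumes coords: "\<forall>y. n \<bullet> y = 0 \<longrightarrow> (\<exists>k. y = k *\<^sub>R a + (y \<bullet> g) *\<^sub>R g + (y \<bullet> h) *\<^sub>R h)"
    and b: "n \<bullet> b = 0" "b \<notin> span {a}" and m: "m \<bullet> a = 0" "m \<bullet> b = 0"
  shows "\<exists>k. \<forall>y. n \<bullet> y = 0 \<longrightarrow> m \<bullet> y = k * ((b \<bullet> g) * (y \<bullet> h) - (b \<bullet> h) * (y \<bullet> g))"
proof -
  have my: "m \<bullet> y = (y \<bullet> g) * (m \<bullet> g) + (y \<bullet> h) * (m \<bullet> h)" if y: "n \<bullet> y = 0" for y
  proof -
    obtain k where "y = k *\<^sub>R a + (y \<bullet> g) *\<^sub>R g + (y \<bullet> h) *\<^sub>R h" using coords y by blast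
    then have "m \<bullet> y = m \<bullet> (k *\<^sub>R a + (y \<bullet> g) *\<^sub>R g + (y \<bullet> h) *\<^sub>R h)" by simp
    then show ?thesis using m(1) by (simp add: inner_simps)
  qed
  have "b \<bullet> g \<noteq> 0 \<or> b \<bullet> h \<noteq> 0"
  proof (rule ccontr)
    assume "\<not> (b \<bullet> g \<noteq> 0 \<or> b \<bullet> h \<noteq> 0)"
    moreover obtain k where "b = k *\<^sub>R a + (b \<bullet> g) *\<^sub>R g + (b \<bullet> h) *\<^sub>R h" using coords b(1) by blast
    ultimately have "b = k *\<^sub>R a" by simp
    then show False using b(2) by (auto simp: span_singleton)
  qed
  define p q u v where "p = b \<bullet> g" "q = b \<bullet> h" "u = m \<bullet> g" "v = m \<bullet> h"
  note d = this
  have nz: "p \<noteq> 0 \<or> q \<noteq> 0" using \<open>b \<bullet> g \<noteq> 0 \<or> b \<bullet> h \<noteq> 0\<close> unfolding d .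
  have rel: "p * u + q * v = 0" using my[OF b(1)] m(2) unfolding d by simp
  have "\<exists>k. u = - k * q \<and> v = k * p"
  proof (cases "p = 0")
    case True
    then show ?thesis using nz rel by (intro exI[of _ "- u / q"]) auto
  next
    case False
    then show ?thesis using rel by (intro exI[of _ "v / p"]) (auto simp: field_simps)
  qed
  then obtain k where k: "u = - k * q" "v = k * p" by blast
  have "m \<bullet> y = k * (p * (y \<bullet> h) - q * (y \<bullet> g))" if "n \<bullet> y = 0" for y
  proof -
    have "m \<bullet> y = (y \<bullet> g) * u + (y \<bullet> h) * v" using my[OF that] unfolding d .
    then show ?thesis unfolding k by (simp add: algebra_simps)
  qed
  then show ?thesis unfolding d by blast
qed

context skew_quad
begin

text \<open>Let \<open>w\<close> be the area of \<open>b\<close> and \<open>d\<close>. Then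
  \<open>nb\<close> has the product \<open>kb * w\<close> with \<open>d\<close>, while antisymmetry
  gives \<open>nd\<close> the product \<open>- (kd * w)\<close> with \<open>b\<close>. Inserted into
  the symmetric relation \<open>coef_opposite\<close>, this produces the sign. The factor
  \<open>kb\<close> cannot vanish because \<open>nb\<close> is not orthogonal to
  \<open>d\<close>.\<close>

lemma coef_sign_flip:
  assumes H: "H \<in> quad_hyperboloids a b c d"
    and kb: "\<forall>y. na \<bullet> y = 0 \<longrightarrow> nb \<bullet> y = kb * ((b \<bullet> g) * (y \<bullet> h) - (b \<bullet> h) * (y \<bullet> g))"
    and kd: "\<forall>y. na \<bullet> y = 0 \<longrightarrow> nd \<bullet> y = kd * ((d \<bullet> g) * (y \<bullet> h) - (d \<bullet> h) * (y \<bullet> g))"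
  shows "kb * (coef H b nb / coef H a na) = - (kd * (coef H d nd / coef H a na))" "kb \<noteq> 0"
proof -
  define w where "w = (b \<bullet> g) * (d \<bullet> h) - (b \<bullet> h) * (d \<bullet> g)"
  have 1: "nb \<bullet> d = kb * w" using kb na unfolding w_def by simp
  have 2: "nd \<bullet> b = - (kd * w)" using kd na unfolding w_def by (simp add: algebra_simps)
  have "coef H b nb * kb * w = - (coef H d nd * kd * w)" "kb * w \<noteq> 0"
    using coef_opposite[OF H] normals_nonzero(2) unfolding 1 2 by (simp_all add: mult.assoc)
  then have "(kb * coef H b nb + kd * coef H d nd) * w = 0" "kb \<noteq> 0" "w \<noteq> 0"
    by (auto simp: algebra_simps)
  then have "kb * coef H b nb = - (kd * coef H d nd)" "kb \<noteq> 0" by auto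
  then show "kb * (coef H b nb / coef H a na) = - (kd * (coef H d nd / coef H a na))" "kb \<noteq> 0"
    by (simp_all add: field_simps)
qed

end

section \<open>Cells of a quad-graph\<close>

abbreviation square :: "complex set" where "square \<equiv> cbox 0 (Complex 1 1)"

abbreviation centre :: complex where "centre \<equiv> Complex (1/2) (1/2)"

lemma mem_square: "z \<in> square \<longleftrightarrow> 0 \<le> Re z \<and> Re z \<le> 1 \<and> 0 \<le> Im z \<and> Im z \<le> 1"
  by (auto simp: in_cbox_complex_iff)

lemma mem_open_square: "z \<in> box 0 (Complex 1 1) \<longleftrightarrow> 0 < Re z \<and> Re z < 1 \<and> 0 < Im z \<and> Im z < 1"
  by (auto simp: in_box_complex_iff)

lemma side_sets:
  "closed_segment 0 1 = {z. Im z = 0 \<and> 0 \<le> Re z \<and> Re z \<le> 1}"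
  "closed_segment 1 (Complex 1 1) = {z. Re z = 1 \<and> 0 \<le> Im z \<and> Im z \<le> 1}"
  "closed_segment (Complex 1 1) \<i> = {z. Im z = 1 \<and> 0 \<le> Re z \<and> Re z \<le> 1}"
  "closed_segment \<i> 0 = {z. Re z = 0 \<and> 0 \<le> Im z \<and> Im z \<le> 1}"
  by (auto simp: closed_segment_same_Im closed_segment_same_Re closed_segment_eq_real_ivl)

lemma square_cases:
  assumes "z \<in> square"
  shows "z \<in> box 0 (Complex 1 1) \<or> (\<exists>s\<in>square_sides. z \<in> s)"
  using assms unfolding mem_square mem_open_square square_sides_def side_sets by force

lemma side_subset: "s \<in> square_sides \<Longrightarrow> s \<subseteq> square"
  unfolding square_sides_def side_sets by (auto simp: mem_square)

text \<open>An affine coordinate measuring the distance from the side. It recovers the second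
  coordinate of the collar built in \<open>collar_ex\<close>.\<close>

lemma side_height:
  assumes "s \<in> square_sides"
  shows "\<exists>l :: complex \<Rightarrow> real. (\<forall>z\<in>s. l z = 0) \<and> l centre = 1 / 2 \<and>
    (\<forall>z \<sigma>. l ((1 - \<sigma>) *\<^sub>R z + \<sigma> *\<^sub>R centre) = (1 - \<sigma>) * l z + \<sigma> * l centre)"
proof -
  consider "s = closed_segment 0 1" | "s = closed_segment 1 (Complex 1 1)"
    | "s = closed_segment (Complex 1 1) \<i>" | "s = closed_segment \<i> 0"
    using assms unfolding square_sides_def by blast
  then show ?thesis
  proof cases
    case 1 then show ?thesis unfolding side_sets by (intro exI[of _ Im]) auto
  next
    case 2 then show ?thesis unfolding side_sets by (intro exI[of _ "\<lambda>z. 1 - Re z"]) (auto simp: algebra_simps)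
  next
    case 3 then show ?thesis unfolding side_sets by (intro exI[of _ "\<lambda>z. 1 - Im z"]) (auto simp: algebra_simps)
  next
    case 4 then show ?thesis unfolding side_sets by (intro exI[of _ Re]) auto
  qed
qed

lemma shrink_square:
  assumes "z \<in> square" "0 < \<sigma>" "\<sigma> \<le> 1"
  shows "(1 - \<sigma>) *\<^sub>R z + \<sigma> *\<^sub>R centre \<in> box 0 (Complex 1 1)"
proof -
  have *: "0 < (1 - \<sigma>) * x + \<sigma> / 2 \<and> (1 - \<sigma>) * x + \<sigma> / 2 < 1" if "0 \<le> x" "x \<le> 1" for x
  proof
    have "0 \<le> (1 - \<sigma>) * x" using assms that by simp
    then show "0 < (1 - \<sigma>) * x + \<sigma> / 2" using assms by linarith
    have "(1 - \<sigma>) * x \<le> (1 - \<sigma>) * 1" using assms that by (intro mult_left_mono) auto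
    then have "(1 - \<sigma>) * x \<le> 1 - \<sigma>" by simp
    then show "(1 - \<sigma>) * x + \<sigma> / 2 < 1" using assms(2) by simp
  qed
  show ?thesis using *[of "Re z"] *[of "Im z"] assms(1) unfolding mem_open_square mem_square by simp
qed

lemma corner_sides:
  "\<exists>s\<in>square_sides. z \<in> s" if "z \<in> square_corners"
  using that unfolding square_corners_def square_sides_def side_sets by auto

lemma edge_cell_props:
  fixes V :: "'a::t2_space set"
  assumes "edge_cell V e"
  shows "compact e" "\<exists>v w. v \<noteq> w \<and> e \<inter> V = {v, w}" "\<exists>x\<in>e. x \<notin> V"
proof -
  obtain g where g: "arc g" "path_image g = e" "e \<inter> V = {pathstart g, pathfinish g}"
    using assms unfolding edge_cell_def by blast
  show "compact e" using g compact_arc_image by blast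
  show "\<exists>v w. v \<noteq> w \<and> e \<inter> V = {v, w}" using g arc_distinct_ends by blast
  have inj: "inj_on g {0..1}" using g(1) unfolding arc_def by blast
  have "g (1/2) \<noteq> pathstart g" "g (1/2) \<noteq> pathfinish g"
    using inj_onD[OF inj, of "1/2" 0] inj_onD[OF inj, of "1/2" 1]
    unfolding pathstart_def pathfinish_def by auto
  moreover have "g (1/2) \<in> e" using g(2) unfolding path_image_def by auto
  ultimately show "\<exists>x\<in>e. x \<notin> V" using g(3) by blast
qed

text \<open>\<open>quad_cell\<close> with its two maps named, so that they can be passed between
  lemmas.\<close>

definition face_chart :: "'a::t2_space set \<Rightarrow> 'a set set \<Rightarrow> 'a set \<Rightarrow> (complex \<Rightarrow> 'a) \<Rightarrow> ('a \<Rightarrow> complex) \<Rightarrow> bool"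
  where "face_chart V E Q h k \<longleftrightarrow> homeomorphism square Q h k \<and>
       h ` square_corners \<subseteq> V \<and> (\<forall>s\<in>square_sides. h ` s \<in> E) \<and>
       h ` box 0 (Complex 1 1) \<inter> (V \<union> \<Union>E) = {}"

lemma face_chartD:
  assumes "face_chart V E Q h k"
  shows "h ` square = Q" "inj_on h square" "continuous_on square h"
    "\<And>x. x \<in> Q \<Longrightarrow> k x \<in> square" "\<And>x. x \<in> Q \<Longrightarrow> h (k x) = x" "continuous_on Q k"
    "h ` square_corners \<subseteq> V" "\<And>s. s \<in> square_sides \<Longrightarrow> h ` s \<in> E"
    "\<And>z. z \<in> box 0 (Complex 1 1) \<Longrightarrow> h z \<notin> V" "\<And>z e. z \<in> box 0 (Complex 1 1) \<Longrightarrow> e \<in> E \<Longrightarrow> h z \<notin> e"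
proof -
  have hom: "homeomorphism square Q h k" and disj: "h ` box 0 (Complex 1 1) \<inter> (V \<union> \<Union>E) = {}"
    using assms unfolding face_chart_def by auto
  show "h ` square = Q" "inj_on h square" "continuous_on square h" "continuous_on Q k"
    "\<And>x. x \<in> Q \<Longrightarrow> k x \<in> square" "\<And>x. x \<in> Q \<Longrightarrow> h (k x) = x"
    using hom unfolding homeomorphism_def by (auto intro: inj_on_inverseI[where g = k])
  show "h ` square_corners \<subseteq> V" "\<And>s. s \<in> square_sides \<Longrightarrow> h ` s \<in> E"
    using assms unfolding face_chart_def by auto
  show "h z \<notin> V" "e \<in> E \<Longrightarrow> h z \<notin> e" if "z \<in> box 0 (Complex 1 1)" for z e
    using disj imageI[OF that, of h] by auto
qed

section \<open>Intersections of cells\<close>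

context quad_graph
begin

lemma closed_cells_iff: "c \<in> closed_cells V E F \<longleftrightarrow> (\<exists>v\<in>V. c = {v}) \<or> c \<in> E \<or> c \<in> F"
  unfolding closed_cells_def by auto

lemma face_chart_ex: "Q \<in> F \<Longrightarrow> \<exists>h k. face_chart V E Q h k"
  using quad_cells unfolding quad_cell_def face_chart_def by blast

lemma cell_subset: "c \<in> closed_cells V E F \<Longrightarrow> c \<subseteq> S"
  using cover by blast

lemma vertex_in_S: "v \<in> V \<Longrightarrow> v \<in> S" and edge_subset_S: "e \<in> E \<Longrightarrow> e \<subseteq> S" and face_subset_S: "Q \<in> F \<Longrightarrow> Q \<subseteq> S"
  using cell_subset unfolding closed_cells_def by auto

lemma edge_endpoints: "e \<in> E \<Longrightarrow> \<exists>v w. v \<noteq> w \<and> e \<inter> V = {v, w}"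
  and edge_inner_point: "e \<in> E \<Longrightarrow> \<exists>x\<in>e. x \<notin> V"
  and edge_compact: "e \<in> E \<Longrightarrow> compact e"
  using edge_cell_props[OF edge_cells[of e]] by auto

lemma face_compact:
  assumes "Q \<in> F" shows "compact Q"
proof -
  obtain h k where hk: "face_chart V E Q h k" using face_chart_ex[OF assms] by blast
  show ?thesis
    using compact_continuous_image[OF face_chartD(3)[OF hk] compact_cbox] face_chartD(1)[OF hk] by simp
qed

lemma face_path_connected:
  assumes "Q \<in> F" shows "path_connected Q"
proof -
  obtain h k where hk: "face_chart V E Q h k" using face_chart_ex[OF assms] by blast
  have "path_connected square" by (intro convex_imp_path_connected convex_box)
  then show ?thesis
    using path_connected_continuous_image[OF face_chartD(3)[OF hk]] face_chartD(1)[OF hk] by simp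
qed

lemma edge_eqI: "e \<in> E \<Longrightarrow> e' \<in> E \<Longrightarrow> x \<in> e \<Longrightarrow> x \<in> e' \<Longrightarrow> x \<notin> V \<Longrightarrow> e = e'"
  using edges_disjoint by blast

lemma face_not_in_edges: "Q \<in> F \<Longrightarrow> \<not> Q \<subseteq> \<Union>E"
proof -
  assume "Q \<in> F"
  then obtain h k where hk: "face_chart V E Q h k" using face_chart_ex by blast
  have c: "centre \<in> box 0 (Complex 1 1)" "centre \<in> square" unfolding mem_open_square mem_square by auto
  then have "h centre \<in> Q" using face_chartD(1)[OF hk] by blast
  moreover have "h centre \<notin> \<Union>E" using face_chartD(10)[OF hk c(1)] by blast
  ultimately show ?thesis by blast
qed

text \<open>By strong regularity \<open>e \<inter> Q\<close> is a closed cell. It contains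
  \<open>x\<close>, so it is not a vertex; it is not a face, since a face has points off all edges;
  and an edge through \<open>x\<close> can only be \<open>e\<close>.\<close>

lemma edge_subset_face:
  assumes "e \<in> E" "Q \<in> F" "x \<in> e" "x \<in> Q" "x \<notin> V"
  shows "e \<subseteq> Q"
proof -
  have "e \<inter> Q \<noteq> {}" using assms(3,4) by blast
  then have "e \<inter> Q \<in> closed_cells V E F"
    using strongly_regular[of e Q] assms(1,2) unfolding closed_cells_iff by simp
  then have "(\<exists>v\<in>V. e \<inter> Q = {v}) \<or> e \<inter> Q \<in> E \<or> e \<inter> Q \<in> F"
    unfolding closed_cells_iff .
  then show ?thesis
  proof (elim disjE bexE)
    fix v assume v: "v \<in> V" "e \<inter> Q = {v}"
    have "x \<in> e \<inter> Q" using assms(3,4) by simp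
    then show ?thesis using v assms(5) by simp
  next
    assume E: "e \<inter> Q \<in> E"
    have "e = e \<inter> Q" by (rule edge_eqI[OF assms(1) E assms(3) _ assms(5)]) (use assms(3,4) in simp)
    then show ?thesis by blast
  next
    assume F: "e \<inter> Q \<in> F"
    have "e \<inter> Q \<subseteq> \<Union>E" using assms(1) by blast
    then show ?thesis using face_not_in_edges[OF F] by simp
  qed
qed

lemma face_intersection:
  assumes "Q \<in> F" "Q' \<in> F" "Q \<noteq> Q'" "x \<in> Q" "x \<in> Q'"
  shows "(x \<in> V \<and> Q \<inter> Q' = {x}) \<or> (Q \<inter> Q' \<in> E)"
proof -
  have "Q \<inter> Q' \<noteq> {}" using assms(4,5) by blast
  then have "Q \<inter> Q' \<in> closed_cells V E F"
    using strongly_regular[of Q Q'] assms(1,2) unfolding closed_cells_iff by simp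
  moreover have "Q \<inter> Q' \<notin> F" using face_not_in_edges[of "Q \<inter> Q'"] faces_disjoint[OF assms(1-3)] by blast
  ultimately have "(\<exists>v\<in>V. Q \<inter> Q' = {v}) \<or> Q \<inter> Q' \<in> E" unfolding closed_cells_iff by simp
  then show ?thesis
  proof (elim disjE bexE)
    fix v assume v: "v \<in> V" "Q \<inter> Q' = {v}"
    have "x \<in> Q \<inter> Q'" using assms(4,5) by simp
    then show ?thesis using v by simp
  qed simp
qed

text \<open>An inner point of \<open>e\<close> rules out that the intersection is a vertex. Thus
  distinct faces at \<open>x\<close> can share only an edge through \<open>x\<close>, and the
  conditions on a germ at \<open>x\<close> concern edges at \<open>x\<close> alone.\<close>

lemma common_edge_unique:
  assumes "Q \<in> F" "Q' \<in> F" "Q \<noteq> Q'" "e \<in> E" "e \<subseteq> Q" "e \<subseteq> Q'" "x \<in> Q" "x \<in> Q'"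
  shows "Q \<inter> Q' = e" "x \<in> e"
proof -
  obtain y where y: "y \<in> e" "y \<notin> V" using edge_inner_point assms(4) by blast
  then have "Q \<inter> Q' \<in> E" using face_intersection[OF assms(1-3), of y] assms by blast
  then show "Q \<inter> Q' = e" using edge_eqI[of "Q \<inter> Q'" e y] y assms by blast
  then show "x \<in> e" using assms by blast
qed

lemma side_vertices:
  assumes hk: "face_chart V E Q h k"
    and ab: "closed_segment a b \<in> square_sides" "a \<in> square_corners" "b \<in> square_corners" "a \<noteq> b"
  shows "h ` closed_segment a b \<inter> V = {h a, h b}"
proof -
  have "a \<in> square" "b \<in> square" using side_subset[OF ab(1)] by auto
  then have ne: "h a \<noteq> h b" using face_chartD(2)[OF hk] ab(4) by (auto dest: inj_onD)
  obtain v w where vw: "h ` closed_segment a b \<inter> V = {v, w}"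
    using edge_endpoints[OF face_chartD(8)[OF hk ab(1)]] by blast
  have "{h a, h b} \<subseteq> {v, w}" using face_chartD(7)[OF hk] ab vw[symmetric] by auto
  then show ?thesis using ne vw by auto
qed

lemma face_chart_props:
  assumes "Q \<in> F" and hk: "face_chart V E Q h k"
  shows "Q \<inter> V = h ` square_corners" "{e \<in> E. e \<subseteq> Q} = (\<lambda>s. h ` s) ` square_sides"
    "Q - \<Union>E = h ` box 0 (Complex 1 1)"
proof -
  note corners = face_chartD(7)[OF assms(2)] and sides = face_chartD(8)[OF assms(2)]
    and im = face_chartD(1)[OF assms(2)] and inj = face_chartD(2)[OF assms(2)]
  have disj: "h ` box 0 (Complex 1 1) \<inter> (V \<union> \<Union>E) = {}" using assms(2) unfolding face_chart_def by auto
  have in_side: "\<exists>s\<in>square_sides. y \<in> h ` s" if y: "y \<in> Q" "y \<in> V \<union> \<Union>E" for y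
  proof -
    obtain z where z: "z \<in> square" "y = h z" using im y by blast
    then have "z \<notin> box 0 (Complex 1 1)" using disj y by blast
    then show ?thesis using square_cases[OF z(1)] z(2) by blast
  qed
  have boxsub: "box 0 (Complex 1 1) \<subseteq> square" by (rule box_subset_cbox)
  have side_ends: "h ` s \<inter> V \<subseteq> h ` square_corners" if "s \<in> square_sides" for s
    using that side_vertices[OF hk, of 0 1] side_vertices[OF hk, of 1 "Complex 1 1"] side_vertices[OF hk, of "Complex 1 1" \<i>] side_vertices[OF hk, of \<i> 0]
    unfolding square_sides_def square_corners_def by (auto simp: complex_eq_iff)
  show "Q \<inter> V = h ` square_corners"
  proof
    show "Q \<inter> V \<subseteq> h ` square_corners"
    proof
      fix y assume y: "y \<in> Q \<inter> V"
      then obtain s where "s \<in> square_sides" "y \<in> h ` s" using in_side[of y] by auto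
      then show "y \<in> h ` square_corners" using side_ends[of s] y by auto
    qed
    have "square_corners \<subseteq> square" unfolding square_corners_def by (auto simp: mem_square)
    then show "h ` square_corners \<subseteq> Q \<inter> V" using corners im by blast
  qed
  show "{e \<in> E. e \<subseteq> Q} = (\<lambda>s. h ` s) ` square_sides"
  proof
    show "(\<lambda>s. h ` s) ` square_sides \<subseteq> {e \<in> E. e \<subseteq> Q}"
    proof (rule image_subsetI)
      fix s assume s: "s \<in> square_sides"
      show "h ` s \<in> {e \<in> E. e \<subseteq> Q}" using image_mono[OF side_subset[OF s], of h] sides[OF s] im by simp
    qed
    show "{e \<in> E. e \<subseteq> Q} \<subseteq> (\<lambda>s. h ` s) ` square_sides"
    proof
      fix e assume "e \<in> {e \<in> E. e \<subseteq> Q}"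
      then have e: "e \<in> E" "e \<subseteq> Q" by auto
      obtain x where x: "x \<in> e" "x \<notin> V" using edge_inner_point[OF e(1)] by blast
      have "x \<in> Q" "x \<in> V \<union> \<Union>E" using x(1) e by auto
      then obtain s where s: "s \<in> square_sides" "x \<in> h ` s" using in_side by blast
      have "e = h ` s" by (rule edge_eqI[OF e(1) sides[OF s(1)] x(1) s(2) x(2)])
      then show "e \<in> (\<lambda>s. h ` s) ` square_sides" using s(1) by simp
    qed
  qed
  show "Q - \<Union>E = h ` box 0 (Complex 1 1)"
  proof
    show "h ` box 0 (Complex 1 1) \<subseteq> Q - \<Union>E" using disj image_mono[OF boxsub, of h] unfolding im by auto
    show "Q - \<Union>E \<subseteq> h ` box 0 (Complex 1 1)"
    proof
      fix y assume y: "y \<in> Q - \<Union>E"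
      then obtain z where z: "z \<in> square" "y = h z" using im by blast
      have "z \<notin> s" if s: "s \<in> square_sides" for s
      proof
        assume "z \<in> s"
        then have "y \<in> h ` s" using z(2) by simp
        then show False using y sides[OF s] by auto
      qed
      then show "y \<in> h ` box 0 (Complex 1 1)" using square_cases[OF z(1)] z(2) by auto
    qed
  qed
qed

lemma face_corners:
  assumes Q: "Q \<in> F"
  obtains v0 v1 v2 v3 e0 e1 e2 e3 where
    "distinct [v0, v1, v2, v3]" "Q \<inter> V = {v0, v1, v2, v3}" "{e \<in> E. e \<subseteq> Q} = {e0, e1, e2, e3}"
    "e0 \<inter> V = {v0, v1}" "e1 \<inter> V = {v1, v2}" "e2 \<inter> V = {v2, v3}" "e3 \<inter> V = {v3, v0}"
proof -
  obtain h k where hk: "face_chart V E Q h k" using face_chart_ex[OF Q] by blast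
  note corners = face_chartD(7)[OF hk] and sides = face_chartD(8)[OF hk] and inj = face_chartD(2)[OF hk]
  have sq: "0 \<in> square" "1 \<in> square" "Complex 1 1 \<in> square" "\<i> \<in> square"
    by (auto simp: mem_square)
  have ne: "h a \<noteq> h b" if "a \<in> square" "b \<in> square" "a \<noteq> b" for a b
    using that inj by (auto dest: inj_onD)
  have d: "distinct [h 0, h 1, h (Complex 1 1), h \<i>]"
    using ne sq by (auto simp: complex_eq_iff)
  show thesis
  proof (rule that[OF d, of "h ` closed_segment 0 1" "h ` closed_segment 1 (Complex 1 1)"
        "h ` closed_segment (Complex 1 1) \<i>" "h ` closed_segment \<i> 0"])
    show "Q \<inter> V = {h 0, h 1, h (Complex 1 1), h \<i>}"
      using face_chart_props(1)[OF Q hk] unfolding square_corners_def by simp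
    show "{e \<in> E. e \<subseteq> Q} = {h ` closed_segment 0 1, h ` closed_segment 1 (Complex 1 1),
        h ` closed_segment (Complex 1 1) \<i>, h ` closed_segment \<i> 0}"
      using face_chart_props(2)[OF Q hk] unfolding square_sides_def by simp
  qed (rule side_vertices[OF hk]; auto simp: square_sides_def square_corners_def complex_eq_iff)+
qed

text \<open>Contracting the square towards its centre moves \<open>x\<close> off the edges at once.
  In this way every face at \<open>x\<close> is detected, by its open part, in arbitrarily small
  neighbourhoods of \<open>x\<close>.\<close>

lemma interior_point_near:
  assumes Q: "Q \<in> F" and x: "x \<in> Q" and N: "openin (top_of_set S) N" "x \<in> N"
  shows "\<exists>y\<in>N. y \<in> Q - \<Union>E"
proof -
  obtain h k where hk: "face_chart V E Q h k" using face_chart_ex[OF Q] by blast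
  note im = face_chartD(1)[OF hk] and cont = face_chartD(3)[OF hk]
    and kx = face_chartD(4)[OF hk x] face_chartD(5)[OF hk x]
  define p where "p t = (1 - t) *\<^sub>R k x + t *\<^sub>R centre" for t
  have p_sq: "p t \<in> square" if "t \<in> {0..1}" for t
    unfolding p_def
    by (rule convexD[OF convex_box(1) kx(1)]) (use that in \<open>auto simp: mem_square\<close>)
  have "continuous_on {0..1} (\<lambda>t. h (p t))"
    by (rule continuous_on_compose2[OF cont]) (use p_sq in \<open>auto simp: p_def intro!: continuous_intros\<close>)
  moreover have "(\<lambda>t. h (p t)) \<in> {0..1} \<rightarrow> S" using p_sq im face_subset_S[OF Q] by auto
  ultimately have "openin (top_of_set {0..1}) ({0..1} \<inter> (\<lambda>t. h (p t)) -` N)"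
    using N(1) by (rule continuous_openin_preimage)
  then obtain T where T: "open T" "{0..1} \<inter> (\<lambda>t. h (p t)) -` N = {0..1} \<inter> T" by (auto simp: openin_open)
  have "h (p 0) = x" unfolding p_def using kx by simp
  then have "0 \<in> {0..1} \<inter> (\<lambda>t. h (p t)) -` N" using N(2) by simp
  then have "0 \<in> T" using T(2) by blast
  then obtain \<epsilon> where \<epsilon>: "\<epsilon> > 0" "ball 0 \<epsilon> \<subseteq> T" using T(1) open_contains_ball by blast
  define t where "t = min (\<epsilon> / 2) 1"
  have t: "0 < t" "t \<le> 1" "t \<in> ball 0 \<epsilon>" using \<epsilon>(1) unfolding t_def by auto
  then have "t \<in> {0..1} \<inter> (\<lambda>t. h (p t)) -` N" unfolding T(2) using \<epsilon>(2) by auto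
  then have "h (p t) \<in> N" by blast
  moreover have "p t \<in> box 0 (Complex 1 1)" unfolding p_def by (rule shrink_square) (use kx t in auto)
  ultimately show ?thesis using face_chart_props(3)[OF Q hk] by blast
qed

end

section \<open>Local structure of the surface\<close>

text \<open>A weak way of saying that \<open>N\<close> contains a disc around \<open>x\<close>: the
  map is asked to be continuous and injective on an open set, and invariance of domain supplies
  openness of the image.\<close>

definition planar_in :: "'a::t2_space \<Rightarrow> 'a set \<Rightarrow> bool"
  where "planar_in x N \<longleftrightarrow> (\<exists>D (g :: complex \<Rightarrow> 'a). open D \<and> continuous_on D g \<and> inj_on g D \<and> x \<in> g ` D \<and> g ` D \<subseteq> N)"

definition surface_chart :: "'a::t2_space set \<Rightarrow> 'a set \<Rightarrow> complex set \<Rightarrow> ('a \<Rightarrow> complex) \<Rightarrow> (complex \<Rightarrow> 'a) \<Rightarrow> bool"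
  where "surface_chart S U W \<phi> \<psi> \<longleftrightarrow> openin (top_of_set S) U \<and>
    openin (top_of_set closed_half_plane) W \<and> homeomorphism U W \<phi> \<psi>"

lemma surface_chartD:
  assumes "surface_chart S U W \<phi> \<psi>"
  shows "openin (top_of_set S) U" "openin (top_of_set closed_half_plane) W"
    "continuous_on U \<phi>" "continuous_on W \<psi>" "\<And>y. y \<in> U \<Longrightarrow> \<phi> y \<in> W" "\<And>y. y \<in> U \<Longrightarrow> \<psi> (\<phi> y) = y"
    "\<And>z. z \<in> W \<Longrightarrow> \<psi> z \<in> U" "\<And>z. z \<in> W \<Longrightarrow> \<phi> (\<psi> z) = z" "U \<subseteq> S" "\<And>z. z \<in> W \<Longrightarrow> 0 \<le> Im z"
proof -
  have "openin (top_of_set S) U" "openin (top_of_set closed_half_plane) W" "homeomorphism U W \<phi> \<psi>"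
    using assms unfolding surface_chart_def by auto
  then show "openin (top_of_set S) U" "openin (top_of_set closed_half_plane) W"
    "continuous_on U \<phi>" "continuous_on W \<psi>" "\<And>y. y \<in> U \<Longrightarrow> \<phi> y \<in> W" "\<And>y. y \<in> U \<Longrightarrow> \<psi> (\<phi> y) = y"
    "\<And>z. z \<in> W \<Longrightarrow> \<psi> z \<in> U" "\<And>z. z \<in> W \<Longrightarrow> \<phi> (\<psi> z) = z" "U \<subseteq> S"
    by (auto simp: homeomorphism_def dest: openin_imp_subset)
  show "0 \<le> Im z" if "z \<in> W" for z
    using openin_imp_subset[OF \<open>openin (top_of_set closed_half_plane) W\<close>] that
    unfolding closed_half_plane_def by auto
qed

lemma chart_preimage_openin:
  assumes "surface_chart S U W \<phi> \<psi>" "open R"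
  shows "openin (top_of_set S) {y \<in> U. \<phi> y \<in> R}"
proof -
  have "openin (top_of_set U) (U \<inter> \<phi> -` R)"
    by (rule continuous_openin_preimage_gen[OF surface_chartD(3)[OF assms(1)] assms(2)])
  moreover have "U \<inter> \<phi> -` R = {y \<in> U. \<phi> y \<in> R}" by auto
  ultimately show ?thesis using openin_trans surface_chartD(1)[OF assms(1)] by metis
qed

text \<open>Both parts are instances of invariance of domain.\<close>

lemma planar_in_chart:
  assumes ch: "surface_chart S U W \<phi> \<psi>" and x: "x \<in> U" and pl: "planar_in x N" and N: "N \<subseteq> S"
  shows "0 < Im (\<phi> x)" "\<exists>M. openin (top_of_set S) M \<and> x \<in> M \<and> M \<subseteq> N"
proof -
  note c = surface_chartD[OF ch]
  obtain D and g :: "complex \<Rightarrow> 'a" where g: "open D" "continuous_on D g" "inj_on g D" "x \<in> g ` D" "g ` D \<subseteq> N"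
    using pl unfolding planar_in_def by blast
  define D' where "D' = D \<inter> g -` U"
  have "openin (top_of_set D) D'" unfolding D'_def
    by (rule continuous_openin_preimage[OF g(2) _ c(1)]) (use g(5) N in auto)
  then have D': "open D'" using g(1) openin_open_trans by blast
  have sub: "D' \<subseteq> D" "g ` D' \<subseteq> U" unfolding D'_def by auto
  define R where "R = (\<lambda>z. \<phi> (g z)) ` D'"
  have "open R" unfolding R_def
  proof (rule invariance_of_domain[OF _ D'])
    show "continuous_on D' (\<lambda>z. \<phi> (g z))"
      by (rule continuous_on_compose2[OF c(3) continuous_on_subset[OF g(2) sub(1)] sub(2)])
    show "inj_on (\<lambda>z. \<phi> (g z)) D'"
    proof (rule inj_onI)
      fix y z assume yz: "y \<in> D'" "z \<in> D'" "\<phi> (g y) = \<phi> (g z)"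
      then have "g y \<in> U" "g z \<in> U" using sub(2) by auto
      then have "g y = g z" using c(6) yz(3) by metis
      then show "y = z" using inj_onD[OF g(3)] yz sub(1) by blast
    qed
  qed
  obtain z where z: "z \<in> D" "x = g z" using g(4) by blast
  then have xR: "\<phi> x \<in> R" using x unfolding R_def D'_def by auto
  have R_W: "R \<subseteq> W" unfolding R_def using sub(2) c(5) by auto
  obtain \<epsilon> where \<epsilon>: "\<epsilon> > 0" "ball (\<phi> x) \<epsilon> \<subseteq> R" using \<open>open R\<close> xR open_contains_ball by blast
  have "\<phi> x - (\<epsilon> / 2) *\<^sub>R \<i> \<in> ball (\<phi> x) \<epsilon>" using \<epsilon>(1) by (simp add: dist_norm)
  then have "\<phi> x - (\<epsilon> / 2) *\<^sub>R \<i> \<in> W" using \<epsilon>(2) R_W by blast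
  then show "0 < Im (\<phi> x)" using c(10) \<epsilon>(1) by fastforce
  show "\<exists>M. openin (top_of_set S) M \<and> x \<in> M \<and> M \<subseteq> N"
  proof (intro exI conjI)
    show "openin (top_of_set S) {y \<in> U. \<phi> y \<in> R}" by (rule chart_preimage_openin[OF ch \<open>open R\<close>])
    show "x \<in> {y \<in> U. \<phi> y \<in> R}" using x xR by simp
    show "{y \<in> U. \<phi> y \<in> R} \<subseteq> N"
    proof
      fix y assume "y \<in> {y \<in> U. \<phi> y \<in> R}"
      then obtain z where z: "y \<in> U" "z \<in> D'" "\<phi> y = \<phi> (g z)" unfolding R_def by auto
      then have "g z \<in> U" using sub(2) by auto
      then have "y = g z" using c(6) z by metis
      then show "y \<in> N" using z(2) sub(1) g(5) by auto
    qed
  qed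
qed

lemma interior_finite_Union_closed:
  assumes "finite \<C>" "\<And>C. C \<in> \<C> \<Longrightarrow> closed C \<and> interior C = {}"
  shows "interior (\<Union>\<C>) = {}"
  using assms
proof (induction \<C>)
  case (insert C \<C>)
  have "interior (C \<union> \<Union>\<C>) = interior C"
    by (rule interior_closed_Un_empty_interior) (use insert in auto)
  then show ?case using insert by simp
qed simp

section \<open>Neighbourhoods of inner points of faces and edges\<close>

context quad_graph
begin

lemma surface_chart_ex:
  assumes "x \<in> S" shows "\<exists>U W \<phi> \<psi>. surface_chart S U W \<phi> \<psi> \<and> x \<in> U"
proof -
  have "\<forall>x\<in>S. \<exists>U W. openin (top_of_set S) U \<and> x \<in> U \<and>
         openin (top_of_set closed_half_plane) W \<and> U homeomorphic W"
    using surface unfolding surface_def by (rule conjunct2)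
  then obtain U W where "openin (top_of_set S) U" "x \<in> U" "openin (top_of_set closed_half_plane) W" "U homeomorphic W"
    using assms by meson
  then show ?thesis unfolding surface_chart_def homeomorphic_def by blast
qed

lemma planar_in_nbhd:
  assumes "planar_in x N" "N \<subseteq> S" "x \<in> S"
  shows "\<exists>M. openin (top_of_set S) M \<and> x \<in> M \<and> M \<subseteq> N"
proof -
  obtain U W \<phi> \<psi> where "surface_chart S U W \<phi> \<psi>" "x \<in> U" using surface_chart_ex[OF assms(3)] by blast
  then show ?thesis by (rule planar_in_chart(2)) fact+
qed

lemma planar_in_face:
  assumes "Q \<in> F" "x \<in> Q - \<Union>E"
  shows "planar_in x Q"
proof -
  obtain h k where hk: "face_chart V E Q h k" using face_chart_ex[OF assms(1)] by blast
  have sub: "box 0 (Complex 1 1) \<subseteq> square" by (rule box_subset_cbox)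
  show ?thesis unfolding planar_in_def
  proof (intro exI conjI)
    show "continuous_on (box 0 (Complex 1 1)) h" using face_chartD(3)[OF hk] sub by (rule continuous_on_subset)
    show "inj_on h (box 0 (Complex 1 1))" using face_chartD(2)[OF hk] sub by (rule inj_on_subset)
    show "x \<in> h ` box 0 (Complex 1 1)" using assms(2) face_chart_props(3)[OF assms(1) hk] by simp
    show "h ` box 0 (Complex 1 1) \<subseteq> Q" using image_mono[OF sub, of h] face_chartD(1)[OF hk] by simp
  qed (rule open_box)
qed

text \<open>The side is moved towards the centre of the square, with \<open>\<sigma>\<close> as
  time. Time 1 is left out, as there everything collapses to the centre; before that, the height
  over the side recovers \<open>\<sigma>\<close>, and then the starting point.\<close>

lemma collar_ex:
  assumes Q: "Q \<in> F" and e: "e \<in> E" "e \<subseteq> Q"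
  shows "\<exists>C :: 'a \<times> real \<Rightarrow> 'a. (\<forall>p\<in>e. C (p, 0) = p) \<and> (\<forall>p\<in>e. \<forall>\<sigma>\<in>{0<..<1}. C (p, \<sigma>) \<in> Q - \<Union>E) \<and>
    continuous_on (e \<times> {0..<1}) C \<and> inj_on C (e \<times> {0..<1})"
proof -
  obtain h k where hk: "face_chart V E Q h k" using face_chart_ex[OF Q] by blast
  have "e \<in> (\<lambda>s. h ` s) ` square_sides" using e face_chart_props(2)[OF Q hk] by auto
  then obtain s where s: "s \<in> square_sides" "e = h ` s" by auto
  obtain l :: "complex \<Rightarrow> real" where l: "\<And>z. z \<in> s \<Longrightarrow> l z = 0" "l centre = 1 / 2"
    "\<And>z \<sigma>. l ((1 - \<sigma>) *\<^sub>R z + \<sigma> *\<^sub>R centre) = (1 - \<sigma>) * l z + \<sigma> * l centre"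
    using side_height[OF s(1)] by auto
  have k_s: "k p \<in> s" "k p \<in> square" "h (k p) = p" if p: "p \<in> e" for p
  proof -
    obtain z where z: "z \<in> s" "p = h z" using p s(2) by auto
    have zsq: "z \<in> square" using side_subset[OF s(1)] z(1) by auto
    have pQ: "p \<in> Q" using p e by auto
    show ksq: "k p \<in> square" and hkp: "h (k p) = p" using face_chartD(4,5)[OF hk pQ] by auto
    have "k p = z" by (rule inj_onD[OF face_chartD(2)[OF hk]]) (use hkp z(2) ksq zsq in auto)
    then show "k p \<in> s" using z(1) by simp
  qed
  define q where "q x = (1 - snd x) *\<^sub>R k (fst x) + snd x *\<^sub>R centre" for x :: "'a \<times> real"
  have q_box: "q (p, \<sigma>) \<in> box 0 (Complex 1 1)" if "p \<in> e" "0 < \<sigma>" "\<sigma> \<le> 1" for p \<sigma>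
    unfolding q_def using shrink_square[OF k_s(2)[OF that(1)] that(2,3)] by simp
  have q_sq: "q x \<in> square" if x: "x \<in> e \<times> {0..<1}" for x
  proof (cases "snd x = 0")
    case True
    then show ?thesis using k_s(2)[of "fst x"] x unfolding q_def by auto
  next
    case False
    then have "q (fst x, snd x) \<in> box 0 (Complex 1 1)" using x by (intro q_box) auto
    then show ?thesis using box_subset_cbox by fastforce
  qed
  show ?thesis
  proof (intro exI[of _ "\<lambda>x. h (q x)"] conjI ballI)
    show "h (q (p, 0)) = p" if "p \<in> e" for p using k_s(3)[OF that] unfolding q_def by simp
    show "h (q (p, \<sigma>)) \<in> Q - \<Union>E" if "p \<in> e" "\<sigma> \<in> {0<..<1}" for p \<sigma>
      unfolding face_chart_props(3)[OF Q hk] using that by (intro imageI q_box) auto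
    have "continuous_on (e \<times> {0..<1}) (\<lambda>x. k (fst x))"
      by (rule continuous_on_compose2[OF face_chartD(6)[OF hk]]) (use e in \<open>auto intro!: continuous_intros\<close>)
    then have "continuous_on (e \<times> {0..<1}) q" unfolding q_def by (intro continuous_intros)
    then show "continuous_on (e \<times> {0..<1}) (\<lambda>x. h (q x))"
      by (rule continuous_on_compose2[OF face_chartD(3)[OF hk]]) (use q_sq in auto)
    show "inj_on (\<lambda>x. h (q x)) (e \<times> {0..<1})"
    proof (rule inj_onI)
      fix x y assume x: "x \<in> e \<times> {0..<1}" and y: "y \<in> e \<times> {0..<1}" and eq: "h (q x) = h (q y)"
      have qeq: "q x = q y" by (rule inj_onD[OF face_chartD(2)[OF hk] eq q_sq[OF x] q_sq[OF y]])
      have lq: "l (q z) = snd z / 2" if "z \<in> e \<times> {0..<1}" for z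
        unfolding q_def l(3) using l(1)[OF k_s(1), of "fst z"] l(2) that by auto
      have sn: "snd x = snd y" using lq[OF x] lq[OF y] qeq by simp
      then have "(1 - snd x) *\<^sub>R k (fst x) = (1 - snd x) *\<^sub>R k (fst y)"
        using qeq unfolding q_def by simp
      then have "k (fst x) = k (fst y)" using x by auto
      then have "fst x = fst y" using k_s(3)[of "fst x"] k_s(3)[of "fst y"] x y by auto
      then show "x = y" using sn by (simp add: prod_eq_iff)
    qed
  qed
qed

text \<open>The collars of \<open>e\<close> in the two faces are glued along \<open>e\<close>, which
  is parametrised by an arc: the upper half of an open rectangle maps into \<open>Q\<close>, the
  lower half into \<open>Q'\<close>, and both collars start on the edge itself. The halves have
  disjoint images because the part above the axis avoids all edges, whereas
  \<open>Q \<inter> Q'\<close> lies in edges.\<close>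

lemma planar_in_two_faces:
  assumes Q: "Q \<in> F" "Q' \<in> F" "Q \<noteq> Q'" and e: "e \<in> E" "e \<subseteq> Q" "e \<subseteq> Q'" and x: "x \<in> e" "x \<notin> V"
  shows "planar_in x (Q \<union> Q')"
proof -
  obtain C where C0: "\<forall>p\<in>e. C (p, 0) = p" "\<forall>p\<in>e. \<forall>\<sigma>\<in>{0<..<1}. C (p, \<sigma>) \<in> Q - \<Union>E"
    "continuous_on (e \<times> {0..<1::real}) C" "inj_on C (e \<times> {0..<1})"
    using collar_ex[OF Q(1) e(1,2)] by (elim exE conjE) (rule that; assumption)
  note C = C0(1,2)[rule_format] C0(3,4)
  obtain C' where C0': "\<forall>p\<in>e. C' (p, 0) = p" "\<forall>p\<in>e. \<forall>\<sigma>\<in>{0<..<1}. C' (p, \<sigma>) \<in> Q' - \<Union>E"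
    "continuous_on (e \<times> {0..<1::real}) C'" "inj_on C' (e \<times> {0..<1})"
    using collar_ex[OF Q(2) e(1,3)] by (elim exE conjE) (rule that; assumption)
  note C' = C0'(1,2)[rule_format] C0'(3,4)
  obtain g where g: "arc g" "path_image g = e" "e \<inter> V = {pathstart g, pathfinish g}"
    using edge_cells[OF e(1)] unfolding edge_cell_def by blast
  have gcont: "continuous_on {0..1} g" and ginj: "inj_on g {0..1}" and gim: "g ` {0..1} = e"
    using g unfolding arc_def path_def path_image_def by auto
  define D where "D = box (Complex 0 (-1)) (Complex 1 1)"
  have D: "z \<in> D \<longleftrightarrow> 0 < Re z \<and> Re z < 1 \<and> -1 < Im z \<and> Im z < 1" for z
    unfolding D_def by (auto simp: in_box_complex_iff)
  have gRe: "g (Re z) \<in> e" if "z \<in> D" for z using that gim unfolding D by auto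
  have gD: "continuous_on D (\<lambda>z. g (Re z))"
    by (rule continuous_on_compose2[OF gcont]) (auto simp: D intro!: continuous_intros)
  define f where "f z = (if Im z \<le> 0 then C' (g (Re z), - Im z) else C (g (Re z), Im z))" for z
  have cont: "continuous_on D f" unfolding f_def
  proof (rule continuous_on_cases_le)
    show "continuous_on {z \<in> D. Im z \<le> 0} (\<lambda>z. C' (g (Re z), - Im z))"
      by (rule continuous_on_compose2[OF C'(3)])
        (auto simp: D intro!: continuous_intros gRe continuous_on_subset[OF gD])
    show "continuous_on {z \<in> D. 0 \<le> Im z} (\<lambda>z. C (g (Re z), Im z))"
      by (rule continuous_on_compose2[OF C(3)])
        (auto simp: D intro!: continuous_intros gRe continuous_on_subset[OF gD])
  qed (use C(1) C'(1) gRe in \<open>auto intro!: continuous_intros\<close>)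
  have upper: "f z \<in> Q - \<Union>E" if "z \<in> D" "0 < Im z" for z
    unfolding f_def using that C(2)[OF gRe[OF that(1)], of "Im z"] D by auto
  have lower: "f z \<in> Q'" if z: "z \<in> D" "Im z \<le> 0" for z
  proof (cases "Im z = 0")
    case True
    then have "f z = g (Re z)" unfolding f_def using C'(1)[OF gRe[OF z(1)]] by simp
    then show ?thesis using gRe[OF z(1)] e(3) by auto
  next
    case False
    then have "f z \<in> Q' - \<Union>E" unfolding f_def using z C'(2)[OF gRe[OF z(1)], of "- Im z"] D by auto
    then show ?thesis by blast
  qed
  have QQ: "Q \<inter> Q' \<subseteq> \<Union>E" by (rule faces_disjoint[OF Q])
  have inj: "inj_on f D"
  proof (rule inj_onI)
    fix y z assume y: "y \<in> D" and z: "z \<in> D" and eq: "f y = f z"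
    have same: "(Im y \<le> 0) = (Im z \<le> 0)"
      using upper[of y] upper[of z] lower[of y] lower[of z] y z eq QQ by (cases "Im y \<le> 0"; cases "Im z \<le> 0") auto
    have "g (Re y) = g (Re z) \<and> Im y = Im z"
    proof (cases "Im y \<le> 0")
      case True
      then have "C' (g (Re y), - Im y) = C' (g (Re z), - Im z)" using same eq unfolding f_def by simp
      from inj_onD[OF C'(4) this] show ?thesis using gRe y z True same D by auto
    next
      case False
      then have "C (g (Re y), Im y) = C (g (Re z), Im z)" using same eq unfolding f_def by simp
      from inj_onD[OF C(4) this] show ?thesis using gRe y z False same D by auto
    qed
    moreover have "Re y = Re z" by (rule inj_onD[OF ginj]) (use calculation y z D in auto)
    ultimately show "y = z" by (simp add: complex_eq_iff)
  qed
  obtain t where t: "t \<in> {0..1}" "x = g t" using x(1) gim by auto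
  have "t \<noteq> 0" "t \<noteq> 1" using t(2) x g(3) unfolding pathstart_def pathfinish_def by auto
  then have tD: "Complex t 0 \<in> D" using t(1) unfolding D by auto
  have "f (Complex t 0) = x" unfolding f_def using C'(1)[of x] x(1) t(2) by simp
  then have "x \<in> f ` D" using tD by (metis imageI)
  moreover have "f ` D \<subseteq> Q \<union> Q'" using upper lower by (auto simp: not_le[symmetric])
  moreover have "open D" unfolding D_def by (rule open_box)
  ultimately show ?thesis unfolding planar_in_def using cont inj by blast
qed

text \<open>Two of the faces already fill a neighbourhood of an inner point of \<open>e\<close>; a
  third would have points off all edges in it, and these would lie in two faces.\<close>

lemma at_most_two_faces:
  assumes Q: "Q1 \<in> F" "Q2 \<in> F" "Q3 \<in> F" and e: "e \<in> E" "e \<subseteq> Q1" "e \<subseteq> Q2" "e \<subseteq> Q3"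
  shows "Q1 = Q2 \<or> Q1 = Q3 \<or> Q2 = Q3"
proof (rule ccontr)
  assume ne: "\<not> ?thesis"
  obtain x where x: "x \<in> e" "x \<notin> V" using edge_inner_point[OF e(1)] by blast
  have "planar_in x (Q1 \<union> Q2)" using planar_in_two_faces[OF Q(1,2) _ e(1-3) x] ne by simp
  moreover have "Q1 \<union> Q2 \<subseteq> S" "x \<in> S" using face_subset_S Q edge_subset_S[OF e(1)] x by auto
  ultimately obtain M where M: "openin (top_of_set S) M" "x \<in> M" "M \<subseteq> Q1 \<union> Q2"
    using planar_in_nbhd by blast
  have "x \<in> Q3" using x(1) e(4) by auto
  then obtain y where "y \<in> M" "y \<in> Q3 - \<Union>E" using interior_point_near[OF Q(3) _ M(1,2)] by blast
  then show False using M(3) faces_disjoint[of Q3 Q1] faces_disjoint[of Q3 Q2] Q ne by auto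
qed

end

section \<open>Faces and edges around a point\<close>

lemma half_plane_contains_ball:
  assumes "openin (top_of_set closed_half_plane) R" "R \<noteq> {}"
  shows "\<exists>z r. 0 < r \<and> cball z r \<subseteq> R"
proof -
  obtain T where T: "open T" "R = closed_half_plane \<inter> T" using assms(1) unfolding openin_open by blast
  obtain w where w: "w \<in> R" using assms(2) by blast
  then have w': "w \<in> T" "0 \<le> Im w" using T(2) unfolding closed_half_plane_def by auto
  obtain \<epsilon> where \<epsilon>: "\<epsilon> > 0" "ball w \<epsilon> \<subseteq> T" using T(1) w'(1) open_contains_ball by blast
  \<comment> \<open>The point \<open>w\<close> may lie on the boundary line, so the ball is centred
    higher by \<open>\<epsilon> / 2\<close>.\<close>
  define z where "z = w + (\<epsilon> / 2) *\<^sub>R \<i>"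
  have "cball z (\<epsilon> / 4) \<subseteq> R"
  proof
    fix u assume u: "u \<in> cball z (\<epsilon> / 4)"
    then have n: "norm (z - u) \<le> \<epsilon> / 4" by (simp add: dist_norm)
    have "\<bar>Im (z - u)\<bar> \<le> \<epsilon> / 4" using abs_Im_le_cmod[of "z - u"] n by linarith
    moreover have "Im (z - u) = Im w + \<epsilon> / 2 - Im u" unfolding z_def by simp
    ultimately have "0 \<le> Im u" using w'(2) \<epsilon>(1) by linarith
    have "norm (w - z) = \<epsilon> / 2" unfolding z_def using \<epsilon>(1) by (simp add: norm_mult)
    then have "dist w u < \<epsilon>" using n \<epsilon>(1) dist_triangle[of w u z] by (simp add: dist_norm)
    then show "u \<in> R" using \<epsilon>(2) \<open>0 \<le> Im u\<close> unfolding T(2) closed_half_plane_def by auto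
  qed
  then show ?thesis using \<epsilon>(1) by (intro exI[of _ z] exI[of _ "\<epsilon> / 4"]) auto
qed

lemma chart_half_ball:
  assumes ch: "surface_chart S P W \<phi> \<psi>" "v \<in> P" and U: "openin (top_of_set S) U" "v \<in> U"
  shows "\<exists>\<epsilon>>0. \<forall>z\<in>ball (\<phi> v) \<epsilon>. 0 \<le> Im z \<longrightarrow> z \<in> W \<and> \<psi> z \<in> U"
proof -
  note c = surface_chartD[OF ch(1)]
  have "openin (top_of_set W) (W \<inter> \<psi> -` U)"
    by (rule continuous_openin_preimage[OF c(4) _ U(1)]) (use c(7,9) in auto)
  then have "openin (top_of_set closed_half_plane) (W \<inter> \<psi> -` U)" using openin_trans c(2) by metis
  then obtain T where T: "open T" "W \<inter> \<psi> -` U = closed_half_plane \<inter> T" unfolding openin_open by blast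
  have "\<phi> v \<in> W \<inter> \<psi> -` U" using c(5,6) ch(2) U(2) by auto
  then have "\<phi> v \<in> T" using T(2) by auto
  then obtain \<epsilon> where \<epsilon>: "\<epsilon> > 0" "ball (\<phi> v) \<epsilon> \<subseteq> T" using T(1) open_contains_ball by blast
  have "z \<in> W \<and> \<psi> z \<in> U" if "z \<in> ball (\<phi> v) \<epsilon>" "0 \<le> Im z" for z
  proof -
    have "z \<in> closed_half_plane \<inter> T" using that \<epsilon>(2) unfolding closed_half_plane_def by auto
    then show ?thesis unfolding T(2)[symmetric] by simp
  qed
  then show ?thesis using \<epsilon>(1) by blast
qed

lemma open_plane_not_into_arc:
  fixes f :: "complex \<Rightarrow> 'a::t2_space"
  assumes "arc g" "open D" "D \<noteq> {}" "continuous_on D f" "inj_on f D" "f ` D \<subseteq> path_image g"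
  shows False
proof -
  obtain k where k: "homeomorphism {0..1} (path_image g) g k" using homeomorphism_arc[OF assms(1)] by blast
  then have kc: "continuous_on (path_image g) k" and gk: "\<And>x. x \<in> path_image g \<Longrightarrow> g (k x) = x"
    unfolding homeomorphism_def by auto
  have "continuous_on D (\<lambda>z. k (f z))" by (rule continuous_on_compose2[OF kc assms(4,6)])
  moreover have "inj_on (\<lambda>z. k (f z)) D"
  proof (rule inj_onI)
    fix y z assume yz: "y \<in> D" "z \<in> D" "k (f y) = k (f z)"
    have "f y \<in> path_image g" "f z \<in> path_image g" using yz(1,2) assms(6) by auto
    then have "g (k (f y)) = f y" "g (k (f z)) = f z" by (simp_all only: gk)
    then have "f y = f z" unfolding yz(3) by simp
    then show "y = z" using inj_onD[OF assms(5)] yz by blast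
  qed
  ultimately have "DIM(complex) \<le> DIM(real)"
    using assms(2,3) by (intro invariance_of_dimension[of D "\<lambda>z. k (f z)"]) auto
  then show False by simp
qed

context quad_graph
begin

lemma cell_compact: "c \<in> closed_cells V E F \<Longrightarrow> compact c"
  unfolding closed_cells_iff using edge_compact face_compact by auto

text \<open>Of the finitely many cells near \<open>x\<close>, those missing \<open>x\<close> are
  compact, hence closed; removing them from the neighbourhood leaves only cells through
  \<open>x\<close>.\<close>

lemma star_nbhd:
  assumes x: "x \<in> S"
  shows "\<exists>U. openin (top_of_set S) U \<and> x \<in> U \<and> finite {c \<in> closed_cells V E F. c \<inter> U \<noteq> {}} \<and>
    (\<forall>c\<in>closed_cells V E F. c \<inter> U \<noteq> {} \<longrightarrow> x \<in> c)"
proof -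
  obtain U where U: "openin (top_of_set S) U" "x \<in> U" "finite {c \<in> closed_cells V E F. c \<inter> U \<noteq> {}}"
    using locally_finite[OF x] by blast
  define \<K> where "\<K> = {c \<in> closed_cells V E F. c \<inter> U \<noteq> {} \<and> x \<notin> c}"
  have fin: "finite \<K>" by (rule finite_subset[OF _ U(3)]) (auto simp: \<K>_def)
  have "closed (\<Union>\<K>)" using fin cell_compact by (intro closed_Union) (auto simp: \<K>_def compact_imp_closed)
  then have "open (- \<Union>\<K>)" by (simp add: open_Compl)
  then have op: "openin (top_of_set S) (U \<inter> - \<Union>\<K>)" by (rule openin_Int_open[OF U(1)])
  show ?thesis
  proof (intro exI conjI ballI impI)
    show "x \<in> U \<inter> - \<Union>\<K>" using U(2) unfolding \<K>_def by auto
    show "finite {c \<in> closed_cells V E F. c \<inter> (U \<inter> - \<Union>\<K>) \<noteq> {}}"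
      by (rule finite_subset[OF _ U(3)]) auto
    show "x \<in> c" if c: "c \<in> closed_cells V E F" "c \<inter> (U \<inter> - \<Union>\<K>) \<noteq> {}" for c
    proof (rule ccontr)
      assume "x \<notin> c"
      then have "c \<in> \<K>" using c unfolding \<K>_def by auto
      then show False using c(2) by auto
    qed
  qed (rule op)
qed

lemma finite_cells_at: "x \<in> S \<Longrightarrow> finite {c \<in> closed_cells V E F. x \<in> c}"
proof -
  assume "x \<in> S"
  then obtain U where "x \<in> U" "finite {c \<in> closed_cells V E F. c \<inter> U \<noteq> {}}" using star_nbhd by blast
  then show ?thesis by (elim finite_subset[rotated]) auto
qed

lemma finite_faces_at: "x \<in> S \<Longrightarrow> finite {Q \<in> F. x \<in> Q}"
  by (rule finite_subset[OF _ finite_cells_at]) (auto simp: closed_cells_iff)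

text \<open>Without a face at \<open>x\<close>, finitely many vertices and edges would cover a
  neighbourhood of \<open>x\<close>. In a chart these become closed sets without inner points, and
  finitely many of them cannot cover a disc.\<close>

lemma point_in_face:
  assumes x: "x \<in> S"
  shows "\<exists>Q\<in>F. x \<in> Q"
proof (rule ccontr)
  assume none: "\<not> ?thesis"
  obtain U where U: "openin (top_of_set S) U" "x \<in> U" "finite {c \<in> closed_cells V E F. c \<inter> U \<noteq> {}}"
    "\<forall>c\<in>closed_cells V E F. c \<inter> U \<noteq> {} \<longrightarrow> x \<in> c" using star_nbhd[OF x] by blast
  define \<K> where "\<K> = {c \<in> closed_cells V E F. c \<inter> U \<noteq> {}}"
  have \<K>: "finite \<K>" using U(3) unfolding \<K>_def .
  have not_face: "c \<notin> F" if "c \<in> \<K>" for c using that U(4) none unfolding \<K>_def by auto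
  have cov: "U \<subseteq> \<Union>\<K>"
  proof
    fix y assume y: "y \<in> U"
    then have "y \<in> \<Union>(closed_cells V E F)" using cover openin_imp_subset[OF U(1)] by auto
    then show "y \<in> \<Union>\<K>" using y unfolding \<K>_def by auto
  qed
  obtain A W \<phi> \<psi> where ch: "surface_chart S A W \<phi> \<psi>" "x \<in> A" using surface_chart_ex[OF x] by blast
  note c = surface_chartD[OF ch(1)]
  define R where "R = {z \<in> W. \<psi> z \<in> U}"
  have "openin (top_of_set W) (W \<inter> \<psi> -` U)"
    by (rule continuous_openin_preimage[OF c(4) _ U(1)]) (use c(7,9) in auto)
  moreover have "W \<inter> \<psi> -` U = R" unfolding R_def by auto
  ultimately have R: "openin (top_of_set closed_half_plane) R" using openin_trans c(2) by metis
  have "\<phi> x \<in> R" unfolding R_def using c(5,6) ch(2) U(2) by auto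
  \<comment> \<open>The disc need not contain \<open>\<phi> x\<close>, as \<open>x\<close> may be a
    boundary point.\<close>
  then obtain z r where zr: "0 < r" "cball z r \<subseteq> R" using half_plane_contains_ball[OF R] by blast
  have contB: "continuous_on (cball z r) \<psi>" and injB: "inj_on \<psi> (cball z r)"
  proof -
    have sub: "cball z r \<subseteq> W" using zr(2) unfolding R_def by auto
    show "continuous_on (cball z r) \<psi>" using c(4) sub by (rule continuous_on_subset)
    show "inj_on \<psi> (cball z r)" by (rule inj_on_inverseI[where g = \<phi>]) (use c(8) sub in auto)
  qed
  define P where "P K = cball z r \<inter> \<psi> -` K" for K
  have closedP: "closed (P K)" if "K \<in> \<K>" for K
    unfolding P_def using contB
  proof (rule continuous_closed_preimage)
    show "closed K" using that cell_compact unfolding \<K>_def by (simp add: compact_imp_closed)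
  qed simp
  have "interior (P K) = {}" if K: "K \<in> \<K>" for K
  proof (rule ccontr)
    assume ne: "interior (P K) \<noteq> {}"
    have sub: "interior (P K) \<subseteq> cball z r" "\<psi> ` interior (P K) \<subseteq> K"
      using interior_subset[of "P K"] unfolding P_def by auto
    have cont: "continuous_on (interior (P K)) \<psi>" using contB sub(1) by (rule continuous_on_subset)
    have inj: "inj_on \<psi> (interior (P K))" using injB sub(1) by (rule inj_on_subset)
    have "K \<in> closed_cells V E F" using K unfolding \<K>_def by simp
    then have "(\<exists>v\<in>V. K = {v}) \<or> K \<in> E" using not_face[OF K] unfolding closed_cells_iff by simp
    then show False
    proof
      assume "\<exists>v\<in>V. K = {v}"
      then obtain v where "K = {v}" by blast
      then have "finite (\<psi> ` interior (P K))" using sub(2) finite_subset by blast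
      then have "finite (interior (P K))" using inj finite_imageD by blast
      then show False using ne finite_imp_not_open[of "interior (P K)"] open_interior by blast
    next
      assume "K \<in> E"
      then obtain g where g: "arc g" "path_image g = K" using edge_cells unfolding edge_cell_def by blast
      show False by (rule open_plane_not_into_arc[OF g(1) open_interior ne cont inj]) (use sub(2) g(2) in simp)
    qed
  qed
  then have "interior (\<Union>(P ` \<K>)) = {}"
    by (intro interior_finite_Union_closed) (use \<K> closedP in auto)
  moreover have "cball z r \<subseteq> \<Union>(P ` \<K>)"
  proof
    fix y assume y: "y \<in> cball z r"
    then have "\<psi> y \<in> U" using zr(2) unfolding R_def by auto
    then obtain K where "K \<in> \<K>" "\<psi> y \<in> K" using cov by auto
    then show "y \<in> \<Union>(P ` \<K>)" using y unfolding P_def by auto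
  qed
  then have "ball z r \<subseteq> interior (\<Union>(P ` \<K>))" by (intro interior_maximal) (auto simp: subset_eq)
  ultimately show False using zr(1) by auto
qed

lemma edge_in_face:
  assumes "e \<in> E" shows "\<exists>Q\<in>F. e \<subseteq> Q"
proof -
  obtain x where x: "x \<in> e" "x \<notin> V" using edge_inner_point[OF assms] by blast
  then obtain Q where "Q \<in> F" "x \<in> Q" using point_in_face edge_subset_S[OF assms] by blast
  then show ?thesis using edge_subset_face[OF assms _ x(1) _ x(2)] by blast
qed

lemma vertex_in_edge:
  assumes "Q \<in> F" "v \<in> Q" "v \<in> V"
  shows "v \<in> \<Union>E"
proof -
  obtain h k where hk: "face_chart V E Q h k" using face_chart_ex[OF assms(1)] by blast
  have "v \<in> h ` square_corners" using face_chart_props(1)[OF assms(1) hk] assms by auto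
  then obtain z where z: "z \<in> square_corners" "v = h z" by auto
  obtain s where s: "s \<in> square_sides" "z \<in> s" using corner_sides[OF z(1)] by blast
  then have "v \<in> h ` s" using z(2) by auto
  then show ?thesis using face_chartD(8)[OF hk s(1)] by blast
qed

text \<open>A small punctured disc or half-disc around \<open>v\<close> is connected and covered by
  the faces at \<open>v\<close>. If no edge at \<open>v\<close> joined \<open>A\<close> to its
  complement, faces of the two kinds would meet in \<open>v\<close> only, and their closed unions
  would disconnect the punctured set.\<close>

lemma link_connected:
  assumes v: "v \<in> V" and A: "A \<subseteq> {Q \<in> F. v \<in> Q}" "A \<noteq> {}" "A \<noteq> {Q \<in> F. v \<in> Q}"
  shows "\<exists>Q\<in>A. \<exists>Q'\<in>{Q \<in> F. v \<in> Q} - A. \<exists>e\<in>E. v \<in> e \<and> e \<subseteq> Q \<and> e \<subseteq> Q'"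
proof (rule ccontr)
  assume none: "\<not> ?thesis"
  define B where "B = {Q \<in> F. v \<in> Q} - A"
  have vS: "v \<in> S" using vertex_in_S[OF v] .
  have fin: "finite A" "finite B" using finite_faces_at[OF vS] A(1) finite_subset unfolding B_def by auto
  have face: "Q \<in> F" "v \<in> Q" if Q: "Q \<in> A \<or> Q \<in> B" for Q
  proof -
    have "Q \<in> {Q \<in> F. v \<in> Q}" using Q A(1) unfolding B_def by blast
    then show "Q \<in> F" "v \<in> Q" by simp_all
  qed
  have only_v: "Q \<inter> Q' = {v}" if Q: "Q \<in> A" "Q' \<in> B" for Q Q'
  proof -
    have F: "Q \<in> F" "Q' \<in> F" "v \<in> Q" "v \<in> Q'" using face[of Q] face[of Q'] Q by simp_all
    have F5: "Q \<noteq> Q'" using Q unfolding B_def by blast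
    have "Q \<inter> Q' \<notin> E"
    proof
      assume "Q \<inter> Q' \<in> E"
      then have "\<exists>e\<in>E. v \<in> e \<and> e \<subseteq> Q \<and> e \<subseteq> Q'" using F by (intro bexI[of _ "Q \<inter> Q'"]) simp_all
      then show False using none Q unfolding B_def by blast
    qed
    then show ?thesis using face_intersection[OF F(1,2) F5 F(3,4)] by simp
  qed
  obtain U where U: "openin (top_of_set S) U" "v \<in> U"
    "\<forall>c\<in>closed_cells V E F. c \<inter> U \<noteq> {} \<longrightarrow> v \<in> c" using star_nbhd[OF vS] by blast
  obtain P W \<phi> \<psi> where ch: "surface_chart S P W \<phi> \<psi>" "v \<in> P" using surface_chart_ex[OF vS] by blast
  note c = surface_chartD[OF ch(1)]
  obtain \<epsilon> where \<epsilon>: "\<epsilon> > 0" "\<And>z. z \<in> ball (\<phi> v) \<epsilon> \<Longrightarrow> 0 \<le> Im z \<Longrightarrow> z \<in> W \<and> \<psi> z \<in> U"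
    using chart_half_ball[OF ch U(1,2)] by blast
  have v_half: "\<phi> v \<in> closed_half_plane" using c(5)[OF ch(2)] c(10) unfolding closed_half_plane_def by auto
  \<comment> \<open>Intersecting with the half-plane treats interior and boundary vertices alike:
    the set is convex and has inner points, so that removing one point leaves it connected.\<close>
  define X where "X = ball (\<phi> v) \<epsilon> \<inter> closed_half_plane"
  have X_sub: "X \<subseteq> W" "\<psi> ` X \<subseteq> U"
    using \<epsilon>(2) unfolding X_def closed_half_plane_def by auto
  have "convex closed_half_plane" unfolding closed_half_plane_def
    using convex_halfspace_ge[of 0 \<i>] by (simp add: inner_complex_def)
  then have "convex X" unfolding X_def by (intro convex_Int convex_ball)
  have "interior X \<noteq> {}"
  proof -
    have "openin (top_of_set closed_half_plane) X" unfolding X_def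
      by (metis Int_commute open_ball openin_open_Int)
    moreover have "\<phi> v \<in> X" using v_half \<epsilon>(1) unfolding X_def by simp
    ultimately obtain z r where "0 < r" "cball z r \<subseteq> X" using half_plane_contains_ball by blast
    then have "z \<in> interior X" by (metis ball_subset_cball centre_in_ball mem_interior subset_trans)
    then show ?thesis by blast
  qed
  then have "aff_dim X = 2" using aff_dim_nonempty_interior[of X] by simp
  then have "path_connected (X - {\<phi> v})" using path_connected_punctured_convex[OF \<open>convex X\<close>] by simp
  then have conX: "connected (X - {\<phi> v})" by (rule path_connected_imp_connected)
  define D where "D = \<psi> ` (X - {\<phi> v})"
  have "continuous_on (X - {\<phi> v}) \<psi>" by (rule continuous_on_subset[OF c(4)]) (use X_sub in auto)
  then have conD: "connected D" unfolding D_def using conX by (rule connected_continuous_image)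
  have D_sub: "D \<subseteq> U" unfolding D_def using X_sub by auto
  have vD: "v \<notin> D"
  proof
    assume "v \<in> D"
    then obtain z where "z \<in> X - {\<phi> v}" "v = \<psi> z" unfolding D_def by auto
    then show False using c(8) X_sub by auto
  qed
  have D_mem: "y \<in> D" if y: "y \<in> P" "\<phi> y \<in> ball (\<phi> v) \<epsilon>" "y \<noteq> v" for y
  proof -
    have "\<phi> y \<noteq> \<phi> v" using c(6) y(1,3) ch(2) by metis
    moreover have "\<phi> y \<in> closed_half_plane" using c(5)[OF y(1)] c(10) unfolding closed_half_plane_def by auto
    ultimately have "\<phi> y \<in> X - {\<phi> v}" using y(2) unfolding X_def by auto
    then show ?thesis unfolding D_def using c(6)[OF y(1)] by (metis imageI)
  qed
  \<comment> \<open>Points of the face off all edges occur arbitrarily near \<open>v\<close>, and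
    they differ from \<open>v\<close>, which lies on an edge.\<close>
  have meets: "Q \<inter> D \<noteq> {}" if Q: "Q \<in> A \<or> Q \<in> B" for Q
  proof -
    have N: "openin (top_of_set S) {y \<in> P. \<phi> y \<in> ball (\<phi> v) \<epsilon>}"
      by (rule chart_preimage_openin[OF ch(1) open_ball])
    obtain y where y: "y \<in> {y \<in> P. \<phi> y \<in> ball (\<phi> v) \<epsilon>}" "y \<in> Q - \<Union>E"
      using interior_point_near[OF face[OF Q] N] ch(2) \<epsilon>(1) by auto
    have "y \<noteq> v" using vertex_in_edge[OF face[OF Q] v] y(2) by blast
    then have "y \<in> D" using D_mem y(1) by blast
    then show ?thesis using y(2) by blast
  qed
  have "closed (\<Union>A)" "closed (\<Union>B)"
    using fin face face_compact by (auto intro!: closed_Union simp: compact_imp_closed)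
  moreover have "\<Union>A \<inter> \<Union>B \<inter> D = {}"
  proof (rule equals0I)
    fix y assume "y \<in> \<Union>A \<inter> \<Union>B \<inter> D"
    then obtain Q Q' where Q: "Q \<in> A" "Q' \<in> B" "y \<in> Q" "y \<in> Q'" "y \<in> D" by blast
    then have "y \<in> Q \<inter> Q'" by simp
    then show False using only_v[OF Q(1,2)] Q(5) vD by simp
  qed
  moreover have "D \<subseteq> \<Union>A \<union> \<Union>B"
  proof
    fix y assume y: "y \<in> D"
    then have "y \<in> S" using D_sub openin_imp_subset[OF U(1)] by auto
    then obtain Q where Q: "Q \<in> F" "y \<in> Q" using point_in_face by blast
    have "Q \<in> closed_cells V E F" unfolding closed_cells_iff using Q(1) by simp
    moreover have "Q \<inter> U \<noteq> {}" using y D_sub Q(2) by auto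
    ultimately have "v \<in> Q" using U(3) by blast
    then have "Q \<in> A \<or> Q \<in> B" unfolding B_def using Q(1) by simp
    then show "y \<in> \<Union>A \<union> \<Union>B" using Q(2) by auto
  qed
  ultimately have "\<Union>A \<inter> D = {} \<or> \<Union>B \<inter> D = {}" using connected_closedD[OF conD] by blast
  moreover obtain Q Q' where "Q \<in> A" "Q' \<in> B" using A unfolding B_def by blast
  ultimately show False using meets[of Q] meets[of Q'] by blast
qed

text \<open>In a chart, a boundary vertex lies on the real axis, and so does a nearby point
  \<open>y\<close> other than \<open>v\<close>. There is no planar neighbourhood of
  \<open>y\<close>, so \<open>y\<close> lies neither inside a face nor inside an edge between two
  faces; and a small neighbourhood of \<open>v\<close> contains no other vertex. What remains is an
  edge with at most one face, and it passes through \<open>v\<close>.\<close>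

lemma boundary_vertex_edge:
  assumes v: "v \<in> V" "v \<notin> surface_interior S"
  shows "\<exists>e\<in>E. v \<in> e \<and> (\<forall>Q\<in>F. \<forall>Q'\<in>F. e \<subseteq> Q \<longrightarrow> e \<subseteq> Q' \<longrightarrow> Q = Q')"
proof -
  have vS: "v \<in> S" using vertex_in_S[OF v(1)] .
  obtain U where U: "openin (top_of_set S) U" "v \<in> U"
    "\<forall>c\<in>closed_cells V E F. c \<inter> U \<noteq> {} \<longrightarrow> v \<in> c" using star_nbhd[OF vS] by blast
  obtain P W \<phi> \<psi> where ch: "surface_chart S P W \<phi> \<psi>" "v \<in> P" using surface_chart_ex[OF vS] by blast
  note c = surface_chartD[OF ch(1)]
  \<comment> \<open>Off the axis, cutting the chart down to the open upper half-plane would exhibit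
    \<open>v\<close> as an interior point.\<close>
  have Im0: "Im (\<phi> v) = 0"
  proof (rule ccontr)
    assume "Im (\<phi> v) \<noteq> 0"
    then have pos: "0 < Im (\<phi> v)" using c(10)[OF c(5)[OF ch(2)]] by simp
    define W' where "W' = W \<inter> {z. 0 < Im z}"
    define P' where "P' = {y \<in> P. \<phi> y \<in> {z. 0 < Im z}}"
    obtain T where T: "open T" "W = closed_half_plane \<inter> T" using c(2) unfolding openin_open by blast
    have "W' = T \<inter> {z. 0 < Im z}" unfolding W'_def T(2) closed_half_plane_def by auto
    then have "open W'" using T(1) open_halfspace_Im_gt[of 0] by auto
    have "openin (top_of_set S) P'" unfolding P'_def by (rule chart_preimage_openin[OF ch(1) open_halfspace_Im_gt])
    have "homeomorphism P' W' \<phi> \<psi>"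
    proof (rule homeomorphismI)
      show "continuous_on P' \<phi>" by (rule continuous_on_subset[OF c(3)]) (auto simp: P'_def)
      show "continuous_on W' \<psi>" by (rule continuous_on_subset[OF c(4)]) (auto simp: W'_def)
    qed (use c(5-8) in \<open>auto simp: P'_def W'_def\<close>)
    then have "P' homeomorphic W'" unfolding homeomorphic_def by blast
    moreover have "v \<in> P'" unfolding P'_def using ch(2) pos by simp
    ultimately have "v \<in> surface_interior S"
      unfolding surface_interior_def using vS \<open>open W'\<close> \<open>openin (top_of_set S) P'\<close> by blast
    then show False using v(2) by simp
  qed
  obtain \<epsilon> where \<epsilon>: "\<epsilon> > 0" "\<And>z. z \<in> ball (\<phi> v) \<epsilon> \<Longrightarrow> 0 \<le> Im z \<Longrightarrow> z \<in> W \<and> \<psi> z \<in> U"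
    using chart_half_ball[OF ch U(1,2)] by blast
  define b where "b = \<phi> v + complex_of_real (\<epsilon> / 2)"
  have "b \<in> ball (\<phi> v) \<epsilon>" unfolding b_def using \<epsilon>(1) by (simp add: dist_norm)
  moreover have Imb: "Im b = 0" unfolding b_def using Im0 by simp
  ultimately have b: "b \<in> W" "\<psi> b \<in> U" using \<epsilon>(2)[of b] by auto
  define y where "y = \<psi> b"
  have y: "y \<in> U" "y \<in> P" "\<phi> y = b" "y \<in> S" unfolding y_def using b c(7,8,9) by auto
  have "b \<noteq> \<phi> v" unfolding b_def using \<epsilon>(1) by simp
  then have "y \<noteq> v" using y(3) by auto
  have not_planar: "\<not> planar_in y N" if "N \<subseteq> S" for N
  proof
    assume "planar_in y N"
    then have "0 < Im (\<phi> y)" by (rule planar_in_chart(1)[OF ch(1) y(2) _ that])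
    then show False using y(3) Imb by simp
  qed
  obtain Q where Q: "Q \<in> F" "y \<in> Q" using point_in_face[OF y(4)] by blast
  have "y \<in> \<Union>E" using planar_in_face[OF Q(1), of y] Q(2) not_planar[OF face_subset_S[OF Q(1)]] by blast
  then obtain e where e: "e \<in> E" "y \<in> e" by blast
  have "y \<notin> V"
  proof
    assume "y \<in> V"
    then have "{y} \<in> closed_cells V E F" unfolding closed_cells_iff by blast
    then have "v \<in> {y}" using U(3) y(1) by blast
    then show False using \<open>y \<noteq> v\<close> by simp
  qed
  have "e \<in> closed_cells V E F" unfolding closed_cells_iff using e(1) by simp
  then have "v \<in> e" using U(3) y(1) e(2) by blast
  moreover have "Q1 = Q2" if "Q1 \<in> F" "Q2 \<in> F" "e \<subseteq> Q1" "e \<subseteq> Q2" for Q1 Q2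
  proof (rule ccontr)
    assume "Q1 \<noteq> Q2"
    then have "planar_in y (Q1 \<union> Q2)" using planar_in_two_faces[OF that(1,2) _ e(1) that(3,4) e(2) \<open>y \<notin> V\<close>] by simp
    then show False using not_planar[of "Q1 \<union> Q2"] face_subset_S that(1,2) by simp
  qed
  ultimately show ?thesis using e(1) by blast
qed

lemma face_vertex_edges:
  assumes Q: "Q \<in> F" and v: "v \<in> V" "v \<in> Q"
  shows "\<exists>e e'. e \<noteq> e' \<and> {e \<in> E. v \<in> e \<and> e \<subseteq> Q} = {e, e'}"
proof -
  obtain v0 v1 v2 v3 e0 e1 e2 e3 where
    q: "distinct [v0, v1, v2, v3]" "Q \<inter> V = {v0, v1, v2, v3}" "{e \<in> E. e \<subseteq> Q} = {e0, e1, e2, e3}"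
    "e0 \<inter> V = {v0, v1}" "e1 \<inter> V = {v1, v2}" "e2 \<inter> V = {v2, v3}" "e3 \<inter> V = {v3, v0}"
    using face_corners[OF Q] by blast
  have "{e \<in> E. v \<in> e \<and> e \<subseteq> Q} = {e \<in> {e0, e1, e2, e3}. v \<in> e \<inter> V}" using q(3) v(1) by auto
  moreover have "v \<in> {v0, v1, v2, v3}" using q(2) v by auto
  moreover have "e0 \<noteq> e1" "e1 \<noteq> e2" "e2 \<noteq> e3" "e3 \<noteq> e0"
    using q(1,4-7) by (auto simp: doubleton_eq_iff)
  moreover have "{e \<in> {e0, e1, e2, e3}. v \<in> e \<inter> V} = (if v = v0 then {e0, e3} else if v = v1 then {e0, e1}
      else if v = v2 then {e1, e2} else {e2, e3})"
  proof -
    have m: "v \<in> e0 \<inter> V \<longleftrightarrow> v = v0 \<or> v = v1" "v \<in> e1 \<inter> V \<longleftrightarrow> v = v1 \<or> v = v2"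
      "v \<in> e2 \<inter> V \<longleftrightarrow> v = v2 \<or> v = v3" "v \<in> e3 \<inter> V \<longleftrightarrow> v = v3 \<or> v = v0"
      unfolding q(4-7) by auto
    show ?thesis
    proof (rule set_eqI)
      fix e
      have "e \<in> {e \<in> {e0, e1, e2, e3}. v \<in> e \<inter> V} \<longleftrightarrow>
        (e = e0 \<and> v \<in> e0 \<inter> V) \<or> (e = e1 \<and> v \<in> e1 \<inter> V) \<or> (e = e2 \<and> v \<in> e2 \<inter> V) \<or> (e = e3 \<and> v \<in> e3 \<inter> V)"
        by blast
      then show "e \<in> {e \<in> {e0, e1, e2, e3}. v \<in> e \<inter> V} \<longleftrightarrow> e \<in> (if v = v0 then {e0, e3} else if v = v1 then {e0, e1}
        else if v = v2 then {e1, e2} else {e2, e3})"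
        unfolding m using q(1) \<open>v \<in> {v0, v1, v2, v3}\<close> by auto
    qed
  qed
  ultimately have "{e \<in> E. v \<in> e \<and> e \<subseteq> Q} = (if v = v0 then {e0, e3} else if v = v1 then {e0, e1}
      else if v = v2 then {e1, e2} else {e2, e3})" by simp
  then show ?thesis using \<open>e0 \<noteq> e1\<close> \<open>e1 \<noteq> e2\<close> \<open>e2 \<noteq> e3\<close> \<open>e3 \<noteq> e0\<close>[symmetric] by (auto split: if_splits)
qed

text \<open>The link of \<open>v\<close> has the degree of \<open>v\<close> as its number of nodes,
  which settles interior vertices. At a boundary vertex \<open>boundary_vertex_edge\<close> supplies
  a node lying on at most one arc.\<close>

lemma link_colouring:
  assumes v: "v \<in> V" and even: "v \<in> surface_interior S \<Longrightarrow> even (vertex_degree E v)"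
  shows "\<exists>col :: 'a set \<Rightarrow> bool. \<forall>Q\<in>F. v \<in> Q \<longrightarrow> (\<forall>e\<in>E. \<forall>e'\<in>E. v \<in> e \<and> e \<subseteq> Q \<and> v \<in> e' \<and> e' \<subseteq> Q \<and> e \<noteq> e' \<longrightarrow>
    col e \<noteq> col e')"
proof -
  define arcs where "arcs = {Q \<in> F. v \<in> Q}"
  define ends where "ends Q = {e \<in> E. v \<in> e \<and> e \<subseteq> Q}" for Q
  have vS: "v \<in> S" using vertex_in_S[OF v] .
  have nodes: "\<Union>(ends ` arcs) = {e \<in> E. v \<in> e}"
  proof
    show "{e \<in> E. v \<in> e} \<subseteq> \<Union>(ends ` arcs)"
    proof
      fix e assume e: "e \<in> {e \<in> E. v \<in> e}"
      then obtain Q where "Q \<in> F" "e \<subseteq> Q" using edge_in_face by blast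
      then show "e \<in> \<Union>(ends ` arcs)" using e unfolding arcs_def ends_def by auto
    qed
  qed (auto simp: ends_def)
  have fin: "finite arcs" unfolding arcs_def using finite_faces_at[OF vS] .
  have "\<exists>col :: 'a set \<Rightarrow> bool. \<forall>Q\<in>arcs. \<forall>x\<in>ends Q. \<forall>y\<in>ends Q. x \<noteq> y \<longrightarrow> col x \<noteq> col y"
  proof (rule two_colouring_of_path_or_cycle[OF fin])
    show "\<exists>x y. x \<noteq> y \<and> ends Q = {x, y}" if "Q \<in> arcs" for Q
      using face_vertex_edges[of Q v] that v unfolding arcs_def ends_def by simp
    show "card {Q \<in> arcs. e \<in> ends Q} \<le> 2" for e
    proof (rule ccontr)
      assume "\<not> card {Q \<in> arcs. e \<in> ends Q} \<le> 2"
      then have "3 \<le> card {Q \<in> arcs. e \<in> ends Q}" by simp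
      then obtain T where T: "T \<subseteq> {Q \<in> arcs. e \<in> ends Q}" "card T = 3" "finite T"
        by (rule obtain_subset_with_card_n)
      then obtain Q1 Q2 Q3 where Q: "T = {Q1, Q2, Q3}" "Q1 \<noteq> Q2" "Q2 \<noteq> Q3" "Q1 \<noteq> Q3"
        using card_3_iff[of T] by blast
      have in_T: "Q \<in> F \<and> e \<in> E \<and> e \<subseteq> Q" if "Q \<in> T" for Q
        using subsetD[OF T(1) that] unfolding arcs_def ends_def by simp
      show False
        using at_most_two_faces[of Q1 Q2 Q3 e] in_T[of Q1] in_T[of Q2] in_T[of Q3] Q by simp
    qed
    show "\<exists>Q\<in>A. \<exists>Q'\<in>arcs - A. ends Q \<inter> ends Q' \<noteq> {}" if A: "A \<subseteq> arcs" "A \<noteq> {}" "A \<noteq> arcs" for A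
    proof -
      obtain Q Q' e where "Q \<in> A" "Q' \<in> arcs - A" "e \<in> E" "v \<in> e" "e \<subseteq> Q" "e \<subseteq> Q'"
        using link_connected[OF v A[unfolded arcs_def]] unfolding arcs_def by blast
      then have "e \<in> ends Q \<inter> ends Q'" unfolding ends_def by simp
      then show ?thesis using \<open>Q \<in> A\<close> \<open>Q' \<in> arcs - A\<close> by blast
    qed
    show "even (card (\<Union>(ends ` arcs))) \<or> (\<exists>e\<in>\<Union>(ends ` arcs). card {Q \<in> arcs. e \<in> ends Q} \<le> 1)"
    proof (cases "v \<in> surface_interior S")
      case True
      then show ?thesis using even unfolding vertex_degree_def nodes by simp
    next
      case False
      obtain e where e: "e \<in> E" "v \<in> e" "\<forall>Q\<in>F. \<forall>Q'\<in>F. e \<subseteq> Q \<longrightarrow> e \<subseteq> Q' \<longrightarrow> Q = Q'"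
        using boundary_vertex_edge[OF v False] by blast
      have "card {Q \<in> arcs. e \<in> ends Q} \<le> 1"
      proof (rule card_le_Suc0_iff_eq[THEN iffD2, folded One_nat_def])
        show "\<forall>Q\<in>{Q \<in> arcs. e \<in> ends Q}. \<forall>Q'\<in>{Q \<in> arcs. e \<in> ends Q}. Q = Q'"
          using e(3) unfolding arcs_def ends_def by simp
      qed (use fin in simp)
      then show ?thesis using e(1,2) unfolding nodes by blast
    qed
  qed
  then obtain col :: "'a set \<Rightarrow> bool" where col: "\<forall>Q\<in>arcs. \<forall>x\<in>ends Q. \<forall>y\<in>ends Q. x \<noteq> y \<longrightarrow> col x \<noteq> col y" by (elim exE)
  show ?thesis
  proof (intro exI ballI impI, elim conjE)
    fix Q e e' assume a: "Q \<in> F" "v \<in> Q" "e \<in> E" "e' \<in> E" "v \<in> e" "e \<subseteq> Q" "v \<in> e'" "e' \<subseteq> Q" "e \<noteq> e'"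
    have in_arcs: "Q \<in> arcs" using a(1,2) unfolding arcs_def by simp
    have in_ends: "e \<in> ends Q" "e' \<in> ends Q" using a(3-8) unfolding ends_def by (simp_all only: mem_Collect_eq)
    show "col e \<noteq> col e'" by (rule col[rule_format, OF in_arcs in_ends a(9)])
  qed
qed

end

section \<open>Propagation of hyperboloids\<close>

lemma proj_line_independent:
  fixes a b :: "real^4"
  assumes line: "span {a, b} \<in> proj_lines" and eq: "x *\<^sub>R a + y *\<^sub>R b = 0"
  shows "x = 0 \<and> y = 0"
proof -
  have two: "dim {a, b} = 2" using line unfolding proj_lines_def by (simp add: dim_span)
  have one: False if "{a, b} \<subseteq> span {u}" for u
    using dim_le_card[OF that] two by simp
  show ?thesis
  proof (rule ccontr)
    assume "\<not> ?thesis"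
    then consider "x \<noteq> 0" | "y \<noteq> 0" by blast
    then show False
    proof cases
      case 1
      have "x *\<^sub>R a = (- y) *\<^sub>R b" using eq by (simp add: add_eq_0_iff2)
      then have "(1 / x) *\<^sub>R (x *\<^sub>R a) = (1 / x) *\<^sub>R ((- y) *\<^sub>R b)" by simp
      then have "a = (- y / x) *\<^sub>R b" using 1 by simp
      then have "a \<in> span {b}" by (metis span_base span_scale singletonI)
      then show False using one[of b] by (simp add: span_base)
    next
      case 2
      have "y *\<^sub>R b = (- x) *\<^sub>R a" using eq by (simp add: add_eq_0_iff)
      then have "(1 / y) *\<^sub>R (y *\<^sub>R b) = (1 / y) *\<^sub>R ((- x) *\<^sub>R a)" by simp
      then have "b = (- x / y) *\<^sub>R a" using 2 by simp
      then have "b \<in> span {a}" by (metis span_base span_scale singletonI)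
      then show False using one[of a] by (simp add: span_base)
    qed
  qed
qed

lemma span_Un_span: "span (span A \<union> span B) = span (A \<union> B)"
proof (rule span_subspace[OF _ _ subspace_span, symmetric, THEN sym])
  show "span A \<union> span B \<subseteq> span (A \<union> B)" by (simp add: span_mono)
  show "span (A \<union> B) \<subseteq> span (span A \<union> span B)" by (intro span_mono) (meson Un_mono span_superset)
qed

locale generic_net = quad_graph S V E F
  for S :: "'a::t2_space set" and V E F +
  fixes f :: "'a \<Rightarrow> (real^4) set"
  assumes generic: "generic_A_net V E f"
begin

definition rep :: "'a \<Rightarrow> real^4"
  where "rep v = (SOME x. x \<noteq> 0 \<and> f v = span {x})"

text \<open>One normal vector per vertex, chosen independently of the faces, so that factors
  obtained in different faces at the vertex can be compared.\<close>

definition nrm :: "'a \<Rightarrow> real^4"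
  where "nrm v = (SOME m. m \<noteq> 0 \<and> (\<forall>w\<in>vertex_star V E v. \<forall>x\<in>f w. m \<bullet> x = 0))"

definition coords :: "'a \<Rightarrow> (real^4) \<times> (real^4)"
  where "coords v = (SOME gh. \<forall>y. nrm v \<bullet> y = 0 \<longrightarrow>
    (\<exists>k. y = k *\<^sub>R rep v + (y \<bullet> fst gh) *\<^sub>R fst gh + (y \<bullet> snd gh) *\<^sub>R snd gh))"

definition area :: "'a \<Rightarrow> real^4 \<Rightarrow> real^4 \<Rightarrow> real"
  where "area v x y = (x \<bullet> fst (coords v)) * (y \<bullet> snd (coords v)) - (x \<bullet> snd (coords v)) * (y \<bullet> fst (coords v))"

text \<open>On the vertex plane at \<open>v\<close>, the normal \<open>nrm w\<close> of a neighbour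
  \<open>w\<close> vanishes at \<open>v\<close> and at \<open>w\<close>, hence is a multiple of the
  area form with first argument \<open>rep w\<close>. The multiple depends on the edge and not on a
  face; it converts ratios of \<open>coef\<close> into a parameter comparable between the edges at
  \<open>v\<close>.\<close>

definition scale :: "'a \<Rightarrow> 'a \<Rightarrow> real"
  where "scale v w = (SOME k. \<forall>y. nrm v \<bullet> y = 0 \<longrightarrow> nrm w \<bullet> y = k * area v (rep w) y)"

abbreviation line :: "'a set \<Rightarrow> (real^4) set"
  where "line \<equiv> discrete_asymptotic_line V f"

abbreviation hyps :: "'a set \<Rightarrow> (real^4) set set set"
  where "hyps \<equiv> face_hyperboloids V E f"

lemma A_net: "discrete_A_net V E f"
  and edge_line: "e \<in> E \<Longrightarrow> line e \<in> proj_lines"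
  and skew_edges: "e \<in> E \<Longrightarrow> e' \<in> E \<Longrightarrow> e \<inter> e' \<inter> V = {} \<Longrightarrow> points_on (line e) \<inter> points_on (line e') = {}"
proof -
  note g = generic[unfolded generic_A_net_def]
  show "discrete_A_net V E f" "e \<in> E \<Longrightarrow> line e \<in> proj_lines" using g by simp_all
  show "e \<in> E \<Longrightarrow> e' \<in> E \<Longrightarrow> e \<inter> e' \<inter> V = {} \<Longrightarrow> points_on (line e) \<inter> points_on (line e') = {}"
    using g[THEN conjunct2, THEN conjunct2, THEN conjunct2, rule_format] .
qed

lemma rep:
  assumes "v \<in> V" shows "rep v \<noteq> 0" "f v = span {rep v}"
proof -
  have "f v \<in> proj_points" using A_net assms unfolding discrete_A_net_def by blast
  then have "\<exists>x. x \<noteq> 0 \<and> f v = span {x}" unfolding proj_point_iff .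
  then have "rep v \<noteq> 0 \<and> f v = span {rep v}" unfolding rep_def by (rule someI_ex)
  then show "rep v \<noteq> 0" "f v = span {rep v}" by auto
qed

lemma nrm:
  assumes v: "v \<in> V"
  shows "nrm v \<noteq> 0" "nrm v \<bullet> rep v = 0" "\<And>w e. w \<in> V \<Longrightarrow> e \<in> E \<Longrightarrow> e \<inter> V = {v, w} \<Longrightarrow> nrm v \<bullet> rep w = 0"
proof -
  obtain P where P: "P \<in> proj_planes" "\<forall>w\<in>vertex_star V E v. f w \<subseteq> P"
    using A_net v unfolding discrete_A_net_def by blast
  obtain m where "m \<noteq> 0" "\<forall>x\<in>P. m \<bullet> x = 0" using proj_plane_normal[OF P(1)] by blast
  then have "\<exists>m. m \<noteq> 0 \<and> (\<forall>w\<in>vertex_star V E v. \<forall>x\<in>f w. m \<bullet> x = 0)" using P(2) by (intro exI[of _ m]) blast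
  then have *: "nrm v \<noteq> 0 \<and> (\<forall>w\<in>vertex_star V E v. \<forall>x\<in>f w. nrm v \<bullet> x = 0)" unfolding nrm_def by (rule someI_ex)
  then show "nrm v \<noteq> 0" by simp
  have star: "nrm v \<bullet> rep w = 0" if "w \<in> V" "w \<in> vertex_star V E v" for w
  proof -
    have "rep w \<in> f w" using rep(2)[OF that(1)] by (simp add: span_base)
    then show ?thesis using * that(2) by simp
  qed
  show "nrm v \<bullet> rep v = 0" using star[OF v] unfolding vertex_star_def by simp
  show "nrm v \<bullet> rep w = 0" if "w \<in> V" "e \<in> E" "e \<inter> V = {v, w}" for w e
  proof (rule star[OF that(1)])
    show "w \<in> vertex_star V E v" unfolding vertex_star_def using that(2,3) by blast
  qed
qed

lemma coords:
  assumes "v \<in> V"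
  shows "\<forall>y. nrm v \<bullet> y = 0 \<longrightarrow> (\<exists>k. y = k *\<^sub>R rep v + (y \<bullet> fst (coords v)) *\<^sub>R fst (coords v) +
    (y \<bullet> snd (coords v)) *\<^sub>R snd (coords v))"
proof -
  obtain g h where gh: "\<forall>y. nrm v \<bullet> y = 0 \<longrightarrow> (\<exists>k. y = k *\<^sub>R rep v + (y \<bullet> g) *\<^sub>R g + (y \<bullet> h) *\<^sub>R h)"
    using plane_coordinates[OF rep(1)[OF assms] nrm(1,2)[OF assms]] by blast
  show ?thesis unfolding coords_def by (rule someI[of _ "(g, h)"]) (use gh in simp)
qed

lemma line_eq:
  assumes "e \<inter> V = {v, w}" shows "line e = span {rep v, rep w}"
proof -
  have "v \<in> V" "w \<in> V" using assms by blast+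
  then have "(\<Union>u\<in>e \<inter> V. f u) = span {rep v} \<union> span {rep w}" unfolding assms using rep(2) by simp
  then show ?thesis unfolding discrete_asymptotic_line_def by (simp add: span_Un_span insert_commute)
qed

lemma scale:
  assumes e: "e \<in> E" "e \<inter> V = {v, w}"
  shows "\<forall>y. nrm v \<bullet> y = 0 \<longrightarrow> nrm w \<bullet> y = scale v w * area v (rep w) y"
proof -
  have vw: "v \<in> V" "w \<in> V" using e(2) by blast+
  have e': "e \<inter> V = {w, v}" using e(2) by (simp add: insert_commute)
  have line: "span {rep v, rep w} \<in> proj_lines" using edge_line[OF e(1)] line_eq[OF e(2)] by simp
  have "rep w \<notin> span {rep v}"
  proof
    assume "rep w \<in> span {rep v}"
    then obtain k where "rep w = k *\<^sub>R rep v" by (auto simp: span_singleton)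
    then show False using proj_line_independent[OF line, of "-k" 1] by simp
  qed
  then have "\<exists>k. \<forall>y. nrm v \<bullet> y = 0 \<longrightarrow> nrm w \<bullet> y = k * area v (rep w) y"
    unfolding area_def
    by (intro area_form_multiple[OF coords[OF vw(1)]]) (use nrm(2,3) vw e(1,2) e' in auto)
  then show ?thesis unfolding scale_def by (rule someI_ex)
qed

text \<open>Labels corners and sides cyclically, to match \<open>skew_quad\<close>; rotations and
  reflections of a labelling are again labellings.\<close>

definition frame :: "'a set \<Rightarrow> 'a \<Rightarrow> 'a \<Rightarrow> 'a \<Rightarrow> 'a \<Rightarrow> 'a set \<Rightarrow> 'a set \<Rightarrow> 'a set \<Rightarrow> 'a set \<Rightarrow> bool"
  where "frame Q v0 v1 v2 v3 e0 e1 e2 e3 \<longleftrightarrow> distinct [v0, v1, v2, v3] \<and>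
    Q \<inter> V = {v0, v1, v2, v3} \<and> {e \<in> E. e \<subseteq> Q} = {e0, e1, e2, e3} \<and>
    e0 \<inter> V = {v0, v1} \<and> e1 \<inter> V = {v1, v2} \<and> e2 \<inter> V = {v2, v3} \<and> e3 \<inter> V = {v3, v0}"

lemma frame_rotate: "frame Q v0 v1 v2 v3 e0 e1 e2 e3 \<Longrightarrow> frame Q v1 v2 v3 v0 e1 e2 e3 e0"
  unfolding frame_def by (auto simp: insert_commute)

lemma frame_reflect: "frame Q v0 v1 v2 v3 e0 e1 e2 e3 \<Longrightarrow> frame Q v0 v3 v2 v1 e3 e2 e1 e0"
  unfolding frame_def by (auto simp: insert_commute)

lemma frameD:
  assumes "frame Q v0 v1 v2 v3 e0 e1 e2 e3"
  shows "v0 \<in> V" "v1 \<in> V" "v2 \<in> V" "v3 \<in> V" "e0 \<in> E" "e1 \<in> E" "e2 \<in> E" "e3 \<in> E"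
    "e0 \<inter> V = {v0, v1}" "e1 \<inter> V = {v1, v2}" "e2 \<inter> V = {v2, v3}" "e3 \<inter> V = {v3, v0}"
    "distinct [v0, v1, v2, v3]" "\<And>e. e \<in> E \<and> e \<subseteq> Q \<longleftrightarrow> e = e0 \<or> e = e1 \<or> e = e2 \<or> e = e3"
proof -
  have fr: "distinct [v0, v1, v2, v3]" "Q \<inter> V = {v0, v1, v2, v3}" "{e \<in> E. e \<subseteq> Q} = {e0, e1, e2, e3}"
    "e0 \<inter> V = {v0, v1}" "e1 \<inter> V = {v1, v2}" "e2 \<inter> V = {v2, v3}" "e3 \<inter> V = {v3, v0}"
    using assms unfolding frame_def by auto
  have "{v0, v1, v2, v3} \<subseteq> V" using fr(2) by blast
  then show "v0 \<in> V" "v1 \<in> V" "v2 \<in> V" "v3 \<in> V" by simp_all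
  have "{e0, e1, e2, e3} \<subseteq> E" using fr(3) by blast
  then show "e0 \<in> E" "e1 \<in> E" "e2 \<in> E" "e3 \<in> E" by simp_all
  show "e \<in> E \<and> e \<subseteq> Q \<longleftrightarrow> e = e0 \<or> e = e1 \<or> e = e2 \<or> e = e3" for e
    using eqset_imp_iff[OF fr(3), of e] by simp
  show "e0 \<inter> V = {v0, v1}" "e1 \<inter> V = {v1, v2}" "e2 \<inter> V = {v2, v3}" "e3 \<inter> V = {v3, v0}"
    "distinct [v0, v1, v2, v3]" by (fact fr)+
qed

lemma frame_ex:
  assumes "Q \<in> F"
  shows "\<exists>v0 v1 v2 v3 e0 e1 e2 e3. frame Q v0 v1 v2 v3 e0 e1 e2 e3"
proof (rule face_corners[OF assms])
  fix v0 v1 v2 v3 e0 e1 e2 e3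
  assume "distinct [v0, v1, v2, v3]" "Q \<inter> V = {v0, v1, v2, v3}" "{e \<in> E. e \<subseteq> Q} = {e0, e1, e2, e3}"
    "e0 \<inter> V = {v0, v1}" "e1 \<inter> V = {v1, v2}" "e2 \<inter> V = {v2, v3}" "e3 \<inter> V = {v3, v0}"
  then have "frame Q v0 v1 v2 v3 e0 e1 e2 e3" unfolding frame_def by (intro conjI)
  then show ?thesis by blast
qed

text \<open>Rotation brings \<open>v\<close> to the first place, and reflection exchanges the two
  sides of the face at \<open>v\<close>.\<close>

lemma flag_frame:
  assumes Q: "Q \<in> F" and v: "v \<in> V" and e: "e \<in> E" "v \<in> e" "e \<subseteq> Q"
  shows "\<exists>w u x e1 e2 e3. frame Q v w u x e e1 e2 e3"
proof -
  obtain v0 v1 v2 v3 e0 e1 e2 e3 where fr: "frame Q v0 v1 v2 v3 e0 e1 e2 e3" using frame_ex[OF Q] by blast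
  note fr1 = frame_rotate[OF fr]
  note fr2 = frame_rotate[OF fr1]
  note fr3 = frame_rotate[OF fr2]
  have "Q \<inter> V = {v0, v1, v2, v3}" using fr unfolding frame_def by simp
  moreover have "v \<in> Q \<inter> V" using v e(2,3) by auto
  ultimately have "v = v0 \<or> v = v1 \<or> v = v2 \<or> v = v3" by simp
  then have "\<exists>w u x a0 a1 a2 a3. frame Q v w u x a0 a1 a2 a3"
  proof (elim disjE)
    assume "v = v0" then show ?thesis using fr by (intro exI) simp
  next
    assume "v = v1" then show ?thesis using fr1 by (intro exI) simp
  next
    assume "v = v2" then show ?thesis using fr2 by (intro exI) simp
  next
    assume "v = v3" then show ?thesis using fr3 by (intro exI) simp
  qed
  then obtain w u x a0 a1 a2 a3 where g: "frame Q v w u x a0 a1 a2 a3" by (elim exE)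
  note d = frameD[OF g]
  have "e = a0 \<or> e = a1 \<or> e = a2 \<or> e = a3" using d(14)[of e] e by simp
  moreover have "v \<in> e \<inter> V" using v e(2) by simp
  then have "e \<noteq> a1" "e \<noteq> a2" using d(10,11,13) by auto
  ultimately show ?thesis using g frame_reflect[OF g] by blast
qed

text \<open>A linear relation between the corners gives a common vector of the lines of two opposite
  sides. These lines are disjoint by genericity, so the vector is zero and the relation is trivial
  on each side.\<close>

lemma frame_skew_quad:
  assumes fr: "frame Q v0 v1 v2 v3 e0 e1 e2 e3"
  shows "skew_quad (rep v0) (rep v1) (rep v2) (rep v3) (nrm v0) (nrm v1) (nrm v2) (nrm v3)"
proof
  note d = frameD[OF fr]
  have c: "e0 \<inter> V = {v1, v0}" "e1 \<inter> V = {v2, v1}" "e2 \<inter> V = {v3, v2}" "e3 \<inter> V = {v0, v3}"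
    using d(9-12) by (simp_all add: insert_commute)
  show "nrm v0 \<noteq> 0" "nrm v1 \<noteq> 0" "nrm v2 \<noteq> 0" "nrm v3 \<noteq> 0" using nrm(1) d(1-4) by auto
  show "nrm v0 \<bullet> rep v0 = 0" "nrm v1 \<bullet> rep v1 = 0" "nrm v2 \<bullet> rep v2 = 0" "nrm v3 \<bullet> rep v3 = 0"
    using nrm(2) d(1-4) by auto
  show "nrm v0 \<bullet> rep v1 = 0" "nrm v0 \<bullet> rep v3 = 0" using nrm(3)[OF d(1)] d(2,4,5,8,9) c(4) by auto
  show "nrm v1 \<bullet> rep v2 = 0" "nrm v1 \<bullet> rep v0 = 0" using nrm(3)[OF d(2)] d(1,3,5,6,10) c(1) by auto
  show "nrm v2 \<bullet> rep v3 = 0" "nrm v2 \<bullet> rep v1 = 0" using nrm(3)[OF d(3)] d(2,4,6,7,11) c(2) by auto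
  show "nrm v3 \<bullet> rep v0 = 0" "nrm v3 \<bullet> rep v2 = 0" using nrm(3)[OF d(4)] d(1,3,7,8,12) c(3) by auto
  fix x y z w assume eq: "x *\<^sub>R rep v0 + y *\<^sub>R rep v1 + z *\<^sub>R rep v2 + w *\<^sub>R rep v3 = 0"
  define p where "p = x *\<^sub>R rep v0 + y *\<^sub>R rep v1"
  have p2: "p = (- z) *\<^sub>R rep v2 + (- w) *\<^sub>R rep v3"
    using eq unfolding p_def by (simp add: add.assoc add_eq_0_iff2)
  have "e0 \<inter> e2 \<inter> V = (e0 \<inter> V) \<inter> (e2 \<inter> V)" by blast
  then have "e0 \<inter> e2 \<inter> V = {}" using d(9,11,13) by auto
  then have disj: "points_on (span {rep v0, rep v1}) \<inter> points_on (span {rep v2, rep v3}) = {}"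
    using skew_edges[OF d(5,7)] line_eq[OF d(9)] line_eq[OF d(11)] by simp
  have "p \<in> span {rep v0, rep v1}" unfolding p_def span_pair by blast
  moreover have "p \<in> span {rep v2, rep v3}" unfolding p2 span_pair by blast
  ultimately have "span {p} \<subseteq> span {rep v0, rep v1}" "span {p} \<subseteq> span {rep v2, rep v3}"
    by (simp_all only: span_minimal subspace_span insert_subset empty_subsetI simp_thms)
  moreover have "span {p} \<in> proj_points" if "p \<noteq> 0" unfolding proj_point_iff using that by blast
  ultimately have "p = 0" using disj unfolding points_on_def by blast
  have l: "span {rep v0, rep v1} \<in> proj_lines" "span {rep v2, rep v3} \<in> proj_lines"
    using edge_line[OF d(5)] edge_line[OF d(7)] line_eq[OF d(9)] line_eq[OF d(11)] by simp_all
  have "x = 0 \<and> y = 0" by (rule proj_line_independent[OF l(1)]) (use \<open>p = 0\<close> p_def in simp)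
  moreover have "- z = 0 \<and> - w = 0" by (rule proj_line_independent[OF l(2)]) (use \<open>p = 0\<close> p2 in simp)
  ultimately show "x = 0 \<and> y = 0 \<and> z = 0 \<and> w = 0" by simp
qed

lemma frame_hyps:
  assumes fr: "frame Q v0 v1 v2 v3 e0 e1 e2 e3"
  shows "hyps Q = quad_hyperboloids (rep v0) (rep v1) (rep v2) (rep v3)"
proof -
  note d = frameD[OF fr]
  have "(\<forall>e\<in>E. e \<subseteq> Q \<longrightarrow> asymptotic_line H (line e)) \<longleftrightarrow>
    asymptotic_line H (line e0) \<and> asymptotic_line H (line e1) \<and> asymptotic_line H (line e2) \<and> asymptotic_line H (line e3)" for H
    using d(14) by metis
  then show ?thesis
    unfolding face_hyperboloids_def quad_hyperboloids_def
    using line_eq[OF d(9)] line_eq[OF d(10)] line_eq[OF d(11)] line_eq[OF d(12)] by simp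
qed

text \<open>The coordinate of a hyperboloid in its 1-parameter family, as read off along the edge \<open>e\<close>, in the
  normalisation belonging to the end point \<open>v\<close> of \<open>e\<close>.\<close>

definition param :: "'a \<Rightarrow> 'a set \<Rightarrow> (real^4) set set \<Rightarrow> real"
  where "param v e H = (let w = (SOME w. e \<inter> V = {v, w}) in
    scale v w * (coef H (rep w) (nrm w) / coef H (rep v) (nrm v)))"

lemma param_eq:
  assumes "e \<inter> V = {v, w}"
  shows "param v e H = scale v w * (coef H (rep w) (nrm w) / coef H (rep v) (nrm v))"
proof -
  have "e \<inter> V = {v, (SOME w. e \<inter> V = {v, w})}" using assms by (rule someI)
  then have "(SOME w. e \<inter> V = {v, w}) = w" unfolding assms by (auto simp: doubleton_eq_iff)
  then show ?thesis unfolding param_def by simp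
qed

lemma scale_nonzero:
  assumes fr: "frame Q v w u x e e1 e2 e3" shows "scale v w \<noteq> 0"
proof -
  interpret q: skew_quad "rep v" "rep w" "rep u" "rep x" "nrm v" "nrm w" "nrm u" "nrm x"
    by (rule frame_skew_quad[OF fr])
  note d = frameD[OF fr]
  have e3: "e3 \<inter> V = {v, x}" using d(12) by (simp add: insert_commute)
  obtain H where H: "H \<in> quad_hyperboloids (rep v) (rep w) (rep u) (rep x)" using q.ratio_bij[of 1] by auto
  show ?thesis
    by (rule q.coef_sign_flip(2)[OF H scale[OF d(5,9), unfolded area_def] scale[OF d(8) e3, unfolded area_def]])
qed

lemma param_bij:
  assumes "Q \<in> F" "v \<in> V" "e \<in> E" "v \<in> e" "e \<subseteq> Q" "r \<noteq> 0"
  shows "\<exists>!H. H \<in> hyps Q \<and> param v e H = r"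
proof -
  obtain w u x e1 e2 e3 where fr: "frame Q v w u x e e1 e2 e3" using flag_frame[OF assms(1-5)] by blast
  interpret q: skew_quad "rep v" "rep w" "rep u" "rep x" "nrm v" "nrm w" "nrm u" "nrm x"
    by (rule frame_skew_quad[OF fr])
  have s: "scale v w \<noteq> 0" by (rule scale_nonzero[OF fr])
  have "param v e H = r \<longleftrightarrow> coef H (rep w) (nrm w) / coef H (rep v) (nrm v) = r / scale v w" for H
    unfolding param_eq[OF frameD(9)[OF fr]] using s by (auto simp: field_simps)
  then show ?thesis unfolding frame_hyps[OF fr] using q.ratio_bij[of "r / scale v w"] s assms(6) by simp
qed

lemma param_nonzero:
  assumes "Q \<in> F" "v \<in> V" "e \<in> E" "v \<in> e" "e \<subseteq> Q" and H: "H \<in> hyps Q"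
  shows "param v e H \<noteq> 0"
proof -
  obtain w u x e1 e2 e3 where fr: "frame Q v w u x e e1 e2 e3" using flag_frame[OF assms(1-5)] by blast
  interpret q: skew_quad "rep v" "rep w" "rep u" "rep x" "nrm v" "nrm w" "nrm u" "nrm x"
    by (rule frame_skew_quad[OF fr])
  have H': "H \<in> quad_hyperboloids (rep v) (rep w) (rep u) (rep x)" using H frame_hyps[OF fr] by simp
  then have "H \<in> quad_hyperboloids (rep w) (rep u) (rep x) (rep v)" by (simp add: quad_hyperboloids_rotate)
  from skew_quad.coef_a(2)[OF q.rotate this] q.coef_a(2)[OF H'] scale_nonzero[OF fr]
  show ?thesis unfolding param_eq[OF frameD(9)[OF fr]] by simp
qed

lemma param_flip:
  assumes "Q \<in> F" "v \<in> V" "e \<in> E" "v \<in> e" "e \<subseteq> Q" and e': "e' \<in> E" "v \<in> e'" "e' \<subseteq> Q" "e \<noteq> e'"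
    and H: "H \<in> hyps Q"
  shows "param v e' H = - param v e H"
proof -
  obtain w u x e1 e2 e3 where fr: "frame Q v w u x e e1 e2 e3" using flag_frame[OF assms(1-5)] by blast
  interpret q: skew_quad "rep v" "rep w" "rep u" "rep x" "nrm v" "nrm w" "nrm u" "nrm x"
    by (rule frame_skew_quad[OF fr])
  note d = frameD[OF fr]
  have e3: "e3 \<inter> V = {v, x}" using d(12) by (simp add: insert_commute)
  have "e' = e1 \<or> e' = e2 \<or> e' = e3" using d(14)[of e'] e' by auto
  moreover have "v \<in> e' \<inter> V" using assms(2) e'(2) by simp
  then have "e' \<noteq> e1" "e' \<noteq> e2" using d(10,11,13) by auto
  ultimately have "e' = e3" by simp
  have "H \<in> quad_hyperboloids (rep v) (rep w) (rep u) (rep x)" using H frame_hyps[OF fr] by simp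
  from q.coef_sign_flip(1)[OF this scale[OF d(5,9), unfolded area_def] scale[OF d(8) e3, unfolded area_def]]
  show ?thesis unfolding \<open>e' = e3\<close> param_eq[OF d(9)] param_eq[OF e3] by simp
qed

lemma param_inject:
  assumes "Q \<in> F" "v \<in> V" "e \<in> E" "v \<in> e" "e \<subseteq> Q" and H: "H \<in> hyps Q" "H' \<in> hyps Q"
    and eq: "param v e H = param v e H'"
  shows "H = H'"
proof -
  have "\<exists>!K. K \<in> hyps Q \<and> param v e K = param v e H"
    by (rule param_bij[OF assms(1-5) param_nonzero[OF assms(1-5) H(1)]])
  then show ?thesis by (rule ex1E) (use H eq in metis)
qed

definition compatible :: "'a set \<Rightarrow> (real^4) set set \<Rightarrow> (real^4) set set \<Rightarrow> bool"
  where "compatible e H H' \<longleftrightarrow> (\<forall>p\<in>points_on (line e). tangent_plane H p = tangent_plane H' p)"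

text \<open>Both faces use the same vertex normals and the same nonzero factor
  \<open>scale v w\<close>, so equality of parameters is equality of the ratios in
  \<open>tangent_planes_agree_iff\<close>.\<close>

lemma compatible_iff_param:
  assumes "Q \<in> F" "Q' \<in> F" "v \<in> V" "e \<in> E" "v \<in> e" "e \<subseteq> Q" "e \<subseteq> Q'" and H: "H \<in> hyps Q" "H' \<in> hyps Q'"
  shows "compatible e H H' \<longleftrightarrow> param v e H = param v e H'"
proof -
  obtain w u x e1 e2 e3 where fr: "frame Q v w u x e e1 e2 e3"
    using flag_frame[OF assms(1,3,4,5,6)] by blast
  obtain w' u' x' e1' e2' e3' where fr': "frame Q' v w' u' x' e e1' e2' e3'"
    using flag_frame[OF assms(2,3,4,5,7)] by blast
  have "{v, w} = {v, w'}" using frameD(9)[OF fr] frameD(9)[OF fr'] by simp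
  then have "w' = w" by (auto simp: doubleton_eq_iff)
  note fr' = fr'[unfolded this]
  show ?thesis
    unfolding compatible_def line_eq[OF frameD(9)[OF fr]] param_eq[OF frameD(9)[OF fr]]
      tangent_planes_agree_iff[OF frame_skew_quad[OF fr] frame_skew_quad[OF fr']
        H[unfolded frame_hyps[OF fr] frame_hyps[OF fr']]]
    using scale_nonzero[OF fr] by (metis mult_cancel_left)
qed

lemma one_parameter_hyps:
  assumes "Q \<in> F" shows "one_parameter_family (hyps Q)"
proof -
  obtain v0 v1 v2 v3 e0 e1 e2 e3 where fr: "frame Q v0 v1 v2 v3 e0 e1 e2 e3" using frame_ex[OF assms] by blast
  show ?thesis unfolding frame_hyps[OF fr] by (rule skew_quad.one_parameter[OF frame_skew_quad[OF fr]])
qed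

section \<open>Germs of pre-hyperbolic nets\<close>

definition faces_at :: "'a \<Rightarrow> 'a set set"
  where "faces_at x = {Q \<in> F. x \<in> Q}"

text \<open>The condition ranges over all shared edges, not only over those through
  \<open>x\<close>, so that passing to fewer faces preserves it at once. For distinct faces the two
  readings coincide by \<open>common_edge_unique\<close>.\<close>

definition germs :: "'a \<Rightarrow> ('a set \<Rightarrow> (real^4) set set) set"
  where "germs x = {\<gamma> \<in> extensional (faces_at x). (\<forall>Q\<in>faces_at x. \<gamma> Q \<in> hyps Q) \<and>
    (\<forall>Q\<in>faces_at x. \<forall>Q'\<in>faces_at x. \<forall>e\<in>E. e \<subseteq> Q \<and> e \<subseteq> Q' \<longrightarrow> compatible e (\<gamma> Q) (\<gamma> Q'))}"

lemma germsI:
  assumes "\<And>Q. Q \<in> F \<Longrightarrow> x \<in> Q \<Longrightarrow> g Q \<in> hyps Q"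
    and "\<And>Q Q' e. Q \<in> F \<Longrightarrow> x \<in> Q \<Longrightarrow> Q' \<in> F \<Longrightarrow> x \<in> Q' \<Longrightarrow> Q \<noteq> Q' \<Longrightarrow> e \<in> E \<Longrightarrow> e \<subseteq> Q \<Longrightarrow> e \<subseteq> Q' \<Longrightarrow>
      compatible e (g Q) (g Q')"
  shows "restrict g (faces_at x) \<in> germs x"
proof -
  have "compatible e (g Q) (g Q')" if "Q \<in> F" "x \<in> Q" "Q' \<in> F" "x \<in> Q'" "e \<in> E" "e \<subseteq> Q" "e \<subseteq> Q'" for Q Q' e
    using assms(2)[OF that(1-4) _ that(5-7)] by (cases "Q = Q'") (simp_all add: compatible_def)
  then show ?thesis unfolding germs_def faces_at_def using assms(1) by simp
qed

lemma germsD: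
  assumes "\<gamma> \<in> germs x"
  shows "\<gamma> \<in> extensional (faces_at x)" "\<And>Q. Q \<in> F \<Longrightarrow> x \<in> Q \<Longrightarrow> \<gamma> Q \<in> hyps Q"
    "\<And>Q Q' e. Q \<in> F \<Longrightarrow> x \<in> Q \<Longrightarrow> Q' \<in> F \<Longrightarrow> x \<in> Q' \<Longrightarrow> e \<in> E \<Longrightarrow> e \<subseteq> Q \<Longrightarrow> e \<subseteq> Q' \<Longrightarrow>
      compatible e (\<gamma> Q) (\<gamma> Q')"
  using assms unfolding germs_def faces_at_def by simp_all

lemma compatible_unique:
  assumes Q: "Q \<in> F" "Q' \<in> F" and e: "e \<in> E" "e \<subseteq> Q" "e \<subseteq> Q'"
    and H: "H \<in> hyps Q" "H1 \<in> hyps Q'" "H2 \<in> hyps Q'" "compatible e H H1" "compatible e H H2"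
  shows "H1 = H2"
proof -
  obtain v where v: "v \<in> V" "v \<in> e" using edge_endpoints[OF e(1)] by blast
  have "param v e H1 = param v e H" "param v e H2 = param v e H"
    using compatible_iff_param[OF Q v(1) e(1) v(2) e(2,3)] H by auto
  then show ?thesis using param_inject[OF Q(2) v(1) e(1) v(2) e(3) H(2,3)] by simp
qed

text \<open>All faces at an inner point of \<open>e\<close> contain \<open>e\<close>, and
  compatibility along \<open>e\<close> is equality of parameters. So each of them receives the
  hyperboloid with the parameter of \<open>H0\<close>.\<close>

lemma germs_at_edge_exist:
  assumes x: "x \<in> e" "e \<in> E" "x \<notin> V" and Q0: "Q0 \<in> F" "x \<in> Q0" and H0: "H0 \<in> hyps Q0"
  shows "\<exists>\<gamma>\<in>germs x. \<gamma> Q0 = H0"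
proof -
  obtain v where v: "v \<in> V" "v \<in> e" using edge_endpoints[OF x(2)] by blast
  have sub: "e \<subseteq> Q" if "Q \<in> F" "x \<in> Q" for Q using edge_subset_face[OF x(2) that(1) x(1) that(2) x(3)] .
  define r where "r = param v e H0"
  have r: "r \<noteq> 0" unfolding r_def by (rule param_nonzero[OF Q0(1) v(1) x(2) v(2) sub[OF Q0] H0])
  define g where "g Q = (THE H. H \<in> hyps Q \<and> param v e H = r)" for Q
  have g: "g Q \<in> hyps Q \<and> param v e (g Q) = r" if "Q \<in> F" "x \<in> Q" for Q
    unfolding g_def by (rule theI'[OF param_bij[OF that(1) v(1) x(2) v(2) sub[OF that] r]])
  have "restrict g (faces_at x) \<in> germs x"
  proof (rule germsI)
    show "g Q \<in> hyps Q" if "Q \<in> F" "x \<in> Q" for Q using g[OF that] by simp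
    fix Q Q' e' assume a: "Q \<in> F" "x \<in> Q" "Q' \<in> F" "x \<in> Q'" "Q \<noteq> Q'" "e' \<in> E" "e' \<subseteq> Q" "e' \<subseteq> Q'"
    have "x \<in> e'" by (rule common_edge_unique(2)[OF a(1,3,5,6,7,8,2,4)])
    then have ee: "e' = e" by (rule edge_eqI[OF a(6) x(2) _ x(1,3)])
    show "compatible e' (g Q) (g Q')"
      unfolding ee compatible_iff_param[OF a(1,3) v(1) x(2) v(2) sub[OF a(1,2)] sub[OF a(3,4)]
          g[OF a(1,2), THEN conjunct1] g[OF a(3,4), THEN conjunct1]]
      using g[OF a(1,2)] g[OF a(3,4)] by simp
  qed
  moreover have "g Q0 = H0"
    by (rule param_inject[OF Q0(1) v(1) x(2) v(2) sub[OF Q0] _ H0]) (use g[OF Q0] in \<open>simp_all add: r_def\<close>)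
  then have "restrict g (faces_at x) Q0 = H0" using Q0 unfolding faces_at_def by simp
  ultimately show ?thesis by blast
qed

text \<open>Parameters \<open>r\<close> and \<open>- r\<close> are prescribed on the edges at
  \<open>v\<close> according to their colour. The two edges of a face have different colours, in
  accordance with \<open>param_flip\<close>, so one hyperboloid per face realises both values; an
  edge then sees the same value from all its faces.\<close>

lemma germs_at_vertex_exist:
  assumes v: "v \<in> V" and even: "v \<in> surface_interior S \<Longrightarrow> even (vertex_degree E v)"
    and Q0: "Q0 \<in> F" "v \<in> Q0" and H0: "H0 \<in> hyps Q0"
  shows "\<exists>\<gamma>\<in>germs v. \<gamma> Q0 = H0"
proof -
  obtain col :: "'a set \<Rightarrow> bool" where col: "\<forall>Q\<in>F. v \<in> Q \<longrightarrow> (\<forall>e\<in>E. \<forall>e'\<in>E.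
    v \<in> e \<and> e \<subseteq> Q \<and> v \<in> e' \<and> e' \<subseteq> Q \<and> e \<noteq> e' \<longrightarrow> col e \<noteq> col e')"
    using link_colouring[OF v even] by blast
  have edge: "\<exists>e. e \<in> E \<and> v \<in> e \<and> e \<subseteq> Q" if Q: "Q \<in> F" "v \<in> Q" for Q
  proof -
    obtain e e' where "{e \<in> E. v \<in> e \<and> e \<subseteq> Q} = {e, e'}" using face_vertex_edges[OF Q(1) v Q(2)] by blast
    then have "e \<in> {e \<in> E. v \<in> e \<and> e \<subseteq> Q}" by simp
    then show ?thesis by blast
  qed
  obtain e0 where e0: "e0 \<in> E" "v \<in> e0" "e0 \<subseteq> Q0" using edge[OF Q0] by blast
  define r where "r = param v e0 H0"
  have r: "r \<noteq> 0" unfolding r_def by (rule param_nonzero[OF Q0(1) v e0(1,2,3) H0])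
  define s where "s e = (if col e = col e0 then r else - r)" for e
  have s: "s e \<noteq> 0" for e unfolding s_def using r by simp
  have spread: "param v e' H = s e'"
    if Q: "Q \<in> F" "v \<in> Q" and e: "e \<in> E" "v \<in> e" "e \<subseteq> Q" and e': "e' \<in> E" "v \<in> e'" "e' \<subseteq> Q"
      and H: "H \<in> hyps Q" "param v e H = s e" for Q e e' H
  proof (cases "e = e'")
    case False
    have "col e \<noteq> col e'" using col[rule_format, OF Q e(1) e'(1)] e e' False by simp
    then have "s e' = - s e" unfolding s_def by auto
    then show ?thesis using param_flip[OF Q(1) v e(1,2,3) e'(1,2,3) False H(1)] H(2) by simp
  qed (use H in simp)
  have "\<exists>H. H \<in> hyps Q \<and> (\<forall>e\<in>E. v \<in> e \<and> e \<subseteq> Q \<longrightarrow> param v e H = s e)" if Q: "Q \<in> F" "v \<in> Q" for Q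
  proof -
    obtain e where e: "e \<in> E" "v \<in> e" "e \<subseteq> Q" using edge[OF Q] by blast
    obtain H where H: "H \<in> hyps Q" "param v e H = s e" using param_bij[OF Q(1) v e s[of e]] by blast
    show ?thesis using spread[OF Q e _ _ _ H] H(1) by blast
  qed
  then have "\<forall>Q. \<exists>H. Q \<in> F \<and> v \<in> Q \<longrightarrow> H \<in> hyps Q \<and> (\<forall>e\<in>E. v \<in> e \<and> e \<subseteq> Q \<longrightarrow> param v e H = s e)" by blast
  then obtain g where g: "\<forall>Q. Q \<in> F \<and> v \<in> Q \<longrightarrow> g Q \<in> hyps Q \<and> (\<forall>e\<in>E. v \<in> e \<and> e \<subseteq> Q \<longrightarrow> param v e (g Q) = s e)"
    by (rule choice[THEN exE])
  have gh: "g Q \<in> hyps Q" if "Q \<in> F" "v \<in> Q" for Q using g that by simp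
  have gp: "param v e (g Q) = s e" if "Q \<in> F" "v \<in> Q" "e \<in> E" "v \<in> e" "e \<subseteq> Q" for Q e using g that by simp
  have "restrict g (faces_at v) \<in> germs v"
  proof (rule germsI)
    show "g Q \<in> hyps Q" if "Q \<in> F" "v \<in> Q" for Q by (rule gh[OF that])
    fix Q Q' e assume a: "Q \<in> F" "v \<in> Q" "Q' \<in> F" "v \<in> Q'" "Q \<noteq> Q'" "e \<in> E" "e \<subseteq> Q" "e \<subseteq> Q'"
    have ve: "v \<in> e" by (rule common_edge_unique(2)[OF a(1,3,5,6,7,8,2,4)])
    show "compatible e (g Q) (g Q')"
      unfolding compatible_iff_param[OF a(1,3) v a(6) ve a(7,8) gh[OF a(1,2)] gh[OF a(3,4)]]
      by (simp add: gp a ve)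
  qed
  moreover have "g Q0 = H0"
  proof -
    have "param v e0 (g Q0) = r" using gp[OF Q0 e0] unfolding s_def by simp
    then show ?thesis by (intro param_inject[OF Q0(1) v e0 gh[OF Q0] H0]) (simp add: r_def)
  qed
  then have "restrict g (faces_at v) Q0 = H0" using Q0 unfolding faces_at_def by simp
  ultimately show ?thesis by blast
qed

text \<open>Agreement passes from a face to any face at \<open>x\<close> sharing an edge with it. At
  a vertex \<open>link_connected\<close> carries it to all faces; at an inner point of an edge, any
  two faces share that edge.\<close>

lemma germs_unique:
  assumes Q0: "Q0 \<in> F" "x \<in> Q0" and \<gamma>: "\<gamma> \<in> germs x" "\<gamma>' \<in> germs x" "\<gamma> Q0 = \<gamma>' Q0"
  shows "\<gamma> = \<gamma>'"
proof -
  have share: "\<gamma> Q' = \<gamma>' Q'"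
    if Q: "Q \<in> F" "x \<in> Q" "Q' \<in> F" "x \<in> Q'" "e \<in> E" "e \<subseteq> Q" "e \<subseteq> Q'" "\<gamma> Q = \<gamma>' Q" for Q Q' e
  proof (rule compatible_unique[OF Q(1,3,5,6,7)])
    show "\<gamma> Q \<in> hyps Q" "\<gamma> Q' \<in> hyps Q'" "\<gamma>' Q' \<in> hyps Q'"
      using germsD(2)[OF \<gamma>(1)] germsD(2)[OF \<gamma>(2)] Q(1-4) by simp_all
    show "compatible e (\<gamma> Q) (\<gamma> Q')" by (rule germsD(3)[OF \<gamma>(1) Q(1-7)])
    show "compatible e (\<gamma> Q) (\<gamma>' Q')" unfolding Q(8) by (rule germsD(3)[OF \<gamma>(2) Q(1-7)])
  qed
  have all: "\<gamma> Q = \<gamma>' Q" if Q: "Q \<in> F" "x \<in> Q" for Q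
  proof (cases "x \<in> V")
    case True
    define A where "A = {Q \<in> F. x \<in> Q \<and> \<gamma> Q = \<gamma>' Q}"
    have "A = {Q \<in> F. x \<in> Q}"
    proof (rule ccontr)
      assume "A \<noteq> {Q \<in> F. x \<in> Q}"
      moreover have "A \<subseteq> {Q \<in> F. x \<in> Q}" "A \<noteq> {}" using Q0 \<gamma>(3) unfolding A_def by auto
      ultimately obtain P P' e where P: "P \<in> A" "P' \<in> {Q \<in> F. x \<in> Q} - A" "e \<in> E" "e \<subseteq> P" "e \<subseteq> P'"
        using link_connected[OF True, of A] by blast
      then have "\<gamma> P' = \<gamma>' P'" using share[of P P' e] unfolding A_def by simp
      then show False using P(2) unfolding A_def by blast
    qed
    then have "Q \<in> A" using Q by simp
    then show ?thesis unfolding A_def by simp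
  next
    case False
    show ?thesis
    proof (cases "Q = Q0")
      case False
      then have "x \<in> \<Union>E" using faces_disjoint[OF Q(1) Q0(1)] Q Q0 by blast
      then obtain e where e: "e \<in> E" "x \<in> e" by blast
      show ?thesis
        by (rule share[OF Q0 Q e(1) _ _ \<gamma>(3)])
          (use edge_subset_face[OF e(1) _ e(2) _ \<open>x \<notin> V\<close>] Q Q0 in simp_all)
    qed (use \<gamma>(3) in simp)
  qed
  show ?thesis
  proof (rule extensionalityI[OF germsD(1)[OF \<gamma>(1)] germsD(1)[OF \<gamma>(2)]])
    show "\<gamma> Q = \<gamma>' Q" if "Q \<in> faces_at x" for Q using all that unfolding faces_at_def by simp
  qed
qed

lemma germs_exist:
  assumes even: "\<forall>v\<in>V \<inter> surface_interior S. even (vertex_degree E v)"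
    and Q0: "Q0 \<in> F" "x \<in> Q0" and H0: "H0 \<in> hyps Q0"
  shows "\<exists>\<gamma>\<in>germs x. \<gamma> Q0 = H0"
proof (cases "x \<in> V")
  case True
  show ?thesis by (rule germs_at_vertex_exist[OF True _ Q0 H0]) (use even True in simp)
next
  case False
  show ?thesis
  proof (cases "x \<in> \<Union>E")
    case True
    then obtain e where "e \<in> E" "x \<in> e" by blast
    then show ?thesis using germs_at_edge_exist[OF _ _ False Q0 H0] by blast
  next
    case no_edge: False
    have only: "Q = Q0" if "Q \<in> F" "x \<in> Q" for Q
      using faces_disjoint[OF that(1) Q0(1)] that(2) Q0(2) no_edge by blast
    have "restrict (\<lambda>_. H0) (faces_at x) \<in> germs x"
    proof (rule germsI)
      show "H0 \<in> hyps Q" if "Q \<in> F" "x \<in> Q" for Q using only[OF that] H0 by simp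
      show "compatible e H0 H0" for e by (simp add: compatible_def)
    qed
    moreover have "restrict (\<lambda>_. H0) (faces_at x) Q0 = H0" using Q0 unfolding faces_at_def by simp
    ultimately show ?thesis by blast
  qed
qed

lemma germs_local_system:
  assumes even: "\<forall>v\<in>V \<inter> surface_interior S. even (vertex_degree E v)"
  shows "local_system S faces_at germs"
proof
  show "\<exists>U. openin (top_of_set S) U \<and> x \<in> U \<and> (\<forall>y\<in>U. faces_at y \<subseteq> faces_at x)" if x: "x \<in> S" for x
  proof -
    obtain U where U: "openin (top_of_set S) U" "x \<in> U"
      "\<forall>c\<in>closed_cells V E F. c \<inter> U \<noteq> {} \<longrightarrow> x \<in> c" using star_nbhd[OF x] by blast
    have "faces_at y \<subseteq> faces_at x" if y: "y \<in> U" for y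
    proof
      fix Q assume "Q \<in> faces_at y"
      then have Q: "Q \<in> F" "y \<in> Q" unfolding faces_at_def by auto
      then have "Q \<in> closed_cells V E F" "Q \<inter> U \<noteq> {}" using y unfolding closed_cells_iff by auto
      then show "Q \<in> faces_at x" using U(3) Q(1) unfolding faces_at_def by simp
    qed
    then show ?thesis using U(1,2) by blast
  qed
  show ne: "faces_at x \<noteq> {}" if "x \<in> S" for x using point_in_face[OF that] unfolding faces_at_def by blast
  show "g \<in> extensional (faces_at x)" if "g \<in> germs x" for x g using germsD(1)[OF that] .
  show restr: "restrict g (faces_at y) \<in> germs y" if sub: "faces_at y \<subseteq> faces_at x" and g: "g \<in> germs x" for x y g
  proof (rule germsI)
    have in_x: "x \<in> Q" if "Q \<in> F" "y \<in> Q" for Q using sub that unfolding faces_at_def by blast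
    show "g Q \<in> hyps Q" if "Q \<in> F" "y \<in> Q" for Q by (rule germsD(2)[OF g that(1) in_x[OF that]])
    show "compatible e (g Q) (g Q')"
      if "Q \<in> F" "y \<in> Q" "Q' \<in> F" "y \<in> Q'" "e \<in> E" "e \<subseteq> Q" "e \<subseteq> Q'" for Q Q' e
      by (rule germsD(3)[OF g that(1) in_x[OF that(1,2)] that(3) in_x[OF that(3,4)] that(5-7)])
  qed
  show uniq: "g = g'" if "i \<in> faces_at x" "g \<in> germs x" "g' \<in> germs x" "g i = g' i" for x i g g'
    using germs_unique[of i x g g'] that unfolding faces_at_def by simp
  show "\<exists>g'\<in>germs x. restrict g' (faces_at y) = g"
    if x: "x \<in> S" "y \<in> S" and sub: "faces_at y \<subseteq> faces_at x" and g: "g \<in> germs y" for x y g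
  proof -
    obtain Q where Q: "Q \<in> faces_at y" using ne[OF x(2)] by blast
    then have Qy: "Q \<in> F" "y \<in> Q" and Qx: "x \<in> Q" using sub unfolding faces_at_def by auto
    \<comment> \<open>Only the value of \<open>g\<close> on one face is extended; uniqueness at
      \<open>y\<close> then forces the restriction to be all of \<open>g\<close>.\<close>
    obtain g' where g': "g' \<in> germs x" "g' Q = g Q" using germs_exist[OF even Qy(1) Qx germsD(2)[OF g Qy]] by blast
    have "restrict g' (faces_at y) = g"
      by (rule uniq[OF Q restr[OF sub g'(1)] g]) (use Q g'(2) in simp)
    then show ?thesis using g'(1) by blast
  qed
qed

text \<open>Every face contains a point, and an edge shared by two faces contains a point of both,
  so the conditions on a net can be checked at points.\<close>

lemma net_iff_germs:
  "pre_hyperbolic_net V E F f N \<longleftrightarrow> N \<in> extensional F \<and> (\<forall>x\<in>S. restrict N (faces_at x) \<in> germs x)"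
proof
  assume net: "pre_hyperbolic_net V E F f N"
  note net' = net[unfolded pre_hyperbolic_net_def, THEN conjunct2]
  have "restrict N (faces_at x) \<in> germs x" for x
  proof (rule germsI)
    show "N Q \<in> hyps Q" if "Q \<in> F" for Q using net'[THEN conjunct1] that by (rule bspec)
    show "compatible e (N Q) (N Q')" if "Q \<in> F" "Q' \<in> F" "e \<in> E" "e \<subseteq> Q" "e \<subseteq> Q'" for Q Q' e
      unfolding compatible_def
      by (rule net'[THEN conjunct2, THEN bspec, THEN bspec, THEN bspec, THEN mp, OF that(1-3) conjI[OF that(4,5)]])
  qed
  then show "N \<in> extensional F \<and> (\<forall>x\<in>S. restrict N (faces_at x) \<in> germs x)"
    using net unfolding pre_hyperbolic_net_def by simp
next
  assume N: "N \<in> extensional F \<and> (\<forall>x\<in>S. restrict N (faces_at x) \<in> germs x)"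
  have hyp: "N Q \<in> hyps Q" if Q: "Q \<in> F" for Q
  proof -
    obtain x where x: "x \<in> Q" using face_not_in_edges[OF Q] by blast
    then have "restrict N (faces_at x) \<in> germs x" using N face_subset_S[OF Q] by blast
    from germsD(2)[OF this Q x] show ?thesis using Q x unfolding faces_at_def by simp
  qed
  have comp: "compatible e (N Q) (N Q')" if Q: "Q \<in> F" "Q' \<in> F" "e \<in> E" "e \<subseteq> Q" "e \<subseteq> Q'" for Q Q' e
  proof -
    obtain x where x: "x \<in> e" using edge_inner_point[OF Q(3)] by blast
    then have xQ: "x \<in> Q" "x \<in> Q'" using Q(4,5) by auto
    then have "restrict N (faces_at x) \<in> germs x" using N face_subset_S[OF Q(1)] by blast
    from germsD(3)[OF this Q(1) xQ(1) Q(2) xQ(2) Q(3-5)] show ?thesis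
      using Q(1,2) xQ unfolding faces_at_def by simp
  qed
  show "pre_hyperbolic_net V E F f N"
    unfolding pre_hyperbolic_net_def
  proof (intro conjI ballI impI)
    show "N \<in> extensional F" using N by (rule conjunct1)
    show "N Q \<in> hyps Q" if "Q \<in> F" for Q by (rule hyp[OF that])
    show "tangent_plane (N Q) p = tangent_plane (N Q') p"
      if "Q \<in> F" "Q' \<in> F" "e \<in> E" "e \<subseteq> Q \<and> e \<subseteq> Q'" "p \<in> points_on (line e)" for Q Q' e p
      using comp[OF that(1-3) conjunct1[OF that(4)] conjunct2[OF that(4)]] that(5)
      unfolding compatible_def by (rule bspec)
  qed
qed

lemma cell_of_index_path_connected: "path_connected {x \<in> S. Q \<in> faces_at x}"
proof (cases "Q \<in> F")
  case True
  then have "{x \<in> S. Q \<in> faces_at x} = Q" using face_subset_S[OF True] unfolding faces_at_def by auto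
  then show ?thesis using face_path_connected[OF True] by simp
qed (simp add: faces_at_def)

text \<open>The hyperboloid \<open>H\<close> is spread to a germ at a point of \<open>Q\<close> and
  continued over \<open>S\<close>. The resulting function may take arbitrary values outside
  \<open>F\<close>, so it is cut down to \<open>F\<close> to become a net.\<close>

lemma net_exists_unique:
  assumes sc: "simply_connected S" and even: "\<forall>v\<in>V \<inter> surface_interior S. even (vertex_degree E v)"
    and Q: "Q \<in> F" and H: "H \<in> hyps Q"
  shows "\<exists>!N. pre_hyperbolic_net V E F f N \<and> N Q = H"
proof -
  interpret L: local_system S faces_at germs by (rule germs_local_system[OF even])
  obtain x where x: "x \<in> Q" using face_not_in_edges[OF Q] by blast
  then have xS: "x \<in> S" using face_subset_S[OF Q] by blast
  obtain g where g: "g \<in> germs x" "g Q = H" using germs_exist[OF even Q x H] by blast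
  obtain N where N: "\<forall>x\<in>S. restrict N (faces_at x) \<in> germs x" "restrict N (faces_at x) = g"
    using L.global_section_exists[OF sc cell_of_index_path_connected xS g(1)] by blast
  have sub: "faces_at y \<subseteq> F" for y unfolding faces_at_def by blast
  show ?thesis
  proof (rule ex1I)
    have "restrict (restrict N F) (faces_at y) = restrict N (faces_at y)" for y
      using sub[of y] by (auto simp: restrict_def fun_eq_iff)
    then have "pre_hyperbolic_net V E F f (restrict N F)" unfolding net_iff_germs using N(1) by simp
    moreover have "restrict N F Q = H" using fun_cong[OF N(2), of Q] g(2) Q x unfolding faces_at_def by simp
    ultimately show "pre_hyperbolic_net V E F f (restrict N F) \<and> restrict N F Q = H" by simp
    fix M assume M: "pre_hyperbolic_net V E F f M \<and> M Q = H"
    show "M = restrict N F"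
    proof (rule extensionalityI[of _ F])
      show "M \<in> extensional F" using M unfolding net_iff_germs by simp
      fix P assume P: "P \<in> F"
      obtain y where y: "y \<in> P" using face_not_in_edges[OF P] by blast
      have yS: "y \<in> S" using y face_subset_S[OF P] by blast
      have "M P = N P"
      proof (rule L.global_section_unique[OF sc _ _ xS _ _ yS])
        show "restrict M (faces_at z) \<in> germs z" "restrict N (faces_at z) \<in> germs z" if "z \<in> S" for z
          using M N(1) that unfolding net_iff_germs by simp_all
        show "Q \<in> faces_at x" "P \<in> faces_at y" using Q P x y unfolding faces_at_def by simp_all
        show "M Q = N Q" using M \<open>restrict N F Q = H\<close> Q by simp
      qed
      then show "M P = restrict N F P" using P by simp
    qed simp
  qed
qed

end

theorem theorem14:
  fixes S V :: "'a::t2_space set" and E F :: "'a set set" and f :: "'a \<Rightarrow> (real^4) set"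
  assumes "quad_graph S V E F"
    and "simply_connected S"
    and "\<forall>v \<in> V \<inter> surface_interior S. even (vertex_degree E v)"
    and "generic_A_net V E f"
  shows "\<forall>Q\<in>F.
    one_parameter_family (face_hyperboloids V E f Q) \<and>
    (\<forall>H \<in> face_hyperboloids V E f Q. \<exists>!\<N>. pre_hyperbolic_net V E F f \<N> \<and> \<N> Q = H)"
proof -
  interpret generic_net S V E F f
    by (intro generic_net.intro generic_net_axioms.intro) (fact assms)+
  show ?thesis
    by (intro ballI conjI) (rule one_parameter_hyps net_exists_unique[OF assms(2,3)]; assumption)+
qed

end
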